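(* There are infinitely many generalized Wallach spaces $G/H$ such that on each of them every generic invariant metric with positive Ricci curvature loses the positivity of the Ricci curvature under the normalized Ricci flow. That is: for each of these spaces, with parameters $(a_1,a_2,a_3)$, and for every initial point $\mathbf{x}(0)\in\mathscr{R}_+$ with pairwise distinct coordinates $x_1(0),x_2(0),x_3(0)$, if $\mathbf{x}(t)$, $t\in[0,T)$, denotes the maximal solution of the normalized Ricci flow system starting at $\mathbf{x}(0)$, then there exists a finite time $t_0\in(0,T)$ such that $\mathbf{x}(t)\notin\mathscr{R}_+$ for all $t\in[t_0,T)$.
   Context: A generalized Wallach space (GWS) is a homogeneous space $G/H$, where $G$ is a compact (semisimple) Lie group with Lie algebra $\mathfrak{g}$ and $H$ is a closed subgroup with Lie algebra $\mathfrak{h}$, such that the orthogonal complement $\mathfrak{p}$ of $\mathfrak{h}$ in $\mathfrak{g}$ with respect to $\langle\cdot,\cdot\rangle=-B(\cdot,\cdot)$ ($B$ the Killing form of $\mathfrak{g}$) decomposes as an orthogonal direct sum $\mathfrak{p}=\mathfrak{p}_1\oplus\mathfrak{p}_2\oplus\mathfrak{p}_3$ of three irreducible $\mathrm{Ad}(H)$-modules satisfying $[\mathfrak{p}_i,\mathfrak{p}_i]\subset\mathfrak{h}$ for each $i\in\{1,2,3\}$. Spaces are counted up to isomorphism of the pair $(\mathfrak{g},\mathfrak{h})$. Each GWS is described by a triple $(a_1,a_2,a_3)\in(0,1/2]^3$, given by $a_i=A/d_i$, where $d_i=\dim\mathfrak{p}_i$ and $A=\sum_{\alpha,\beta,\gamma}\langle[e^1_\alpha,e^2_\beta],e^3_\gamma\rangle^2$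 with $\{e^i_\alpha\}$ a $\langle\cdot,\cdot\rangle$-orthonormal basis of $\mathfrak{p}_i$. The invariant Riemannian metrics considered are $\mathbf{g}=x_1\langle\cdot,\cdot\rangle|_{\mathfrak{p}_1}+x_2\langle\cdot,\cdot\rangle|_{\mathfrak{p}_2}+x_3\langle\cdot,\cdot\rangle|_{\mathfrak{p}_3}$ with $x_1,x_2,x_3>0$; such a metric is identified with $\mathbf{x}=(x_1,x_2,x_3)\in(0,+\infty)^3$. It is called generic if $x_1,x_2,x_3$ are pairwise distinct. Its Ricci tensor is $\operatorname{Ric}_{\mathbf g}=\sum_{i=1}^3 x_i\mathbf{r}_i\langle\cdot,\cdot\rangle|_{\mathfrak{p}_i}$, where $$\mathbf{r}_i=\frac{1}{2x_i}+\frac{a_i}{2}\left(\frac{x_i}{x_jx_k}-\frac{x_j}{x_kx_i}-\frac{x_k}{x_ix_j}\right),\qquad \{i,j,k\}=\{1,2,3\}.$$ Set $\mathscr{R}_+=\{\mathbf{x}\in(0,+\infty)^3 : \mathbf{r}_1>0,\ \mathbf{r}_2>0,\ \mathbf{r}_3>0\}$; thus $\operatorname{Ric}_{\mathbf g}>0$ is equivalent to $\mathbf{x}\in\mathscr{R}_+$. The normalized Ricci flow $\partial_t\mathbf{g}(t)=-2\operatorname{Ric}_{\mathbf g}+2\mathbf{g}(t)S_{\mathbf g}/n$ ($S_{\mathbf g}$ the scalar curvature, $n=\dim G/H$) on these metrics is the autonomous system on $(0,+\infty)^3$ $$\dot{x}_i=-2x_i\left(\mathbf{r}_i-\frac{a_1^{-1}\mathbf{r}_1+a_2^{-1}\mathbf{r}_2+a_3^{-1}\mathbf{r}_3}{a_1^{-1}+a_2^{-1}+a_3^{-1}}\right),\qquad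 i=1,2,3.$$ *)

theory Defs
  imports "HOL-Analysis.Analysis" "Jordan_Normal_Form.Matrix"
begin

section \<open>Compact Lie groups and their Lie algebras\<close>

text \<open>
  A compact Lie group has a faithful finite-dimensional complex representation, so compact
  Lie groups are, up to isomorphism, the compact subgroups of \<open>GL(n, \<complex>)\<close>. A group is given here by
  the size \<open>n\<close> and a set of complex matrices. Lie algebras are real subspaces of the complex
  \<open>n \<times> n\<close> matrices; all linear algebra below is over the reals.
\<close>

definition general_linear :: "nat \<Rightarrow> complex mat monoid" where
  "general_linear n = units_of (ring_mat TYPE(complex) n ())"

definition mat_topology :: "nat \<Rightarrow> complex mat topology" where
  "mat_topology n =
     pullback_topology (carrier_mat n n) (\<lambda>A. \<lambda>ij \<in> {..<n} \<times> {..<n}. A $$ ij)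
       (product_topology (\<lambda>_. euclidean) ({..<n} \<times> {..<n}))"

definition compact_lie_group :: "nat \<Rightarrow> complex mat set \<Rightarrow> bool" where
  "compact_lie_group n G \<longleftrightarrow> subgroup G (general_linear n) \<and> compactin (mat_topology n) G"

definition closed_subgroup :: "nat \<Rightarrow> complex mat set \<Rightarrow> complex mat set \<Rightarrow> bool" where
  "closed_subgroup n G H \<longleftrightarrow>
     subgroup H (general_linear n) \<and> closedin (subtopology (mat_topology n) G) H"

text \<open>The Lie algebra is the tangent space at the identity: velocities of differentiable curves.\<close>

definition lie_algebra :: "nat \<Rightarrow> complex mat set \<Rightarrow> complex mat set" where
  "lie_algebra n G = {X \<in> carrier_mat n n. \<exists>\<gamma> :: real \<Rightarrow> complex mat.
     (\<forall>t. \<gamma> t \<in> G) \<and> \<gamma> 0 = 1\<^sub>m n \<and>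
     (\<forall>i<n. \<forall>j<n. (\<forall>t. (\<lambda>s. \<gamma> s $$ (i, j)) differentiable (at t)) \<and>
        ((\<lambda>s. \<gamma> s $$ (i, j)) has_vector_derivative X $$ (i, j)) (at 0))}"

definition lie_bracket :: "complex mat \<Rightarrow> complex mat \<Rightarrow> complex mat" where
  "lie_bracket X Y = X * Y - Y * X"

definition Ad :: "nat \<Rightarrow> complex mat \<Rightarrow> complex mat \<Rightarrow> complex mat" where
  "Ad n h X = h * X * inv\<^bsub>general_linear n\<^esub> h"

definition real_smult :: "real \<Rightarrow> complex mat \<Rightarrow> complex mat" where
  "real_smult c X = complex_of_real c \<cdot>\<^sub>m X"

definition real_subspace :: "nat \<Rightarrow> complex mat set \<Rightarrow> bool" where
  "real_subspace n V \<longleftrightarrow> V \<subseteq> carrier_mat n n \<and> 0\<^sub>m n n \<in> V \<and>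
     (\<forall>X\<in>V. \<forall>Y\<in>V. X + Y \<in> V) \<and> (\<forall>c. \<forall>X\<in>V. real_smult c X \<in> V)"

definition lie_ideal :: "nat \<Rightarrow> complex mat set \<Rightarrow> complex mat set \<Rightarrow> bool" where
  "lie_ideal n \<gg> I \<longleftrightarrow> real_subspace n I \<and> I \<subseteq> \<gg> \<and> (\<forall>X\<in>\<gg>. \<forall>Y\<in>I. lie_bracket X Y \<in> I)"

definition semisimple :: "nat \<Rightarrow> complex mat set \<Rightarrow> bool" where
  "semisimple n \<gg> \<longleftrightarrow>
     (\<forall>I. lie_ideal n \<gg> I \<and> (\<forall>X\<in>I. \<forall>Y\<in>I. lie_bracket X Y = 0\<^sub>m n n) \<longrightarrow> I = {0\<^sub>m n n})"


section \<open>Bases and the Killing form\<close>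

definition coefficients :: "nat \<Rightarrow> (nat \<Rightarrow> real) set" where
  "coefficients d = {c. \<forall>k\<ge>d. c k = 0}"

definition real_comb :: "nat \<Rightarrow> nat \<Rightarrow> (nat \<Rightarrow> complex mat) \<Rightarrow> (nat \<Rightarrow> real) \<Rightarrow> complex mat" where
  "real_comb n d b c = mat n n (\<lambda>ij. \<Sum>k<d. complex_of_real (c k) * b k $$ ij)"

text \<open>
  The family \<open>b 0, \<dots>, b (d - 1)\<close> is a basis of \<open>V\<close> over the reals, so that \<open>d\<close> is the
  dimension of \<open>V\<close>.
\<close>

definition real_basis :: "nat \<Rightarrow> complex mat set \<Rightarrow> nat \<Rightarrow> (nat \<Rightarrow> complex mat) \<Rightarrow> bool" where
  "real_basis n V d b \<longleftrightarrow>
     (\<forall>k<d. b k \<in> carrier_mat n n) \<and> bij_betw (real_comb n d b) (coefficients d) V"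

definition coord :: "nat \<Rightarrow> nat \<Rightarrow> (nat \<Rightarrow> complex mat) \<Rightarrow> complex mat \<Rightarrow> nat \<Rightarrow> real" where
  "coord n d b = inv_into (coefficients d) (real_comb n d b)"

text \<open>The trace of a linear endomorphism \<open>f\<close> of \<open>V\<close>; it does not depend on the basis chosen.\<close>

definition endo_trace :: "nat \<Rightarrow> complex mat set \<Rightarrow> (complex mat \<Rightarrow> complex mat) \<Rightarrow> real" where
  "endo_trace n V f =
     (let (d, b) = (SOME (d, b). real_basis n V d b) in \<Sum>k<d. coord n d b (f (b k)) k)"

definition killing_form :: "nat \<Rightarrow> complex mat set \<Rightarrow> complex mat \<Rightarrow> complex mat \<Rightarrow> real" where
  "killing_form n \<gg> X Y = endo_trace n \<gg> (\<lambda>Z. lie_bracket X (lie_bracket Y Z))"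

definition ip :: "nat \<Rightarrow> complex mat set \<Rightarrow> complex mat \<Rightarrow> complex mat \<Rightarrow> real" where
  "ip n \<gg> X Y = - killing_form n \<gg> X Y"

definition orthonormal_basis ::
  "nat \<Rightarrow> complex mat set \<Rightarrow> complex mat set \<Rightarrow> nat \<Rightarrow> (nat \<Rightarrow> complex mat) \<Rightarrow> bool" where
  "orthonormal_basis n \<gg> V d e \<longleftrightarrow> real_basis n V d e \<and>
     (\<forall>k<d. \<forall>l<d. ip n \<gg> (e k) (e l) = (if k = l then 1 else 0))"

definition orthogonal_complement ::
  "nat \<Rightarrow> complex mat set \<Rightarrow> complex mat set \<Rightarrow> complex mat set" where
  "orthogonal_complement n \<gg> \<hh> = {X \<in> \<gg>. \<forall>Y\<in>\<hh>. ip n \<gg> X Y = 0}"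


section \<open>Generalized Wallach spaces\<close>

definition irreducible_Ad_module :: "nat \<Rightarrow> complex mat set \<Rightarrow> complex mat set \<Rightarrow> bool" where
  "irreducible_Ad_module n H V \<longleftrightarrow>
     real_subspace n V \<and> V \<noteq> {0\<^sub>m n n} \<and> (\<forall>h\<in>H. \<forall>X\<in>V. Ad n h X \<in> V) \<and>
     (\<forall>W. real_subspace n W \<and> W \<subseteq> V \<and> (\<forall>h\<in>H. \<forall>X\<in>W. Ad n h X \<in> W) \<longrightarrow>
        W = {0\<^sub>m n n} \<or> W = V)"

text \<open>
  No nonzero ideal of the Lie algebra of \<open>G\<close> lies in that of \<open>H\<close>. This is the usual standing
  assumption on homogeneous spaces. Without it, \<open>G/H\<close> and \<open>(G \<times> K)/(H \<times> K)\<close> would be the same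
  space counted with non-isomorphic pairs of Lie algebras.
\<close>

definition almost_effective :: "nat \<Rightarrow> complex mat set \<Rightarrow> complex mat set \<Rightarrow> bool" where
  "almost_effective n \<gg> \<hh> \<longleftrightarrow> (\<forall>I. lie_ideal n \<gg> I \<and> I \<subseteq> \<hh> \<longrightarrow> I = {0\<^sub>m n n})"

text \<open>
  The modules are indexed by the three-element type \<open>3\<close>, whose arithmetic is modulo 3. For
  semisimple compact \<open>G\<close> the form \<^const>\<open>ip\<close> is positive definite, so the orthogonal sum of the
  modules is direct.
\<close>

definition generalized_wallach_space ::
  "nat \<Rightarrow> complex mat set \<Rightarrow> complex mat set \<Rightarrow> (3 \<Rightarrow> complex mat set) \<Rightarrow> bool" where
  "generalized_wallach_space n G H p \<longleftrightarrow>
     (let \<gg> = lie_algebra n G; \<hh> = lie_algebra n H in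
        compact_lie_group n G \<and> semisimple n \<gg> \<and>
        H \<subseteq> G \<and> closed_subgroup n G H \<and> almost_effective n \<gg> \<hh> \<and>
        orthogonal_complement n \<gg> \<hh> = {X 0 + X 1 + X 2 | X. \<forall>i. X i \<in> p i} \<and>
        (\<forall>i j. i \<noteq> j \<longrightarrow> (\<forall>X\<in>p i. \<forall>Y\<in>p j. ip n \<gg> X Y = 0)) \<and>
        (\<forall>i. irreducible_Ad_module n H (p i)) \<and>
        (\<forall>i. \<forall>X\<in>p i. \<forall>Y\<in>p i. lie_bracket X Y \<in> \<hh>))"

text \<open>
  The parameters \<open>a i = A / d i\<close>. The value of \<open>A\<close> is the same for all choices of orthonormal bases.
  Parameters in \<open>{0<..1/2}\<close> exclude \<open>A = 0\<close>, i.e. products of three symmetric spaces.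
\<close>

definition wallach_parameters ::
  "nat \<Rightarrow> complex mat set \<Rightarrow> (3 \<Rightarrow> complex mat set) \<Rightarrow> (3 \<Rightarrow> real) \<Rightarrow> bool" where
  "wallach_parameters n G p a \<longleftrightarrow>
     (let \<gg> = lie_algebra n G in
        \<exists>(d :: 3 \<Rightarrow> nat) (e :: 3 \<Rightarrow> nat \<Rightarrow> complex mat).
          (\<forall>i. orthonormal_basis n \<gg> (p i) (d i) (e i)) \<and>
          (\<forall>i. a i = (\<Sum>\<alpha><d 0. \<Sum>\<beta><d 1. \<Sum>\<gamma><d 2.
                       (ip n \<gg> (lie_bracket (e 0 \<alpha>) (e 1 \<beta>)) (e 2 \<gamma>))\<^sup>2) / real (d i)) \<and>
          (\<forall>i. a i \<in> {0<..1/2}))"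

text \<open>Isomorphism of the pairs formed by the Lie algebras of \<open>G\<close> and \<open>H\<close>.\<close>

definition pair_iso ::
  "((nat \<times> complex mat set \<times> complex mat set) \<times> (nat \<times> complex mat set \<times> complex mat set)) set" where
  "pair_iso = {((n, G, H), (n', G', H')).
     \<exists>\<phi>. bij_betw \<phi> (lie_algebra n G) (lie_algebra n' G') \<and>
        (\<forall>X\<in>lie_algebra n G. \<forall>Y\<in>lie_algebra n G. \<phi> (X + Y) = \<phi> X + \<phi> Y) \<and>
        (\<forall>c. \<forall>X\<in>lie_algebra n G. \<phi> (real_smult c X) = real_smult c (\<phi> X)) \<and>
        (\<forall>X\<in>lie_algebra n G. \<forall>Y\<in>lie_algebra n G.
           \<phi> (lie_bracket X Y) = lie_bracket (\<phi> X) (\<phi> Y)) \<and>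
        \<phi> ` lie_algebra n H = lie_algebra n' H'}"


section \<open>The normalized Ricci flow\<close>

definition ricci :: "(3 \<Rightarrow> real) \<Rightarrow> (3 \<Rightarrow> real) \<Rightarrow> 3 \<Rightarrow> real" where
  "ricci a x i = (let j = i + 1; k = i + 2 in
     1 / (2 * x i) + a i / 2 * (x i / (x j * x k) - x j / (x k * x i) - x k / (x i * x j)))"

definition ricci_positive :: "(3 \<Rightarrow> real) \<Rightarrow> (3 \<Rightarrow> real) set" where
  "ricci_positive a = {x. \<forall>i. 0 < x i \<and> 0 < ricci a x i}"

definition ricci_flow_field :: "(3 \<Rightarrow> real) \<Rightarrow> (3 \<Rightarrow> real) \<Rightarrow> 3 \<Rightarrow> real" where
  "ricci_flow_field a x i =
     - 2 * x i * (ricci a x i - (\<Sum>j\<in>UNIV. inverse (a j) * ricci a x j) / (\<Sum>j\<in>UNIV. inverse (a j)))"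

definition ricci_flow_solution :: "(3 \<Rightarrow> real) \<Rightarrow> ereal \<Rightarrow> (real \<Rightarrow> 3 \<Rightarrow> real) \<Rightarrow> bool" where
  "ricci_flow_solution a T x \<longleftrightarrow> 0 < T \<and>
     (\<forall>t. 0 \<le> t \<and> ereal t < T \<longrightarrow> (\<forall>i. 0 < x t i \<and>
        ((\<lambda>s. x s i) has_real_derivative ricci_flow_field a (x t) i)
          (at t within {s. 0 \<le> s \<and> ereal s < T})))"

definition maximal_ricci_flow_solution :: "(3 \<Rightarrow> real) \<Rightarrow> ereal \<Rightarrow> (real \<Rightarrow> 3 \<Rightarrow> real) \<Rightarrow> bool" where
  "maximal_ricci_flow_solution a T x \<longleftrightarrow> ricci_flow_solution a T x \<and>
     (\<forall>T' y. ricci_flow_solution a T' y \<and> T \<le> T' \<and>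
        (\<forall>t. 0 \<le> t \<and> ereal t < T \<longrightarrow> y t = x t) \<longrightarrow> T' = T)"

end

theory Submission
  imports Defs "Jordan_Normal_Form.Determinant"
begin

text \<open>
  The spaces are \<open>Sp(3k)/Sp(k)\<^sup>3\<close>, all of whose parameters equal \<open>a = k/(6k + 2) < 1/6\<close>. The group
  \<open>Sp(n)\<close> is the group of unitary \<open>2n \<times> 2n\<close> matrices commuting with an antilinear structure map \<open>J\<close>.
  Traces over its Lie algebra become sums over matrix entries; this gives the Killing form
  \<open>(2n + 2) tr(XY)\<close>, the parameters, and the dimension, which separates the pairs for different \<open>k\<close>.

  Let \<open>p < q < r\<close> be the coordinates of a generic solution. The order is preserved and \<open>q/p\<close> increases
  to infinity. The scale-invariant quantity \<open>w = (r - q)/p\<close> satisfies, up to a positive factor,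
  \<open>(ln w)' = (1 - 6a) q r + 2a (p\<^sup>2 - (r - q)\<^sup>2)\<close>. As \<open>a < 1/6\<close>, eventually \<open>w \<ge> 1/a\<close> for good, and
  \<open>w \<ge> 1/a\<close> makes the Ricci eigenvalue belonging to \<open>q\<close> negative. If \<open>q/p\<close> stayed bounded, the
  solution would stay in a compact set and could be continued.
\<close>

section \<open>Local existence and continuation for ordinary differential equations\<close>

text \<open>With equal parameters the averaged term of the flow is the same multiple of every
  coordinate, so it drops out of all quotients; \<open>p q r\<close> is conserved, and this turns
  bounds on quotients into bounds on coordinates. The growth of \<open>w\<close> is seen indirectly:
  as long as \<open>w < 1/a\<close> and \<open>q/p\<close> is large, \<open>ln w\<close> grows at
  least as fast as a fixed multiple of \<open>ln (q/p)\<close>, which is unbounded.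

  On the algebraic side the Killing form is a trace in an unspecified basis, and a Lie algebra is a
  set of velocities of curves. One family of matrices handles both: the orbit of a single entry
  under the symmetries of the symplectic algebra. These matrices turn traces into entry sums; after
  normalization they generate rotation groups with an explicit formula, so no matrix exponential of
  a general element is needed; and such rotations, at a quarter turn, move entries around within a
  module and give irreducibility. The parameters do not require the dimensions of the modules: for
  \<open>X\<close> in one module the trace of \<open>(ad X)^2\<close> on another is a fixed multiple
  of the square norm of \<open>X\<close>, so \<open>A\<close> is the same multiple of each
  \<open>d i\<close>.\<close>

lemma local_solution:
  fixes f :: "'a::euclidean_space \<Rightarrow> 'a"
  assumes L: "L-lipschitz_on (cball x0 r) f" and r: "0 < r"
  obtains \<delta> y where "0 < \<delta>" "y 0 = x0" "\<And>t. t \<in> {0..\<delta>} \<Longrightarrow> y t \<in> cball x0 r"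
    "\<And>t. t \<in> {0..\<delta>} \<Longrightarrow> (y has_vector_derivative f (y t)) (at t within {0..\<delta>})"
proof -
  have L0: "0 \<le> L" using L lipschitz_on_nonneg by blast
  \<comment> \<open>Composing the field with the nearest-point projection onto the ball makes it
    globally Lipschitz and bounded, so the Picard iteration may run in the whole space. The fixed
    point is seen afterwards to stay in the ball, where the truncation changes nothing.\<close>
  define cp where "cp = closest_point (cball x0 r)"
  define g where "g = (\<lambda>x. f (cp x))"
  define B where "B = norm (f x0) + L * r"
  \<comment> \<open>The first bound makes the Picard map a contraction with factor 1/2, the second
    keeps its values within distance \<open>r\<close> of \<open>x0\<close>. The \<open>+ 1\<close>
    covers \<open>L = 0\<close> and \<open>B = 0\<close>.\<close>
  define \<delta> where "\<delta> = min (1 / (2 * (L + 1))) (r / (B + 1))"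
  have B0: "0 \<le> B" unfolding B_def using L0 r by simp
  have d0: "0 < \<delta>" unfolding \<delta>_def using L0 B0 r by simp
  have Ld: "L * \<delta> \<le> 1 / 2"
  proof -
    have "L * \<delta> \<le> L * (1 / (2 * (L + 1)))"
      unfolding \<delta>_def by (intro mult_left_mono L0) simp
    also have "\<dots> \<le> 1 / 2" using L0 by (simp add: field_simps)
    finally show ?thesis .
  qed
  have Bd: "B * \<delta> \<le> r"
  proof -
    have "B * \<delta> \<le> B * (r / (B + 1))"
      unfolding \<delta>_def by (intro mult_left_mono B0) simp
    also have "\<dots> \<le> r" using B0 r by (simp add: field_simps)
    finally show ?thesis .
  qed
  have cp_in: "cp x \<in> cball x0 r" for x
    unfolding cp_def using r by (intro closest_point_in_set) auto
  have cp_lip: "dist (cp x) (cp y) \<le> dist x y" for x y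
    unfolding cp_def using r by (intro closest_point_lipschitz) auto
  have g_lip: "dist (g x) (g y) \<le> L * dist x y" for x y
    using lipschitz_onD[OF L cp_in cp_in, of x y] cp_lip[of x y] L0 unfolding g_def
    by (meson mult_left_mono order_trans)
  have g_cont: "continuous_on S g" for S
    by (rule lipschitz_on_continuous_on[of L]) (simp add: lipschitz_on_def g_lip L0)
  have g_bound: "norm (g x) \<le> B" for x
  proof -
    have "dist (f (cp x)) (f x0) \<le> L * dist (cp x) x0"
      using r by (intro lipschitz_onD[OF L cp_in]) simp
    also have "\<dots> \<le> L * r" using cp_in[of x] L0 by (intro mult_left_mono) (auto simp: dist_commute)
    finally have "norm (f (cp x) - f x0) \<le> L * r" by (simp add: dist_norm)
    then show ?thesis unfolding g_def B_def using norm_triangle_sub[of "f (cp x)" "f x0"] by linarith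
  qed
  \<comment> \<open>Bounded continuous functions on the whole line form the complete space for the
    fixed point theorem; clamping time to the interval makes the Picard integral bounded
    there.\<close>
  define cl where "cl = (\<lambda>t::real. max 0 (min \<delta> t))"
  have cl_in: "cl t \<in> {0..\<delta>}" for t unfolding cl_def using d0 by auto
  have cl_cont: "continuous_on UNIV cl" unfolding cl_def by (intro continuous_intros)
  have gy_cont: "continuous_on S (\<lambda>s. g (apply_bcontfun y s))" for S and y :: "real \<Rightarrow>\<^sub>C 'a"
    by (rule continuous_on_compose2[OF g_cont[of UNIV]]) auto
  have gy_int: "(\<lambda>s. g (apply_bcontfun y s)) integrable_on {0..b}" for b and y :: "real \<Rightarrow>\<^sub>C 'a"
    by (rule integrable_continuous_real[OF gy_cont])
  define \<Phi>0 where "\<Phi>0 = (\<lambda>(y :: real \<Rightarrow>\<^sub>C 'a) t. x0 + integral {0..cl t} (\<lambda>s. g (apply_bcontfun y s)))"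
  have int_le: "norm (integral {0..cl t} (\<lambda>s. g (apply_bcontfun y s))) \<le> B * \<delta>" for t and y :: "real \<Rightarrow>\<^sub>C 'a"
  proof -
    have "norm (integral {0..cl t} (\<lambda>s. g (apply_bcontfun y s))) \<le> B * (cl t - 0)"
      using cl_in[of t] by (intro integral_bound gy_cont g_bound) auto
    also have "\<dots> \<le> B * \<delta>" using cl_in[of t] B0 by (intro mult_left_mono) auto
    finally show ?thesis .
  qed
  have \<Phi>0: "\<Phi>0 y \<in> bcontfun" for y
  proof (rule bcontfun_normI)
    have "continuous_on {0..\<delta>} (\<lambda>x. integral {0..x} (\<lambda>s. g (apply_bcontfun y s)))"
      by (rule indefinite_integral_continuous_1[OF gy_int])
    moreover have "range cl \<subseteq> {0..\<delta>}" using cl_in by blast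
    ultimately show "continuous_on UNIV (\<Phi>0 y)"
      unfolding \<Phi>0_def by (intro continuous_intros continuous_on_compose2[OF _ cl_cont])
    show "norm (\<Phi>0 y t) \<le> norm x0 + B * \<delta>" for t
      unfolding \<Phi>0_def using int_le norm_triangle_ineq by (meson add_left_mono order_trans)
  qed
  define \<Phi> where "\<Phi> = (\<lambda>y. Bcontfun (\<Phi>0 y))"
  have \<Phi>_app: "apply_bcontfun (\<Phi> y) = \<Phi>0 y" for y
    unfolding \<Phi>_def using \<Phi>0 by (simp add: Bcontfun_inverse)
  have "dist (\<Phi> y) (\<Phi> z) \<le> (1/2) * dist y z" for y z
  proof (rule dist_bound)
    fix t
    have "dist (\<Phi> y t) (\<Phi> z t) = norm (integral {0..cl t} (\<lambda>s. g (apply_bcontfun y s) - g (apply_bcontfun z s)))"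
      unfolding \<Phi>_app \<Phi>0_def by (simp add: dist_norm integral_diff[OF gy_int gy_int])
    also have "\<dots> \<le> (L * dist y z) * (cl t - 0)"
    proof (intro integral_bound continuous_intros gy_cont)
      fix s
      have "norm (g (apply_bcontfun y s) - g (apply_bcontfun z s)) \<le> L * dist (apply_bcontfun y s) (apply_bcontfun z s)"
        using g_lip by (simp add: dist_norm)
      also have "\<dots> \<le> L * dist y z" by (intro mult_left_mono dist_bounded L0)
      finally show "norm (g (apply_bcontfun y s) - g (apply_bcontfun z s)) \<le> L * dist y z" .
    qed (use cl_in in auto)
    also have "\<dots> \<le> (L * dist y z) * \<delta>" using cl_in[of t] L0 by (intro mult_left_mono) auto
    also have "\<dots> = (L * \<delta>) * dist y z" by simp
    also have "\<dots> \<le> (1/2) * dist y z" by (intro mult_right_mono Ld) simp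
    finally show "dist (\<Phi> y t) (\<Phi> z t) \<le> (1/2) * dist y z" .
  qed
  then obtain y where y: "\<Phi> y = y"
    using banach_fix_type[of "1/2" \<Phi>] by auto
  then have y_eq: "apply_bcontfun y t = x0 + integral {0..cl t} (\<lambda>s. g (apply_bcontfun y s))" for t
    by (metis \<Phi>_app \<Phi>0_def)
  have y_in: "apply_bcontfun y t \<in> cball x0 r" for t
    using int_le[of t y] Bd by (subst y_eq) (simp add: dist_norm)
  show thesis
  proof (rule that[of \<delta> "apply_bcontfun y"])
    show "apply_bcontfun y 0 = x0" by (subst y_eq) (use d0 in \<open>simp add: cl_def\<close>)
    fix t assume t: "t \<in> {0..\<delta>}"
    have gf: "g (apply_bcontfun y t) = f (apply_bcontfun y t)"
      unfolding g_def cp_def closest_point_self[OF y_in] ..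
    have "((\<lambda>u. x0 + integral {0..u} (\<lambda>s. g (apply_bcontfun y s))) has_vector_derivative
        0 + g (apply_bcontfun y t)) (at t within {0..\<delta>})"
      by (intro has_vector_derivative_add has_vector_derivative_const integral_has_vector_derivative gy_cont t)
    then have "(apply_bcontfun y has_vector_derivative 0 + g (apply_bcontfun y t)) (at t within {0..\<delta>})"
    proof (rule has_vector_derivative_transform[OF t, rotated])
      fix u assume "u \<in> {0..\<delta>}"
      then have "cl u = u" by (simp add: cl_def)
      then show "apply_bcontfun y u = x0 + integral {0..u} (\<lambda>s. g (apply_bcontfun y s))"
        using y_eq[of u] by simp
    qed
    then show "(apply_bcontfun y has_vector_derivative f (apply_bcontfun y t)) (at t within {0..\<delta>})"
      by (simp add: gf)
  qed (use d0 y_in in auto)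
qed

text \<open>On the compact set the field is bounded, so the solution is Lipschitz and has a limit at
  \<open>T\<close>. The limit lies in \<open>K\<close>, hence in \<open>U\<close>, and a local
  solution started there is glued on.\<close>

lemma extend_solution:
  fixes f :: "'a::euclidean_space \<Rightarrow> 'a" and x :: "real \<Rightarrow> 'a"
  assumes T: "0 < T"
    and der: "\<And>t. t \<in> {0..<T} \<Longrightarrow> (x has_vector_derivative f (x t)) (at t within {0..<T})"
    and K: "compact K" "\<And>t. t \<in> {0..<T} \<Longrightarrow> x t \<in> K"
    and U: "K \<subseteq> U"
    and lip: "\<And>z. z \<in> U \<Longrightarrow> \<exists>r>0. \<exists>L. cball z r \<subseteq> U \<and> L-lipschitz_on (cball z r) f"
  obtains T' y where "T < T'" "\<And>t. t \<in> {0..<T} \<Longrightarrow> y t = x t"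
    "\<And>t. t \<in> {0..<T'} \<Longrightarrow> y t \<in> U"
    "\<And>t. t \<in> {0..<T'} \<Longrightarrow> (y has_vector_derivative f (y t)) (at t within {0..<T'})"
proof -
  have fcont: "continuous_on U f"
  proof (clarsimp simp: continuous_on_eq_continuous_within)
    fix z assume "z \<in> U"
    from lip[OF this] obtain r L where r: "r > 0" "L-lipschitz_on (cball z r) f" by blast
    have "continuous_on (ball z r) f"
      by (rule continuous_on_subset[OF lipschitz_on_continuous_on[OF r(2)]]) auto
    then have "isCont f z" using r(1) by (simp add: continuous_on_eq_continuous_at)
    then show "continuous (at z within U) f" by (simp add: continuous_at_imp_continuous_at_within)
  qed
  have "compact (f ` K)" using fcont K U continuous_on_subset compact_continuous_image by blast
  then obtain B where B: "\<And>z. z \<in> K \<Longrightarrow> norm (f z) \<le> B"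
    by (meson bounded_iff compact_imp_bounded image_eqI)
  have xlip: "B-lipschitz_on {0..<T} x"
  proof (rule lipschitz_onI)
    fix s t assume st: "s \<in> {0..<T}" "t \<in> {0..<T}"
    have "norm (x s - x t) \<le> B * norm (s - t)"
    proof (rule differentiable_bound[of "{0..<T}" x "\<lambda>t h. h *\<^sub>R f (x t)"])
      fix u assume u: "u \<in> {0..<T}"
      show "(x has_derivative (\<lambda>h. h *\<^sub>R f (x u))) (at u within {0..<T})"
        using der[OF u] by (simp add: has_vector_derivative_def)
      show "onorm (\<lambda>h. h *\<^sub>R f (x u)) \<le> B"
        using B[OF K(2)[OF u]] by (intro onorm_le) (simp add: mult.commute[of B] mult_left_mono)
    qed (use st in auto)
    then show "dist (x s) (x t) \<le> B * dist s t" by (simp add: dist_norm)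
  next
    show "0 \<le> B" using order_trans[OF norm_ge_zero B[OF K(2)[of 0]]] T by simp
  qed
  then have "uniformly_continuous_on {0..<T} x" by (rule lipschitz_on_uniformly_continuous)
  then obtain x' where x': "uniformly_continuous_on (closure {0..<T}) x'"
      "\<And>t. t \<in> {0..<T} \<Longrightarrow> x t = x' t"
    by (rule uniformly_continuous_on_extension_on_closure) auto
  have clo: "closure {0..<T} = {0..T}" using T by simp
  have x'_cont: "continuous_on {0..T} x'"
    using x'(1) unfolding clo by (rule uniformly_continuous_imp_continuous)
  have x'_K: "x' t \<in> K" if "t \<in> {0..T}" for t
  proof -
    have "x' ` closure {0..<T} \<subseteq> K"
      using K x'(2) by (intro image_closure_subset) (auto simp: x'_cont clo compact_imp_closed)
    then show ?thesis using that clo by auto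
  qed
  have fx'_cont: "continuous_on {0..T} (\<lambda>s. f (x' s))"
    using x'_K U by (intro continuous_on_compose2[OF fcont x'_cont]) auto
  \<comment> \<open>The differential equation is known only before \<open>T\<close>. The difference
    of \<open>x'\<close> and this integral is continuous up to \<open>T\<close> with vanishing
    derivative before it, hence constant; this supplies the one-sided derivative at \<open>T\<close>
    itself.\<close>
  define F where "F = (\<lambda>t. integral {0..t} (\<lambda>s. f (x' s)))"
  have F: "(F has_vector_derivative f (x' t)) (at t within {0..T})" if "t \<in> {0..T}" for t
    unfolding F_def by (rule integral_has_vector_derivative[OF fx'_cont that])
  have x'_der0: "(x' has_vector_derivative f (x' t)) (at t within {0..T})" if t: "t \<in> {0..<T}" for t
  proof -
    have "(x' has_vector_derivative f (x t)) (at t within {0..<T})"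
      using has_vector_derivative_transform[OF t _ der[OF t], of x'] x'(2) by simp
    moreover have "at t within {0..<T} = at t within {0..T}"
      using t by (intro at_within_nhd[of t "{..<T}"]) auto
    ultimately show ?thesis using x'(2)[OF t] by simp
  qed
  have const: "x' t - F t = x' 0" if t: "t \<in> {0..T}" for t
  proof (rule has_derivative_zero_unique_strong_interval[where k = "{T}" and f = "\<lambda>t. x' t - F t" and a=0 and b=T])
    show "continuous_on {0..T} (\<lambda>t. x' t - F t)"
      by (intro continuous_intros x'_cont)
        (auto simp: F_def intro!: indefinite_integral_continuous_1 integrable_continuous_real fx'_cont)
    fix s assume "s \<in> {0..T} - {T}"
    then have s: "s \<in> {0..<T}" by auto
    have "((\<lambda>t. x' t - F t) has_vector_derivative f (x' s) - f (x' s)) (at s within {0..T})"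
      using s by (intro has_vector_derivative_diff x'_der0 F) auto
    then show "((\<lambda>t. x' t - F t) has_derivative (\<lambda>h. 0)) (at s within {0..T})"
      by (simp add: has_vector_derivative_def)
  qed (use t in \<open>auto simp: F_def\<close>)
  have x'_der: "(x' has_vector_derivative f (x' t)) (at t within {0..T})" if t: "t \<in> {0..T}" for t
  proof -
    have "((\<lambda>t. x' 0 + F t) has_vector_derivative 0 + f (x' t)) (at t within {0..T})"
      by (intro has_vector_derivative_add has_vector_derivative_const F t)
    then have "(x' has_vector_derivative 0 + f (x' t)) (at t within {0..T})"
      by (rule has_vector_derivative_transform[OF t, rotated]) (metis const diff_eq_eq)
    then show ?thesis by simp
  qed
  have "x' T \<in> U" using x'_K U T by auto
  from lip[OF this] obtain r L where r: "r > 0" "cball (x' T) r \<subseteq> U" "L-lipschitz_on (cball (x' T) r) f"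
    by blast
  from local_solution[OF r(3,1)] obtain \<delta> z where \<delta>: "0 < \<delta>" "z 0 = x' T"
    and z: "\<And>t. t \<in> {0..\<delta>} \<Longrightarrow> z t \<in> cball (x' T) r"
    "\<And>t. t \<in> {0..\<delta>} \<Longrightarrow> (z has_vector_derivative f (z t)) (at t within {0..\<delta>})" by blast
  \<comment> \<open>At \<open>T\<close> the two branches have the same value and the same velocity
    \<open>f (x' T)\<close>, so the glued curve is differentiable there.\<close>
  define y where "y = (\<lambda>t. if t \<in> {0..T} then x' t else z (t - T))"
  have z': "((\<lambda>t. z (t - T)) has_vector_derivative f (z (t - T))) (at t within {T..T+\<delta>})"
    if "t \<in> {T..T+\<delta>}" for t
  proof -
    have "((z \<circ> (\<lambda>t. t - T)) has_vector_derivative (1 *\<^sub>R f (z (t - T)))) (at t within {T..T+\<delta>})"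
    proof (rule vector_diff_chain_within)
      show "((\<lambda>t. t - T) has_vector_derivative 1) (at t within {T..T + \<delta>})"
        by (auto intro!: derivative_eq_intros)
      have "(\<lambda>t. t - T) ` {T..T + \<delta>} = {0..\<delta>}" by (auto simp: image_iff intro: bexI[of _ "_ + T"])
      then show "(z has_vector_derivative f (z (t - T))) (at (t - T) within (\<lambda>t. t - T) ` {T..T + \<delta>})"
        using z(2)[of "t - T"] that by simp
    qed
    then show ?thesis by (simp add: o_def)
  qed
  have y_der: "(y has_vector_derivative (if t \<in> {0..T} then f (x' t) else f (z (t - T)))) (at t within {0..T+\<delta>})"
    if t: "t \<in> {0..T+\<delta>}" for t
    unfolding y_def
  proof (rule has_vector_derivative_If_within_closures[where T = "{T..T+\<delta>}" and f' = "\<lambda>t. f (x' t)"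
        and g' = "\<lambda>t. f (z (t - T))"])
    show "t \<in> {0..T} \<union> {T..T+\<delta>}" using t by auto
    show "{0..T+\<delta>} = {0..T} \<union> {T..T+\<delta>}" using T \<delta> by auto
    have cl: "closure {0..T} \<inter> closure {T..T+\<delta>} = {T}" using T \<delta> by auto
    have un: "{0..T} \<union> {T} = {0..T}" "{T..T+\<delta>} \<union> {T} = {T..T+\<delta>}" using T \<delta> by auto
    show "(x' has_vector_derivative f (x' t)) (at t within {0..T} \<union> closure {0..T} \<inter> closure {T..T + \<delta>})"
      if "t \<in> {0..T} \<union> closure {0..T} \<inter> closure {T..T + \<delta>}"
      using that x'_der unfolding cl un by blast
    show "((\<lambda>t. z (t - T)) has_vector_derivative f (z (t - T)))
       (at t within {T..T + \<delta>} \<union> closure {0..T} \<inter> closure {T..T + \<delta>})"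
      if "t \<in> {T..T + \<delta>} \<union> closure {0..T} \<inter> closure {T..T + \<delta>}"
      using that z' unfolding cl un by blast
    assume "t \<in> closure {0..T}" "t \<in> closure {T..T + \<delta>}"
    then have "t = T" using cl by blast
    then show "x' t = z (t - T)" "f (x' t) = f (z (t - T))" using \<delta> by auto
  qed
  show thesis
  proof (rule that[of "T + \<delta>" y])
    show "y t = x t" if "t \<in> {0..<T}" for t using that x'(2) by (simp add: y_def)
    show "y t \<in> U" if "t \<in> {0..<T+\<delta>}" for t
      using that x'_K U z(1)[of "t - T"] r(2) by (auto simp: y_def)
    fix t assume t: "t \<in> {0..<T+\<delta>}"
    have "(if t \<in> {0..T} then f (x' t) else f (z (t - T))) = f (y t)" by (simp add: y_def)
    with y_der[of t] t show "(y has_vector_derivative f (y t)) (at t within {0..<T+\<delta>})"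
      by (auto intro: has_vector_derivative_within_subset)
  qed (use \<delta> in auto)
qed


section \<open>The Ricci flow with equal parameters\<close>

lemma UNIV_3_distinct:
  fixes i j k :: 3
  assumes "i \<noteq> j" "j \<noteq> k" "k \<noteq> i"
  shows "UNIV = {i, j, k}"
  using assms exhaust_3[of i] exhaust_3[of j] exhaust_3[of k] by (auto simp: UNIV_3)

lemma successors_3:
  fixes i j k :: 3
  assumes "i \<noteq> j" "j \<noteq> k" "k \<noteq> i"
  shows "j = i + 1 \<and> k = i + 2 \<or> k = i + 1 \<and> j = i + 2"
  using assms exhaust_3[of i] exhaust_3[of j] exhaust_3[of k] by auto

text \<open>The expression is symmetric in the two indices other than \<open>i\<close>, so the
  cyclic labelling by \<open>i + 1\<close> and \<open>i + 2\<close> may be replaced by any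
  other.\<close>

lemma ricci_distinct:
  fixes i j k :: 3
  assumes "i \<noteq> j" "j \<noteq> k" "k \<noteq> i"
  shows "ricci a x i = 1 / (2 * x i) + a i / 2 * (x i / (x j * x k) - x j / (x k * x i) - x k / (x i * x j))"
  using successors_3[OF assms] by (auto simp: ricci_def Let_def mult.commute)

text \<open>Twice the arithmetic mean of the three Ricci components for equal parameters; the
  weights \<open>1 / a\<close> cancel from the average. In each equation it is multiplied by the
  coordinate itself, and so it cancels from derivatives of quotients.\<close>

definition mean_ricci :: "real \<Rightarrow> real \<Rightarrow> real \<Rightarrow> real \<Rightarrow> real" where
  "mean_ricci a u v w = (1/u + 1/v + 1/w - a * (u^2 + v^2 + w^2) / (u * v * w)) / 3"

lemma ricci_flow_field_equal_parameters:
  fixes i j k :: 3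
  assumes ijk: "i \<noteq> j" "j \<noteq> k" "k \<noteq> i" and a: "a \<noteq> 0" and pos: "\<And>i. 0 < x i"
  shows "ricci_flow_field (\<lambda>_. a) x i =
    - (1 + a * ((x i)^2 - (x j)^2 - (x k)^2) / (x j * x k)) + x i * mean_ricci a (x i) (x j) (x k)"
proof -
  have nz: "x i \<noteq> 0" for i using pos[of i] by simp
  have jik: "j \<noteq> i" "i \<noteq> k" "k \<noteq> j" using ijk by auto
  have kij: "k \<noteq> i" "i \<noteq> j" "j \<noteq> k" using ijk by auto
  have "(\<Sum>l\<in>UNIV. inverse a * ricci (\<lambda>_. a) x l) =
      inverse a * (ricci (\<lambda>_. a) x i + ricci (\<lambda>_. a) x j + ricci (\<lambda>_. a) x k)"
    unfolding UNIV_3_distinct[OF ijk] using ijk jik by (simp add: algebra_simps)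
  then have avg: "(\<Sum>l\<in>UNIV. inverse a * ricci (\<lambda>_. a) x l) / (\<Sum>l\<in>(UNIV::3 set). inverse a) =
      (ricci (\<lambda>_. a) x i + ricci (\<lambda>_. a) x j + ricci (\<lambda>_. a) x k) / 3"
    using a by simp
  have mean: "2 * ((ricci (\<lambda>_. a) x i + ricci (\<lambda>_. a) x j + ricci (\<lambda>_. a) x k) / 3) = mean_ricci a (x i) (x j) (x k)"
    unfolding ricci_distinct[OF ijk] ricci_distinct[OF jik] ricci_distinct[OF kij] mean_ricci_def
    using nz[of i] nz[of j] nz[of k] by (simp add: field_simps power2_eq_square)
  have "2 * x i * ricci (\<lambda>_. a) x i = 1 + a * ((x i)^2 - (x j)^2 - (x k)^2) / (x j * x k)"
    unfolding ricci_distinct[OF ijk]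
    using nz[of i] nz[of j] nz[of k] by (simp add: field_simps power2_eq_square)
  moreover have "- 2 * x i * (R - M / 3) = - (2 * x i * R) + x i * (2 * (M / 3))" for R M :: real
    by (simp add: field_simps)
  ultimately show ?thesis
    unfolding ricci_flow_field_def avg mean[symmetric] by metis
qed

section \<open>Comparison principles for scalar functions of time\<close>

lemma nondecreasing_within:
  fixes f :: "real \<Rightarrow> real"
  assumes "s \<le> t" and "\<And>u. u \<in> {s..t} \<Longrightarrow> (f has_real_derivative f' u) (at u within {s..t})"
    and "\<And>u. u \<in> {s..t} \<Longrightarrow> 0 \<le> f' u"
  shows "f s \<le> f t"
proof -
  have "\<exists>x\<in>{s..t}. f t - f s = f' x * (t - s)"
    using assms by (intro mvt_very_simple) (auto simp: has_field_derivative_def)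
  then show ?thesis using assms by (metis diff_ge_0_iff_ge mult_nonneg_nonneg)
qed

text \<open>Consider the last time at which \<open>f\<close> is at least \<open>B\<close>. After it
  \<open>f\<close> lies below \<open>B\<close>, so its derivative is nonnegative there, and the mean
  value theorem forbids the descent to \<open>f t < B\<close>.\<close>

lemma lower_barrier:
  fixes f :: "real \<Rightarrow> real"
  assumes st: "s \<le> t" and der: "\<And>u. u \<in> {s..t} \<Longrightarrow> (f has_real_derivative f' u) (at u within {s..t})"
    and start: "B \<le> f s" and pos: "\<And>u. u \<in> {s..t} \<Longrightarrow> f u < B \<Longrightarrow> 0 \<le> f' u"
  shows "B \<le> f t"
proof (rule ccontr)
  assume neg: "\<not> B \<le> f t"
  have cont: "continuous_on {s..t} f" by (rule DERIV_continuous_on[OF der])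
  define A where "A = {s..t} \<inter> f -` {B..}"
  have "closed A" unfolding A_def by (rule continuous_closed_preimage[OF cont]) auto
  moreover have "A \<noteq> {}" "bdd_above A" unfolding A_def using start st by auto
  ultimately have u0: "Sup A \<in> A" by (intro closed_contains_Sup)
  define u0 where "u0 = Sup A"
  have "u0 \<in> A" using u0 unfolding u0_def .
  then have u0A: "s \<le> u0" "u0 < t" "B \<le> f u0"
    using neg unfolding A_def by (auto simp: less_le)
  have above: "f u < B" if "u0 < u" "u \<le> t" for u
    using cSup_upper[of u A] that u0A \<open>bdd_above A\<close> unfolding u0_def A_def by force
  have "\<exists>x\<in>{u0<..<t}. f t - f u0 = f' x * (t - u0)"
  proof (rule mvt_simple)
    fix u assume "u0 \<le> u" "u \<le> t"
    then have "(f has_real_derivative f' u) (at u within {u0..t})"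
      using u0A by (intro has_field_derivative_subset[OF der]) auto
    then show "(f has_derivative (*) (f' u)) (at u within {u0..t})"
      by (simp add: has_field_derivative_def)
  qed (use u0A in auto)
  then obtain \<xi> where "\<xi> \<in> {u0<..<t}" "f t - f u0 = f' \<xi> * (t - u0)" by blast
  moreover from this have "0 \<le> f' \<xi>" using pos[of \<xi>] above[of \<xi>] u0A by auto
  ultimately have "f u0 \<le> f t" using u0A by (metis diff_ge_0_iff_ge mult_nonneg_nonneg less_imp_le)
  then show False using u0A neg by simp
qed

lemma upper_barrier:
  fixes f :: "real \<Rightarrow> real"
  assumes "s \<le> t" and der: "\<And>u. u \<in> {s..t} \<Longrightarrow> (f has_real_derivative f' u) (at u within {s..t})"
    and "f s \<le> B" and "\<And>u. u \<in> {s..t} \<Longrightarrow> B < f u \<Longrightarrow> f' u \<le> 0"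
  shows "f t \<le> B"
  using lower_barrier[of s t "\<lambda>u. - f u" "\<lambda>u. - f' u" "- B"] assms by (auto intro: DERIV_minus)

text \<open>The integrating factor \<open>exp (- K)\<close> makes \<open>D * exp (- K)\<close>
  constant, so \<open>D\<close> cannot reach zero in finite time. This is what preserves the order
  of the coordinates.\<close>

lemma linear_growth_positive:
  fixes D :: "real \<Rightarrow> real"
  assumes t: "0 \<le> t" and der: "\<And>u. u \<in> {0..t} \<Longrightarrow> (D has_real_derivative D u * k u) (at u within {0..t})"
    and k: "continuous_on {0..t} k" and D0: "0 < D 0"
  shows "0 < D t"
proof -
  define K where "K = (\<lambda>u. integral {0..u} k)"
  have K: "(K has_real_derivative k u) (at u within {0..t})" if "u \<in> {0..t}" for u
    unfolding K_def by (rule integral_has_real_derivative[OF k that])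
  have E: "((\<lambda>u. D u * exp (- K u)) has_real_derivative 0) (at u within {0..t})" if "u \<in> {0..t}" for u
    by (rule derivative_eq_intros der[OF that] K[OF that] refl | simp add: algebra_simps)+
  have "D 0 * exp (- K 0) \<le> D t * exp (- K t)"
    by (rule nondecreasing_within[OF t E]) auto
  moreover have "0 < D 0 * exp (- K 0)" using D0 by simp
  ultimately have "0 < D t * exp (- K t)" by linarith
  then show ?thesis by (simp add: zero_less_mult_iff)
qed


section \<open>Solutions with ordered coordinates\<close>

text \<open>\<open>S\<close> is the time domain, an initial segment of the half-line, bounded or
  not. The strict order is imposed at time 0 only; \<open>order_pq\<close> and
  \<open>order_qr\<close> carry it to all of \<open>S\<close>.\<close>

locale ordered_flow =
  fixes a :: real and S :: "real set" and p q r :: "real \<Rightarrow> real"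
  assumes a: "0 < a" "a < 1/6"
    and S: "\<And>t. t \<in> S \<Longrightarrow> 0 \<le> t \<and> {0..t} \<subseteq> S" "0 \<in> S"
    and pos: "\<And>t. t \<in> S \<Longrightarrow> 0 < p t \<and> 0 < q t \<and> 0 < r t"
    and p': "\<And>t. t \<in> S \<Longrightarrow> (p has_real_derivative
      - (1 + a * ((p t)^2 - (q t)^2 - (r t)^2) / (q t * r t)) + p t * mean_ricci a (p t) (q t) (r t)) (at t within S)"
    and q': "\<And>t. t \<in> S \<Longrightarrow> (q has_real_derivative
      - (1 + a * ((q t)^2 - (p t)^2 - (r t)^2) / (p t * r t)) + q t * mean_ricci a (p t) (q t) (r t)) (at t within S)"
    and r': "\<And>t. t \<in> S \<Longrightarrow> (r has_real_derivative
      - (1 + a * ((r t)^2 - (p t)^2 - (q t)^2) / (p t * q t)) + r t * mean_ricci a (p t) (q t) (r t)) (at t within S)"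
    and ordered: "p 0 < q 0" "q 0 < r 0"
begin

lemma segment: "t \<in> S \<Longrightarrow> u \<in> {s..t} \<Longrightarrow> 0 \<le> s \<Longrightarrow> u \<in> S"
  using S(1)[of t] by auto

lemma segment_subset: "t \<in> S \<Longrightarrow> 0 \<le> s \<Longrightarrow> {s..t} \<subseteq> S"
  using S(1)[of t] by auto

lemma continuous: "continuous_on S p" "continuous_on S q" "continuous_on S r"
  by (rule DERIV_continuous_on, erule p' q' r')+

lemma mean_continuous: "continuous_on S (\<lambda>t. mean_ricci a (p t) (q t) (r t))"
  unfolding mean_ricci_def
  by (intro continuous_intros continuous) (auto dest: pos)

lemma order_pq: "p t < q t" if t: "t \<in> S"
proof -
  have "0 < q t - p t"
  proof (rule linear_growth_positive[where D = "\<lambda>t. q t - p t"])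
    show "0 \<le> t" using S t by blast
    let ?k = "\<lambda>u. mean_ricci a (p u) (q u) (r u) - a * ((p u + q u)^2 - (r u)^2) / (p u * q u * r u)"
    show "continuous_on {0..t} ?k"
      using segment_subset[OF t] pos
      by (intro continuous_intros continuous_on_subset[OF mean_continuous] continuous_on_subset[OF continuous(1)]
          continuous_on_subset[OF continuous(2)] continuous_on_subset[OF continuous(3)]) fastforce+
    fix u assume u: "u \<in> {0..t}"
    have uS: "u \<in> S" using segment[OF t u] by simp
    \<comment> \<open>The difference of the two right-hand sides is divisible by
      \<open>y - x\<close>, so \<open>q - p\<close> solves a homogeneous linear equation with
      continuous coefficient.\<close>
    have eq: "(- (1 + a * (y^2 - x^2 - z^2) / (x * z)) + y * M) - (- (1 + a * (x^2 - y^2 - z^2) / (y * z)) + x * M) =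
        (y - x) * (M - a * ((x + y)^2 - z^2) / (x * y * z))" if "0 < x" "0 < y" "0 < z" for x y z M :: real
      using that by (simp add: divide_simps) (simp add: algebra_simps power2_eq_square)
    have "((\<lambda>t. q t - p t) has_real_derivative (q u - p u) * ?k u) (at u within S)"
      using DERIV_diff[OF q'[OF uS] p'[OF uS]] eq[of "p u" "q u" "r u"] pos[OF uS] by simp
    then show "((\<lambda>t. q t - p t) has_real_derivative (q u - p u) * ?k u) (at u within {0..t})"
      by (rule has_field_derivative_subset) (use segment_subset[OF t] in simp)
  qed (use ordered in simp)
  then show ?thesis by simp
qed

lemma order_qr: "q t < r t" if t: "t \<in> S"
proof -
  have "0 < r t - q t"
  proof (rule linear_growth_positive[where D = "\<lambda>t. r t - q t"])
    show "0 \<le> t" using S t by blast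
    let ?k = "\<lambda>u. mean_ricci a (p u) (q u) (r u) - a * ((q u + r u)^2 - (p u)^2) / (p u * q u * r u)"
    show "continuous_on {0..t} ?k"
      using segment_subset[OF t] pos
      by (intro continuous_intros continuous_on_subset[OF mean_continuous] continuous_on_subset[OF continuous(1)]
          continuous_on_subset[OF continuous(2)] continuous_on_subset[OF continuous(3)]) fastforce+
    fix u assume u: "u \<in> {0..t}"
    have uS: "u \<in> S" using segment[OF t u] by simp
    have eq: "(- (1 + a * (z^2 - x^2 - y^2) / (x * y)) + z * M) - (- (1 + a * (y^2 - x^2 - z^2) / (x * z)) + y * M) =
        (z - y) * (M - a * ((y + z)^2 - x^2) / (x * y * z))" if "0 < x" "0 < y" "0 < z" for x y z M :: real
      using that by (simp add: divide_simps) (simp add: algebra_simps power2_eq_square)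
    have "((\<lambda>t. r t - q t) has_real_derivative (r u - q u) * ?k u) (at u within S)"
      using DERIV_diff[OF r'[OF uS] q'[OF uS]] eq[of "p u" "q u" "r u"] pos[OF uS] by simp
    then show "((\<lambda>t. r t - q t) has_real_derivative (r u - q u) * ?k u) (at u within {0..t})"
      by (rule has_field_derivative_subset) (use segment_subset[OF t] in simp)
  qed (use ordered in simp)
  then show ?thesis by simp
qed

text \<open>The averaged term has cancelled. The sign is that of \<open>r - 2 * a * (p + q)\<close>,
  positive because \<open>r\<close> exceeds the mean of \<open>p\<close> and \<open>q\<close> and
  \<open>a < 1/6\<close>.\<close>

lemma ratio_qp: "((\<lambda>t. q t / p t) has_real_derivative
    (q t - p t) * (r t - 2 * a * (p t + q t)) / ((p t)^2 * r t)) (at t within S)" if t: "t \<in> S"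
proof -
  have eq: "((- (1 + a * (y^2 - x^2 - z^2) / (x * z)) + y * M) * x - y * (- (1 + a * (x^2 - y^2 - z^2) / (y * z)) + x * M)) / (x * x) =
      (y - x) * (z - 2 * a * (x + y)) / (x^2 * z)" if "0 < x" "0 < y" "0 < z" for x y z M :: real
    using that by (simp add: divide_simps) (simp add: algebra_simps power2_eq_square)
  show ?thesis
    using DERIV_divide[OF q'[OF t] p'[OF t]] eq[of "p t" "q t" "r t"] pos[OF t] by simp
qed

lemma ratio_rp: "((\<lambda>t. r t / p t) has_real_derivative
    (r t - p t) * (q t - 2 * a * (p t + r t)) / ((p t)^2 * q t)) (at t within S)" if t: "t \<in> S"
proof -
  have eq: "((- (1 + a * (z^2 - x^2 - y^2) / (x * y)) + z * M) * x - z * (- (1 + a * (x^2 - y^2 - z^2) / (y * z)) + x * M)) / (x * x) =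
      (z - x) * (y - 2 * a * (x + z)) / (x^2 * y)" if "0 < x" "0 < y" "0 < z" for x y z M :: real
    using that by (simp add: divide_simps) (simp add: algebra_simps power2_eq_square)
  show ?thesis
    using DERIV_divide[OF r'[OF t] p'[OF t]] eq[of "p t" "q t" "r t"] pos[OF t] by simp
qed

lemma defect: "((\<lambda>t. (r t - q t) / p t) has_real_derivative
    (r t - q t) * ((1 - 2 * a) * q t * r t - 2 * a * ((q t)^2 + (r t)^2 - (p t)^2)) / ((p t)^2 * q t * r t)) (at t within S)"
  if t: "t \<in> S"
proof -
  have eq: "((- (1 + a * (z^2 - x^2 - y^2) / (x * y)) + z * M - (- (1 + a * (y^2 - x^2 - z^2) / (x * z)) + y * M)) * x
      - (z - y) * (- (1 + a * (x^2 - y^2 - z^2) / (y * z)) + x * M)) / (x * x) =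
      (z - y) * ((1 - 2 * a) * y * z - 2 * a * (y^2 + z^2 - x^2)) / (x^2 * y * z)"
    if "0 < x" "0 < y" "0 < z" for x y z M :: real
    using that by (simp add: divide_simps) (simp add: algebra_simps power2_eq_square)
  show ?thesis
    using DERIV_divide[OF DERIV_diff[OF r'[OF t] q'[OF t]] p'[OF t]] eq[of "p t" "q t" "r t"] pos[OF t] by simp
qed

text \<open>The normalized flow preserves the volume, which for modules of equal dimension is a
  power of \<open>p q r\<close>.\<close>

lemma volume: "((\<lambda>t. p t * q t * r t) has_real_derivative 0) (at t within S)" if t: "t \<in> S"
proof -
  have eq: "((- (1 + a * (x^2 - y^2 - z^2) / (y * z)) + x * mean_ricci a x y z) * y +
      (- (1 + a * (y^2 - x^2 - z^2) / (x * z)) + y * mean_ricci a x y z) * x) * z +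
      (- (1 + a * (z^2 - x^2 - y^2) / (x * y)) + z * mean_ricci a x y z) * (x * y) = 0"
    if "0 < x" "0 < y" "0 < z" for x y z :: real
    using that unfolding mean_ricci_def by (simp add: divide_simps) (simp add: algebra_simps power2_eq_square)
  show ?thesis
    using DERIV_mult[OF DERIV_mult[OF p'[OF t] q'[OF t]] r'[OF t]] eq[of "p t" "q t" "r t"] pos[OF t] by simp
qed

lemma volume_const: "p t * q t * r t = p 0 * q 0 * r 0" if t: "t \<in> S"
proof -
  have t0: "0 \<le> t" using S t by blast
  have d: "((\<lambda>t. p t * q t * r t) has_real_derivative 0) (at u within {0..t})" if "u \<in> {0..t}" for u
    by (rule has_field_derivative_subset[OF volume]) (use segment[OF t that] segment_subset[OF t] in auto)
  have "p 0 * q 0 * r 0 \<le> p t * q t * r t" by (rule nondecreasing_within[OF t0 d]) auto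
  moreover have "- (p 0 * q 0 * r 0) \<le> - (p t * q t * r t)"
    by (rule nondecreasing_within[OF t0, where f = "\<lambda>t. - (p t * q t * r t)" and f' = "\<lambda>_. - 0"])
      (use DERIV_minus[OF d] in auto)
  ultimately show ?thesis by simp
qed

lemma ratio_qp_mono: "q s / p s \<le> q t / p t" if t: "t \<in> S" and s: "0 \<le> s" "s \<le> t"
proof (rule nondecreasing_within[OF s(2)])
  fix u assume u: "u \<in> {s..t}"
  have uS: "u \<in> S" using segment[OF t u s(1)] .
  show "((\<lambda>t. q t / p t) has_real_derivative
    (q u - p u) * (r u - 2 * a * (p u + q u)) / ((p u)^2 * r u)) (at u within {s..t})"
    by (rule has_field_derivative_subset[OF ratio_qp[OF uS]]) (use segment_subset[OF t s(1)] in simp)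
  have "2 * a * (p u + q u) \<le> 1 * (p u + q u) * (1/2)" using a pos[OF uS] by simp
  also have "\<dots> \<le> r u" using order_pq[OF uS] order_qr[OF uS] by simp
  finally show "0 \<le> (q u - p u) * (r u - 2 * a * (p u + q u)) / ((p u)^2 * r u)"
    using order_pq[OF uS] pos[OF uS] by simp
qed

text \<open>The derivative of \<open>r/p\<close> has the sign of \<open>q - 2 * a * (p + r)\<close>,
  which is negative once \<open>r/p > M / (2 * a)\<close> because \<open>q \<le> M * p\<close>. So
  \<open>r/p\<close> is bounded as well, and with both quotients bounded the constant product
  \<open>p q r\<close> confines all coordinates to a compact part of the open octant.\<close>

lemma bounds_of_bounded_ratio:
  assumes M: "\<And>t. t \<in> S \<Longrightarrow> q t / p t \<le> M"
  obtains c C where "0 < c" "\<And>t. t \<in> S \<Longrightarrow> c \<le> p t \<and> r t \<le> C"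
proof -
  define L where "L = max (r 0 / p 0) (M / (2 * a))"
  have L: "r t / p t \<le> L" if t: "t \<in> S" for t
  proof (rule upper_barrier[where f = "\<lambda>t. r t / p t" and s = 0])
    show "0 \<le> t" using S t by blast
    show "r 0 / p 0 \<le> L" by (simp add: L_def)
    fix u assume u: "u \<in> {0..t}"
    have uS: "u \<in> S" using segment[OF t u] by simp
    show "((\<lambda>t. r t / p t) has_real_derivative
      (r u - p u) * (q u - 2 * a * (p u + r u)) / ((p u)^2 * q u)) (at u within {0..t})"
      by (rule has_field_derivative_subset[OF ratio_rp[OF uS]]) (use segment_subset[OF t] in simp)
    assume "L < r u / p u"
    then have "M / (2 * a) < r u / p u" by (simp add: L_def)
    then have "M * p u < r u * (2 * a)" using pos[OF uS] a by (simp add: field_simps)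
    moreover have "q u \<le> M * p u" using M[OF uS] pos[OF uS] by (simp add: field_simps)
    moreover have "0 < 2 * a * p u" using a pos[OF uS] by simp
    ultimately have "q u - 2 * a * (p u + r u) \<le> 0" by (simp add: algebra_simps)
    then show "(r u - p u) * (q u - 2 * a * (p u + r u)) / ((p u)^2 * q u) \<le> 0"
      using order_pq[OF uS] order_qr[OF uS] pos[OF uS]
      by (intro divide_nonpos_nonneg mult_nonneg_nonpos) auto
  qed
  define V where "V = p 0 * q 0 * r 0"
  have V: "0 < V" using pos[OF S(2)] by (simp add: V_def)
  have L1: "0 < L" unfolding L_def using pos[OF S(2)] by (simp add: less_max_iff_disj)
  have M1: "0 < M" using M[OF S(2)] pos[OF S(2)] by (metis divide_pos_pos order_less_le_trans)
  \<comment> \<open>The product gives \<open>V / (M * L) \<le> p^3 \<le> V\<close>. Comparing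
    \<open>p\<close> with its cube on either side of 1 replaces cube roots; hence
    \<open>min 1\<close> here and \<open>max 1 V\<close> in the upper bound.\<close>
  define c where "c = min 1 (V / (M * L))"
  have c: "0 < c" using V L1 M1 by (simp add: c_def)
  have "c \<le> p t \<and> r t \<le> L * max 1 V" if t: "t \<in> S" for t
  proof
    note P = pos[OF t]
    have qM: "q t \<le> M * p t" and rL: "r t \<le> L * p t" using M[OF t] L[OF t] P by (simp_all add: field_simps)
    have Vt: "V = p t * q t * r t" unfolding V_def using volume_const[OF t] by simp
    have "V \<le> p t * (M * p t) * (L * p t)"
      unfolding Vt using P qM rL by (intro mult_mono) auto
    then have up: "V / (M * L) \<le> (p t)^3" using M1 L1 by (simp add: field_simps power3_eq_cube)
    show "c \<le> p t"
    proof (cases "p t \<ge> 1")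
      case False
      then have "(p t)^3 \<le> p t" using P power_decreasing[of 1 3 "p t"] by simp
      then show ?thesis using up by (simp add: c_def)
    qed (simp add: c_def)
    have "p t * p t * p t \<le> p t * q t * r t"
      using P order_pq[OF t] order_qr[OF t] by (intro mult_mono) auto
    then have lo: "(p t)^3 \<le> V" using Vt by (simp add: power3_eq_cube)
    have "p t \<le> max 1 V"
    proof (cases "p t \<ge> 1")
      case True
      then have "p t \<le> (p t)^3" using power_increasing[of 1 3 "p t"] by simp
      then show ?thesis using lo by simp
    qed simp
    then have "L * p t \<le> L * max 1 V" using L1 by (intro mult_left_mono) auto
    then show "r t \<le> L * max 1 V" using rL by simp
  qed
  with c show thesis using that by blast
qed

text \<open>If \<open>q/p\<close> were bounded, the coordinates would be bounded too, and then the
  derivative of \<open>q/p\<close> would have a positive lower bound: linear growth for all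
  time.\<close>

lemma unbounded_ratio_of_infinite_time:
  assumes inf: "\<And>t. 0 \<le> t \<Longrightarrow> t \<in> S"
  shows "\<exists>t\<in>S. M < q t / p t"
proof (rule ccontr)
  assume "\<not> ?thesis"
  then have M: "q t / p t \<le> M" if "t \<in> S" for t using that by force
  obtain c C where c: "0 < c" "\<And>t. t \<in> S \<Longrightarrow> c \<le> p t \<and> r t \<le> C"
    using bounds_of_bounded_ratio[OF M] by blast
  define m where "m = q 0 / p 0"
  have m: "1 < m" unfolding m_def using order_pq[OF S(2)] pos[OF S(2)] by simp
  have C: "0 < C" using c(2)[OF S(2)] pos[OF S(2)] by linarith
  \<comment> \<open>A lower bound for the derivative in \<open>ratio_qp\<close>:
    \<open>q - p \<ge> (m - 1) * p\<close> since \<open>q/p\<close> never falls below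
    \<open>m\<close>, \<open>p + q \<le> 2 * r\<close>, and the remaining \<open>1 / p\<close> is at
    least \<open>1 / C\<close>.\<close>
  define e where "e = (m - 1) * (1 - 4 * a) / C"
  have e: "0 < e" unfolding e_def using m a C by simp
  have grow: "m + e * t \<le> q t / p t" if t: "0 \<le> t" for t
  proof -
    have "q 0 / p 0 - e * 0 \<le> q t / p t - e * t"
    proof (rule nondecreasing_within[OF t, of "\<lambda>t. q t / p t - e * t"])
      fix u assume u: "u \<in> {0..t}"
      have uS: "u \<in> S" using inf u by simp
      show "((\<lambda>t. q t / p t - e * t) has_real_derivative
        (q u - p u) * (r u - 2 * a * (p u + q u)) / ((p u)^2 * r u) - e) (at u within {0..t})"
        by (intro DERIV_diff DERIV_cmult_Id has_field_derivative_subset[OF ratio_qp[OF uS]])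
          (use inf in auto)
      note P = pos[OF uS] and O = order_pq[OF uS] order_qr[OF uS]
      have m_le: "m \<le> q u / p u" unfolding m_def using ratio_qp_mono[OF uS, of 0] u by simp
      have "2 * a * (p u + q u) \<le> 2 * a * (2 * r u)" using O a by (intro mult_left_mono) auto
      then have r_ge: "(1 - 4 * a) * r u \<le> r u - 2 * a * (p u + q u)" by (simp add: algebra_simps)
      have q_ge: "(m - 1) * p u \<le> q u - p u" using m_le P by (simp add: field_simps)
      have "((m - 1) * p u) * ((1 - 4 * a) * r u) \<le> (q u - p u) * (r u - 2 * a * (p u + q u))"
        using q_ge r_ge m a P O by (intro mult_mono) auto
      then have "((m - 1) * p u) * ((1 - 4 * a) * r u) / ((p u)^2 * r u) \<le>
          (q u - p u) * (r u - 2 * a * (p u + q u)) / ((p u)^2 * r u)"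
        using P by (intro divide_right_mono) auto
      moreover have "((m - 1) * p u) * ((1 - 4 * a) * r u) / ((p u)^2 * r u) = (m - 1) * (1 - 4 * a) / p u"
        using P by (simp add: field_simps power2_eq_square)
      moreover have "e \<le> (m - 1) * (1 - 4 * a) / p u"
        unfolding e_def using m a P O c(2)[OF uS] by (intro divide_left_mono) auto
      ultimately show "0 \<le> (q u - p u) * (r u - 2 * a * (p u + q u)) / ((p u)^2 * r u) - e" by linarith
    qed
    then show ?thesis by (simp add: m_def)
  qed
  have "0 < M" using m M[OF S(2)] unfolding m_def by linarith
  \<comment> \<open>At time \<open>M / e\<close> the linear lower bound has the value
    \<open>m + M\<close>, which exceeds \<open>M\<close>.\<close>
  then have "0 \<le> M / e" using e by simp
  from grow[OF this] M[OF inf[OF this]] e m show False by simp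
qed

text \<open>Two things must be shown: \<open>w = (r - q)/p\<close> reaches \<open>1/a\<close> after
  some time \<open>t1\<close>, and it never falls below afterwards. The estimate \<open>key\<close>
  serves both: as a comparison of logarithmic derivatives for the first, and as nonnegativity of the
  derivative of \<open>w\<close> below \<open>1/a\<close> for the second.\<close>

lemma eventually_large_defect:
  assumes unbounded: "\<And>M. \<exists>t\<in>S. M < q t / p t"
  obtains t0 where "0 < t0" "t0 \<in> S" "\<And>t. t \<in> S \<Longrightarrow> t0 \<le> t \<Longrightarrow> p t / a \<le> r t - q t"
proof -
  \<comment> \<open>Half of the coefficient of \<open>q r\<close> in the numerator of
    \<open>w'\<close>: one half absorbs the loss \<open>2 * a * (r - q)^2\<close>, the other is left
    for the comparison with \<open>q/p\<close>.\<close>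
  define \<kappa> where "\<kappa> = (1 - 6 * a) / 2"
  have \<kappa>: "0 < \<kappa>" using a by (simp add: \<kappa>_def)
  \<comment> \<open>If \<open>w < 1/a\<close>, the loss is at most \<open>2 * p^2 / a\<close>, which
    is below \<open>\<kappa> * q^2\<close> once \<open>q/p\<close> exceeds the second entry, since
    \<open>M \<le> M^2\<close>. The first entry forces \<open>t1 > 0\<close>, so that the final time
    is positive.\<close>
  define M where "M = max (q 0 / p 0) (2 / (a * \<kappa>))"
  have "1 \<le> q 0 / p 0" using pos[OF S(2)] order_pq[OF S(2)] by simp
  then have M: "1 \<le> M" unfolding M_def by linarith
  obtain t1 where t1: "t1 \<in> S" "M < q t1 / p t1" using unbounded by blast
  have "0 \<le> t1" using t1 S by blast
  moreover have "t1 \<noteq> 0" using t1 by (auto simp: M_def)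
  ultimately have t1pos: "0 < t1" by simp
  have key: "\<kappa> * ((q t - p t) * (r t - 2 * a * (p t + q t))) \<le>
      (1 - 2 * a) * q t * r t - 2 * a * ((q t)^2 + (r t)^2 - (p t)^2)"
    if t: "t \<in> S" "t1 \<le> t" and small: "(r t - q t) / p t < 1 / a" for t
  proof -
    note P = pos[OF t(1)] and O = order_pq[OF t(1)] order_qr[OF t(1)]
    have "M \<le> q t / p t" using ratio_qp_mono[OF t(1) _ t(2)] t1 t1pos by simp
    then have qp: "M * p t \<le> q t" using P by (simp add: field_simps)
    have "2 * a * (p t + q t) > 0" using a P by simp
    then have k1: "(q t - p t) * (r t - 2 * a * (p t + q t)) \<le> q t * r t"
      using P O by (intro order_trans[OF mult_left_mono[of _ "r t"] mult_right_mono]) auto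
    have d: "r t - q t \<le> p t / a" using small P a by (simp add: field_simps)
    have "(r t - q t)^2 \<le> (p t / a)^2" using d O by (intro power_mono) auto
    then have "2 * a * (r t - q t)^2 \<le> 2 * a * (p t / a)^2" using a by (intro mult_left_mono) auto
    also have "\<dots> = (2 / (a * \<kappa>)) * (\<kappa> * (p t)^2)" using a \<kappa> by (simp add: field_simps power2_eq_square)
    also have "\<dots> \<le> M^2 * (\<kappa> * (p t)^2)"
    proof (intro mult_right_mono)
      have "2 / (a * \<kappa>) \<le> M" by (simp add: M_def)
      also have "M \<le> M^2" using M by (simp add: power2_eq_square)
      finally show "2 / (a * \<kappa>) \<le> M^2" .
    qed (use \<kappa> in simp)
    also have "\<dots> = \<kappa> * (M * p t)^2" by (simp add: power_mult_distrib)
    also have "\<dots> \<le> \<kappa> * (q t)^2"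
      using qp \<kappa> M P by (intro mult_left_mono power_mono) auto
    also have "\<dots> \<le> \<kappa> * (q t * r t)"
      using O P \<kappa> by (intro mult_left_mono) (auto simp: power2_eq_square)
    finally have k2: "2 * a * (r t - q t)^2 \<le> \<kappa> * (q t * r t)" .
    have "(1 - 2 * a) * q t * r t - 2 * a * ((q t)^2 + (r t)^2 - (p t)^2) =
        2 * (\<kappa> * (q t * r t)) - 2 * a * (r t - q t)^2 + 2 * a * (p t)^2"
      by (simp add: \<kappa>_def field_simps power2_eq_square)
    moreover have "\<kappa> * ((q t - p t) * (r t - 2 * a * (p t + q t))) \<le> \<kappa> * (q t * r t)"
      using k1 \<kappa> by (intro mult_left_mono) auto
    moreover have "0 \<le> 2 * a * (p t)^2" using a by simp
    ultimately show ?thesis using k2 by linarith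
  qed
  \<comment> \<open>The left-hand side of \<open>key\<close> without the factor
    \<open>\<kappa>\<close> is the numerator of the derivative of \<open>q/p\<close>; with its sign,
    \<open>key\<close> says that \<open>w\<close> does not decrease while below
    \<open>1/a\<close>.\<close>
  have gain: "0 \<le> (q t - p t) * (r t - 2 * a * (p t + q t))" if t: "t \<in> S" for t
  proof -
    have "2 * a * (p t + q t) \<le> 1 * (p t + q t) * (1/2)" using a pos[OF t] by simp
    also have "\<dots> \<le> r t" using order_pq[OF t] order_qr[OF t] by simp
    finally show ?thesis using order_pq[OF t] by simp
  qed
  obtain t0 where t0: "t0 \<in> S" "t1 \<le> t0" "1 / a \<le> (r t0 - q t0) / p t0"
  proof (rule ccontr)
    assume "\<not> thesis"
    with that have small: "(r t - q t) / p t < 1 / a" if "t \<in> S" "t1 \<le> t" for t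
      using that by force
    \<comment> \<open>After division by the common factor \<open>p q r\<close>, \<open>key\<close>
      states exactly that the derivative of this function is nonnegative. Hence \<open>ln w\<close>
      is at least a constant plus \<open>\<kappa> * ln (q/p)\<close>.\<close>
    define \<phi> where "\<phi> = (\<lambda>t. ln ((r t - q t) / p t) - \<kappa> * ln (q t / p t))"
    have mono: "\<phi> t1 \<le> \<phi> t" if t: "t \<in> S" "t1 \<le> t" for t
    proof (rule nondecreasing_within[OF t(2)])
      fix u assume u: "u \<in> {t1..t}"
      have uS: "u \<in> S" using segment[OF t(1) u] t1pos by simp
      have sub: "{t1..t} \<subseteq> S" using segment_subset[OF t(1)] t1pos by simp
      note P = pos[OF uS] and O = order_pq[OF uS] order_qr[OF uS]
      let ?N = "(1 - 2 * a) * q u * r u - 2 * a * ((q u)^2 + (r u)^2 - (p u)^2)"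
      let ?G = "(q u - p u) * (r u - 2 * a * (p u + q u))"
      have "(\<phi> has_real_derivative (1 / ((r u - q u) / p u)) * ((r u - q u) * ?N / ((p u)^2 * q u * r u))
          - \<kappa> * (1 / (q u / p u) * (?G / ((p u)^2 * r u)))) (at u within {t1..t})"
        unfolding \<phi>_def using P O
        by (intro DERIV_diff DERIV_cmult DERIV_chain2[OF DERIV_ln_divide]
            has_field_derivative_subset[OF defect[OF uS] sub] has_field_derivative_subset[OF ratio_qp[OF uS] sub]) auto
      also have "(1 / ((r u - q u) / p u)) * ((r u - q u) * ?N / ((p u)^2 * q u * r u))
          - \<kappa> * (1 / (q u / p u) * (?G / ((p u)^2 * r u))) = (?N - \<kappa> * ?G) / (p u * q u * r u)"
      proof -
        have "(1 / (d / x)) * (d * n / (x^2 * y * z)) - \<kappa> * (1 / (y / x) * (g / (x^2 * z))) = (n - \<kappa> * g) / (x * y * z)"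
          if "0 < d" "0 < x" "0 < y" "0 < z" for d x y z n g :: real
          using that by (simp add: divide_simps) (simp add: algebra_simps power2_eq_square)
        from this[of "r u - q u" "p u" "q u" "r u" ?N ?G] show ?thesis using P O by simp
      qed
      finally show "(\<phi> has_real_derivative (?N - \<kappa> * ?G) / (p u * q u * r u)) (at u within {t1..t})" .
      show "0 \<le> (?N - \<kappa> * ?G) / (p u * q u * r u)"
        using key[OF uS _ small[OF uS]] u P by simp
    qed
    \<comment> \<open>The value of \<open>q/p\<close> beyond which monotonicity of
      \<open>\<phi>\<close> forces \<open>w \<ge> 1/a\<close>. Asking also for more than
      \<open>q t1 / p t1\<close> places \<open>t2\<close> after \<open>t1\<close>, because the
      quotient is nondecreasing.\<close>
    define E where "E = exp ((ln (1 / a) - \<phi> t1) / \<kappa>)"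
    obtain t2 where t2: "t2 \<in> S" "max E (q t1 / p t1) < q t2 / p t2" using unbounded by blast
    have "t1 \<le> t2"
      using ratio_qp_mono[OF t1(1), of t2] S(1)[OF t2(1)] t2(2) by force
    note P = pos[OF t2(1)] and O = order_pq[OF t2(1)] order_qr[OF t2(1)]
    have "ln E \<le> ln (q t2 / p t2)" using t2(2) P by (intro ln_mono) (auto simp: E_def)
    then have "ln (1 / a) - \<phi> t1 \<le> \<kappa> * ln (q t2 / p t2)"
      using \<kappa> by (simp add: E_def field_simps)
    with mono[OF t2(1) \<open>t1 \<le> t2\<close>] have "ln (1 / a) \<le> ln ((r t2 - q t2) / p t2)"
      by (simp add: \<phi>_def)
    moreover have "ln ((r t2 - q t2) / p t2) < ln (1 / a)"
      using small[OF t2(1) \<open>t1 \<le> t2\<close>] P O a by (intro ln_less_cancel_iff[THEN iffD2]) auto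
    ultimately show False by simp
  qed
  show thesis
  proof (rule that[of t0])
    show "0 < t0" "t0 \<in> S" using t0 t1pos by auto
    fix t assume t: "t \<in> S" "t0 \<le> t"
    have sub: "{t0..t} \<subseteq> S" using segment_subset[OF t(1)] t1pos t0 by simp
    have "1 / a \<le> (r t - q t) / p t"
    proof (rule lower_barrier[OF t(2), where f = "\<lambda>t. (r t - q t) / p t"])
      fix u assume u: "u \<in> {t0..t}"
      have uS: "u \<in> S" using sub u by blast
      note P = pos[OF uS] and O = order_pq[OF uS] order_qr[OF uS]
      show "((\<lambda>t. (r t - q t) / p t) has_real_derivative
        (r u - q u) * ((1 - 2 * a) * q u * r u - 2 * a * ((q u)^2 + (r u)^2 - (p u)^2)) / ((p u)^2 * q u * r u))
        (at u within {t0..t})"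
        by (rule has_field_derivative_subset[OF defect[OF uS] sub])
      assume "(r u - q u) / p u < 1 / a"
      then have "0 \<le> (1 - 2 * a) * q u * r u - 2 * a * ((q u)^2 + (r u)^2 - (p u)^2)"
        using key[OF uS] gain[OF uS] \<kappa> u t0 by (smt (verit) atLeastAtMost_iff mult_nonneg_nonneg)
      then show "0 \<le> (r u - q u) * ((1 - 2 * a) * q u * r u - 2 * a * ((q u)^2 + (r u)^2 - (p u)^2)) / ((p u)^2 * q u * r u)"
        using P O by simp
    qed (use t0 in auto)
    then show "p t / a \<le> r t - q t" using pos[OF t(1)] a by (simp add: field_simps)
  qed
qed

text \<open>Times \<open>2 * p * q * r\<close> the expression is
  \<open>p * r + a * (q^2 - r^2 - p^2)\<close>. Multiplying \<open>p \<le> a * (r - q)\<close> by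
  \<open>r + q\<close> bounds it by \<open>- p * q - a * p^2\<close>, which is negative.\<close>

lemma negative_middle_ricci:
  assumes t: "t \<in> S" and d: "p t / a \<le> r t - q t"
  shows "1 / (2 * q t) + a / 2 * (q t / (r t * p t) - r t / (p t * q t) - p t / (q t * r t)) < 0"
proof -
  note P = pos[OF t]
  have "p t \<le> a * (r t - q t)" using d a by (simp add: field_simps)
  then have "p t * (r t + q t) \<le> a * (r t - q t) * (r t + q t)" using P by (intro mult_right_mono) auto
  moreover have "0 < p t * q t" "0 < a * (p t)^2" using P a by simp_all
  moreover have "a * (r t - q t) * (r t + q t) = a * (r t)^2 - a * (q t)^2"
    by (simp add: algebra_simps power2_eq_square)
  ultimately have "p t * r t + a * ((q t)^2 - (r t)^2 - (p t)^2) < 0"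
    unfolding distrib_left right_diff_distrib by linarith
  moreover have "1 / (2 * q t) + a / 2 * (q t / (r t * p t) - r t / (p t * q t) - p t / (q t * r t)) =
      (p t * r t + a * ((q t)^2 - (r t)^2 - (p t)^2)) / (2 * p t * q t * r t)"
    using P by (simp add: divide_simps) (simp add: algebra_simps power2_eq_square)
  ultimately show ?thesis using P by (simp add: divide_neg_pos)
qed

end

section \<open>Local Lipschitz continuity of the flow field\<close>

text \<open>Boundedness is included so that the property passes to products;
  \<open>positive_lipschitz\<close> adds a lower bound away from zero so that it passes to
  quotients. The rational flow field is then handled by structural rules.\<close>

definition bounded_lipschitz :: "'a::metric_space set \<Rightarrow> ('a \<Rightarrow> real) \<Rightarrow> bool" where
  "bounded_lipschitz S f \<longleftrightarrow> (\<exists>B. \<forall>z\<in>S. \<bar>f z\<bar> \<le> B) \<and> (\<exists>L. L-lipschitz_on S f)"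

definition positive_lipschitz :: "'a::metric_space set \<Rightarrow> ('a \<Rightarrow> real) \<Rightarrow> bool" where
  "positive_lipschitz S f \<longleftrightarrow> bounded_lipschitz S f \<and> (\<exists>e>0. \<forall>z\<in>S. e \<le> f z)"

lemma bounded_lipschitz_const: "bounded_lipschitz S (\<lambda>_. c)"
  unfolding bounded_lipschitz_def by (auto intro: lipschitz_intros)

lemma bounded_lipschitz_add:
  assumes "bounded_lipschitz S f" "bounded_lipschitz S g"
  shows "bounded_lipschitz S (\<lambda>z. f z + g z)"
proof -
  obtain B B' where "\<forall>z\<in>S. \<bar>f z\<bar> \<le> B" "\<forall>z\<in>S. \<bar>g z\<bar> \<le> B'"
    using assms unfolding bounded_lipschitz_def by blast
  then have "\<forall>z\<in>S. \<bar>f z + g z\<bar> \<le> B + B'" by fastforce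
  then show ?thesis using assms unfolding bounded_lipschitz_def by (blast intro: lipschitz_on_add)
qed

lemma bounded_lipschitz_mult:
  assumes f: "bounded_lipschitz S f" and g: "bounded_lipschitz S g"
  shows "bounded_lipschitz S (\<lambda>z. f z * g z)"
proof -
  obtain B B' where B: "\<And>z. z \<in> S \<Longrightarrow> \<bar>f z\<bar> \<le> B" "\<And>z. z \<in> S \<Longrightarrow> \<bar>g z\<bar> \<le> B'"
    using f g unfolding bounded_lipschitz_def by blast
  obtain L L' where L: "L-lipschitz_on S f" "L'-lipschitz_on S g"
    using f g unfolding bounded_lipschitz_def by blast
  have "\<forall>z\<in>S. \<bar>f z * g z\<bar> \<le> \<bar>B\<bar> * \<bar>B'\<bar>"
    unfolding abs_mult using B by (intro ballI mult_mono) fastforce+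
  moreover have "(\<bar>B\<bar> * L' + \<bar>B'\<bar> * L)-lipschitz_on S (\<lambda>z. f z * g z)"
  proof (rule lipschitz_onI)
    show "0 \<le> \<bar>B\<bar> * L' + \<bar>B'\<bar> * L"
      using lipschitz_on_nonneg[OF L(1)] lipschitz_on_nonneg[OF L(2)] by simp
    fix y z assume yz: "y \<in> S" "z \<in> S"
    have "f y * g y - f z * g z = f y * (g y - g z) + g z * (f y - f z)" by (simp add: algebra_simps)
    then have "\<bar>f y * g y - f z * g z\<bar> \<le> \<bar>f y\<bar> * \<bar>g y - g z\<bar> + \<bar>g z\<bar> * \<bar>f y - f z\<bar>"
      by (metis abs_mult abs_triangle_ineq)
    also have "\<dots> \<le> \<bar>B\<bar> * (L' * dist y z) + \<bar>B'\<bar> * (L * dist y z)"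
      using B yz lipschitz_onD[OF L(1) yz] lipschitz_onD[OF L(2) yz]
      by (intro add_mono mult_mono) (fastforce simp: dist_real_def)+
    finally show "dist (f y * g y) (f z * g z) \<le> (\<bar>B\<bar> * L' + \<bar>B'\<bar> * L) * dist y z"
      by (simp add: dist_real_def algebra_simps)
  qed
  ultimately show ?thesis unfolding bounded_lipschitz_def by blast
qed

lemma bounded_lipschitz_diff:
  assumes "bounded_lipschitz S f" "bounded_lipschitz S g"
  shows "bounded_lipschitz S (\<lambda>z. f z - g z)"
  using bounded_lipschitz_add[OF assms(1) bounded_lipschitz_mult[OF bounded_lipschitz_const[of S "-1"] assms(2)]]
  by simp

lemma bounded_lipschitz_divide:
  assumes f: "bounded_lipschitz S f" and g: "positive_lipschitz S g"
  shows "bounded_lipschitz S (\<lambda>z. f z / g z)"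
proof -
  obtain e where e: "0 < e" "\<And>z. z \<in> S \<Longrightarrow> e \<le> g z" using g unfolding positive_lipschitz_def by blast
  obtain L where L: "L-lipschitz_on S g" using g unfolding positive_lipschitz_def bounded_lipschitz_def by blast
  have "bounded_lipschitz S (\<lambda>z. inverse (g z))"
    unfolding bounded_lipschitz_def
  proof (intro conjI exI)
    show "\<forall>z\<in>S. \<bar>inverse (g z)\<bar> \<le> inverse e" using e by (auto intro!: le_imp_inverse_le simp: abs_of_pos dest!: e(2))
    show "(L / (e * e))-lipschitz_on S (\<lambda>z. inverse (g z))"
    proof (rule lipschitz_onI)
      show "0 \<le> L / (e * e)" using lipschitz_on_nonneg[OF L] e by simp
      fix y z assume yz: "y \<in> S" "z \<in> S"
      have p: "0 < g y" "0 < g z" using e yz by (meson order_less_le_trans)+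
      have "dist (inverse (g y)) (inverse (g z)) = \<bar>g y - g z\<bar> / (g y * g z)"
        using p by (simp add: dist_real_def inverse_eq_divide divide_simps abs_minus_commute)
      also have "\<dots> \<le> (L * dist y z) / (e * e)"
        using e(2)[OF yz(1)] e(2)[OF yz(2)] e(1) lipschitz_onD[OF L yz]
        by (intro frac_le mult_mono) (auto simp: dist_real_def)
      finally show "dist (inverse (g y)) (inverse (g z)) \<le> L / (e * e) * dist y z" by simp
    qed
  qed
  from bounded_lipschitz_mult[OF f this] show ?thesis by (simp add: divide_inverse)
qed

lemma positive_lipschitz_mult:
  assumes f: "positive_lipschitz S f" and g: "positive_lipschitz S g"
  shows "positive_lipschitz S (\<lambda>z. f z * g z)"
proof -
  obtain d e where "0 < d" "\<And>z. z \<in> S \<Longrightarrow> d \<le> f z" "0 < e" "\<And>z. z \<in> S \<Longrightarrow> e \<le> g z"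
    using assms unfolding positive_lipschitz_def by blast
  then have "0 < d * e" "\<And>z. z \<in> S \<Longrightarrow> d * e \<le> f z * g z"
    by (simp, meson less_imp_le mult_mono order_trans)
  then show ?thesis using assms bounded_lipschitz_mult unfolding positive_lipschitz_def by blast
qed

lemma positive_lipschitz_const: "0 < c \<Longrightarrow> positive_lipschitz S (\<lambda>_. c)"
  unfolding positive_lipschitz_def using bounded_lipschitz_const by blast

lemma positive_lipschitz_imp_bounded: "positive_lipschitz S f \<Longrightarrow> bounded_lipschitz S f"
  by (simp add: positive_lipschitz_def)

text \<open>Metrics are functions on the index type, while the existence results live on Euclidean
  spaces; this is the same field on \<open>real ^ 3\<close>.\<close>

definition ricci_flow_vector_field :: "(3 \<Rightarrow> real) \<Rightarrow> real ^ 3 \<Rightarrow> real ^ 3" where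
  "ricci_flow_vector_field a z = (\<chi> i. ricci_flow_field a (\<lambda>j. vec_nth z j) i)"

lemma ricci_flow_vector_field_locally_lipschitz:
  assumes z: "\<And>i. 0 < vec_nth z i"
  shows "\<exists>r>0. \<exists>L. cball z r \<subseteq> {z. \<forall>i. 0 < vec_nth z i} \<and> L-lipschitz_on (cball z r) (ricci_flow_vector_field a)"
proof -
  \<comment> \<open>Half the smallest coordinate: on the ball every coordinate stays at least
    \<open>r\<close>, the lower bound that the denominators require.\<close>
  define r where "r = (Min (range (\<lambda>i. vec_nth z i))) / 2"
  have r: "0 < r" "2 * r \<le> vec_nth z i" for i unfolding r_def using z by auto
  let ?S = "cball z r"
  have near: "r \<le> vec_nth y i \<and> \<bar>vec_nth y i\<bar> \<le> \<bar>vec_nth z i\<bar> + r" if "y \<in> ?S" for y i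
  proof -
    have "\<bar>vec_nth y i - vec_nth z i\<bar> \<le> r"
      using that component_le_norm_cart[of "y - z" i] by (simp add: dist_norm norm_minus_commute)
    then show ?thesis using r(2)[of i] r(1) by linarith
  qed
  have coord: "positive_lipschitz ?S (\<lambda>y. vec_nth y i)" for i
    unfolding positive_lipschitz_def bounded_lipschitz_def
  proof (intro conjI)
    have "1-lipschitz_on ?S (\<lambda>y. vec_nth y i)"
      by (rule lipschitz_onI) (simp_all add: dist_vec_nth_le)
    then show "\<exists>L. L-lipschitz_on ?S (\<lambda>y. vec_nth y i)" by blast
  qed (use near r in blast)+
  note intros = bounded_lipschitz_add bounded_lipschitz_mult bounded_lipschitz_diff bounded_lipschitz_divide
    bounded_lipschitz_const positive_lipschitz_mult positive_lipschitz_imp_bounded[OF coord] coord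
  have ric: "bounded_lipschitz ?S (\<lambda>y. ricci a (\<lambda>j. vec_nth y j) i)" for i
    unfolding ricci_def Let_def by (intro intros positive_lipschitz_const) simp
  \<comment> \<open>The sum of the weights is a constant whose sign is not known here, so division
    by it is rewritten as multiplication by a constant.\<close>
  have "bounded_lipschitz ?S (\<lambda>y. ricci_flow_field a (\<lambda>j. vec_nth y j) i)" for i
    unfolding ricci_flow_field_def sum_3 divide_inverse[of _ "_ + _"] by (intro intros ric)
  then have "\<exists>L. L-lipschitz_on ?S (\<lambda>y. ricci_flow_field a (\<lambda>j. vec_nth y j) i)" for i
    unfolding bounded_lipschitz_def by blast
  then obtain L where L: "\<And>i. (L i)-lipschitz_on ?S (\<lambda>y. ricci_flow_field a (\<lambda>j. vec_nth y j) i)" by metis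
  have "(\<Sum>i\<in>UNIV. L i)-lipschitz_on ?S (ricci_flow_vector_field a)"
  proof (rule lipschitz_onI)
    show "0 \<le> (\<Sum>i\<in>UNIV. L i)" using L lipschitz_on_nonneg by (intro sum_nonneg) blast
    fix x y assume xy: "x \<in> ?S" "y \<in> ?S"
    have "dist (ricci_flow_vector_field a x) (ricci_flow_vector_field a y) \<le>
        (\<Sum>i\<in>UNIV. \<bar>vec_nth (ricci_flow_vector_field a x - ricci_flow_vector_field a y) i\<bar>)"
      unfolding dist_norm by (rule norm_le_l1_cart)
    also have "\<dots> \<le> (\<Sum>i\<in>UNIV. L i * dist x y)"
      using lipschitz_onD[OF L xy]
      by (intro sum_mono) (simp add: ricci_flow_vector_field_def dist_real_def)
    finally show "dist (ricci_flow_vector_field a x) (ricci_flow_vector_field a y) \<le> (\<Sum>i\<in>UNIV. L i) * dist x y"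
      by (simp add: sum_distrib_right)
  qed
  moreover have "?S \<subseteq> {z. \<forall>i. 0 < vec_nth z i}" using near less_le_trans[OF r(1)] by blast
  ultimately show ?thesis using r(1) by blast
qed

section \<open>Loss of positivity along a maximal solution\<close>

lemma mean_ricci_commute:
  "mean_ricci a v u w = mean_ricci a u v w" "mean_ricci a u w v = mean_ricci a u v w"
  by (simp_all add: mean_ricci_def algebra_simps)

lemma has_vector_derivative_vec_lambda:
  fixes x :: "real \<Rightarrow> 'n::finite \<Rightarrow> real"
  assumes "\<And>i. ((\<lambda>s. x s i) has_real_derivative d i) (at t within S)"
  shows "((\<lambda>s. \<chi> i. x s i) has_vector_derivative (\<chi> i. d i)) (at t within S)"
  unfolding has_vector_derivative_def
proof (subst has_derivative_componentwise_within, rule ballI)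
  fix b :: "real ^ 'n" assume "b \<in> Basis"
  then obtain i where b: "b = axis i 1" by (auto simp: Basis_vec_def)
  show "((\<lambda>s. inner (\<chi> i. x s i) b) has_derivative (\<lambda>h. inner (h *\<^sub>R (\<chi> i. d i)) b)) (at t within S)"
    using assms[of i] unfolding b has_field_derivative_def
    by (simp add: cart_eq_inner_axis[symmetric] mult.commute[of _ "d i"])
qed

theorem positive_ricci_lost:
  assumes a: "0 < a" "a < 1/6"
    and max: "maximal_ricci_flow_solution (\<lambda>_. a) T x" and inj: "inj (x 0)"
  shows "\<exists>t\<^sub>0 > 0. ereal t\<^sub>0 < T \<and> (\<forall>t. t\<^sub>0 \<le> t \<and> ereal t < T \<longrightarrow> x t \<notin> ricci_positive (\<lambda>_. a))"
proof -
  have sol: "ricci_flow_solution (\<lambda>_. a) T x" using max by (simp add: maximal_ricci_flow_solution_def)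
  have "x 0 1 \<noteq> x 0 2" "x 0 2 \<noteq> x 0 3" "x 0 3 \<noteq> x 0 1" using inj by (auto dest: injD)
  then obtain i j k :: 3 where ord: "x 0 i < x 0 j" "x 0 j < x 0 k"
    by (metis linorder_neqE_linordered_idom)
  then have ijk: "i \<noteq> j" "j \<noteq> k" "k \<noteq> i" by auto
  then have perms: "j \<noteq> i" "i \<noteq> k" "k \<noteq> j" by auto
  define S where "S = {s. 0 \<le> s \<and> ereal s < T}"
  have x: "0 < x t l" "((\<lambda>s. x s l) has_real_derivative ricci_flow_field (\<lambda>_. a) (x t) l) (at t within S)"
    if "t \<in> S" for t l
    using sol that unfolding ricci_flow_solution_def S_def by auto
  have T0: "0 < T" using sol by (simp add: ricci_flow_solution_def)
  have a0: "a \<noteq> 0" using a by simp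
  interpret ordered_flow a S "\<lambda>t. x t i" "\<lambda>t. x t j" "\<lambda>t. x t k"
  proof
    show "0 \<in> S" using T0 by (simp add: S_def zero_ereal_def)
    show "0 \<le> t \<and> {0..t} \<subseteq> S" if "t \<in> S" for t
      using that by (auto simp: S_def intro: le_less_trans[of "ereal _" "ereal t"])
    fix t assume t: "t \<in> S"
    show "0 < x t i \<and> 0 < x t j \<and> 0 < x t k" using x(1)[OF t] by simp
    note field = ricci_flow_field_equal_parameters[where x = "x t", OF _ _ _ a0 x(1)[OF t]]
    show "((\<lambda>t. x t i) has_real_derivative - (1 + a * ((x t i)\<^sup>2 - (x t j)\<^sup>2 - (x t k)\<^sup>2) / (x t j * x t k)) +
        x t i * mean_ricci a (x t i) (x t j) (x t k)) (at t within S)"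
      using x(2)[OF t, of i] field[of i j k] ijk by simp
    show "((\<lambda>t. x t j) has_real_derivative - (1 + a * ((x t j)\<^sup>2 - (x t i)\<^sup>2 - (x t k)\<^sup>2) / (x t i * x t k)) +
        x t j * mean_ricci a (x t i) (x t j) (x t k)) (at t within S)"
      using x(2)[OF t, of j] field[of j i k] perms by (simp add: mean_ricci_commute)
    show "((\<lambda>t. x t k) has_real_derivative - (1 + a * ((x t k)\<^sup>2 - (x t i)\<^sup>2 - (x t j)\<^sup>2) / (x t i * x t j)) +
        x t k * mean_ricci a (x t i) (x t j) (x t k)) (at t within S)"
      using x(2)[OF t, of k] field[of k i j] ijk by (simp add: mean_ricci_commute(1)[of a "x t k" "x t i"] mean_ricci_commute(2))
  qed (use a ord in auto)
  \<comment> \<open>If the quotient is bounded, then the life span is finite, because infinite time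
    forces unbounded growth. But then the solution stays in the cube \<open>K\<close> and extends
    beyond \<open>T\<close>, contrary to maximality.\<close>
  have "\<exists>t\<in>S. M < x t j / x t i" for M
  proof (rule ccontr)
    assume bounded: "\<not> ?thesis"
    then have "x t j / x t i \<le> M" if "t \<in> S" for t using that by force
    then obtain c C where c: "0 < c" "\<And>t. t \<in> S \<Longrightarrow> c \<le> x t i \<and> x t k \<le> C"
      using bounds_of_bounded_ratio by blast
    have "T \<noteq> \<infinity>" using unbounded_ratio_of_infinite_time[of M] bounded by (auto simp: S_def)
    then obtain T1 where T1: "T = ereal T1" "0 < T1" using T0 by (cases T) auto
    have S_eq: "S = {0..<T1}" using T1 by (auto simp: S_def)
    define X where "X = (\<lambda>t. \<chi> l. x t l)"
    define K :: "(real ^ 3) set" where "K = cbox (\<chi> l. c) (\<chi> l. C)"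
    have XK: "X t \<in> K" if t: "t \<in> S" for t
    proof -
      have "c \<le> x t l \<and> x t l \<le> C" for l
      proof -
        have "l = i \<or> l = j \<or> l = k" using UNIV_3_distinct[OF ijk] by blast
        then show ?thesis using c(2)[OF t] order_pq[OF t] order_qr[OF t] by (elim disjE) auto
      qed
      then show ?thesis by (simp add: K_def X_def mem_box_cart)
    qed
    have der: "(X has_vector_derivative ricci_flow_vector_field (\<lambda>_. a) (X t)) (at t within {0..<T1})"
      if "t \<in> {0..<T1}" for t
      using that x(2) unfolding X_def ricci_flow_vector_field_def S_eq
      by (intro has_vector_derivative_vec_lambda) (simp add: vec_lambda_inverse)
    have K: "compact K" "K \<subseteq> {z. \<forall>l. 0 < vec_nth z l}"
      using c(1) by (auto simp: K_def compact_cbox mem_box_cart intro: less_le_trans)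
    obtain T' y where T': "T1 < T'" and y: "\<And>t. t \<in> {0..<T1} \<Longrightarrow> y t = X t"
      "\<And>t. t \<in> {0..<T'} \<Longrightarrow> y t \<in> {z. \<forall>l. 0 < vec_nth z l}"
      "\<And>t. t \<in> {0..<T'} \<Longrightarrow>
        (y has_vector_derivative ricci_flow_vector_field (\<lambda>_. a) (y t)) (at t within {0..<T'})"
      by (rule extend_solution[OF T1(2) der K(1) XK[unfolded S_eq] K(2)])
        (use ricci_flow_vector_field_locally_lipschitz in auto)
    have T'_set: "{s. 0 \<le> s \<and> ereal s < ereal T'} = {0..<T'}" by auto
    have "ricci_flow_solution (\<lambda>_. a) (ereal T') (\<lambda>t l. vec_nth (y t) l)"
      unfolding ricci_flow_solution_def T'_set
    proof (intro conjI allI impI)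
      fix t l assume "0 \<le> t \<and> ereal t < ereal T'"
      then have t: "t \<in> {0..<T'}" by simp
      show "0 < vec_nth (y t) l" using y(2)[OF t] by simp
      have "((\<lambda>s. vec_nth (y s) l) has_derivative (\<lambda>h. vec_nth (h *\<^sub>R ricci_flow_vector_field (\<lambda>_. a) (y t)) l)) (at t within {0..<T'})"
        using y(3)[OF t] unfolding has_vector_derivative_def by (rule bounded_linear.has_derivative[OF bounded_linear_vec_nth])
      then show "((\<lambda>s. vec_nth (y s) l) has_real_derivative ricci_flow_field (\<lambda>_. a) (\<lambda>l. vec_nth (y t) l) l) (at t within {0..<T'})"
        by (simp add: has_field_derivative_def ricci_flow_vector_field_def mult.commute[of _ "ricci_flow_field _ _ _"])
    qed (use T' T1 in auto)
    moreover have "(\<lambda>l. vec_nth (y t) l) = x t" if "0 \<le> t \<and> ereal t < T" for t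
      using y(1)[of t] that T1 by (simp add: X_def)
    moreover have "T \<le> ereal T'" using T' T1 by simp
    ultimately have "ereal T' = T"
      using max unfolding maximal_ricci_flow_solution_def by blast
    then show False using T' T1 by simp
  qed
  then obtain t0 where t0: "0 < t0" "t0 \<in> S" "\<And>t. t \<in> S \<Longrightarrow> t0 \<le> t \<Longrightarrow> x t i / a \<le> x t k - x t j"
    using eventually_large_defect by blast
  show ?thesis
  proof (intro exI conjI allI impI)
    show "0 < t0" "ereal t0 < T" using t0 by (auto simp: S_def)
    fix t assume t: "t0 \<le> t \<and> ereal t < T"
    then have tS: "t \<in> S" using t0 by (simp add: S_def)
    have "ricci (\<lambda>_. a) (x t) j < 0"
      using negative_middle_ricci[OF tS t0(3)[OF tS]] t unfolding ricci_distinct[OF ijk(2,3,1)] by simp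
    then show "x t \<notin> ricci_positive (\<lambda>_. a)" by (auto simp: ricci_positive_def intro!: exI[of _ j])
  qed
qed


section \<open>Traces on real matrix spaces\<close>

lemma mult_entry:
  assumes "X \<in> carrier_mat n n" "Y \<in> carrier_mat n n" "i < n" "j < n"
  shows "(X * Y) $$ (i, j) = (\<Sum>l<n. X $$ (i, l) * Y $$ (l, j))"
  using assms by (auto simp: scalar_prod_def lessThan_atLeast0)

lemma square_eqI:
  assumes "X \<in> carrier_mat n n" "Y \<in> carrier_mat n n"
    and "\<And>i j. i < n \<Longrightarrow> j < n \<Longrightarrow> X $$ (i, j) = Y $$ (i, j)"
  shows "X = Y"
  using assms by (intro eq_matI) auto

lemma lie_bracket_carrier [simp]:
  "X \<in> carrier_mat n n \<Longrightarrow> Y \<in> carrier_mat n n \<Longrightarrow> lie_bracket X Y \<in> carrier_mat n n"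
  unfolding lie_bracket_def by (intro minus_carrier_mat mult_carrier_mat)

lemma lie_bracket_entry:
  assumes "X \<in> carrier_mat n n" "Y \<in> carrier_mat n n" "i < n" "j < n"
  shows "lie_bracket X Y $$ (i, j) = (\<Sum>l<n. X $$ (i, l) * Y $$ (l, j)) - (\<Sum>l<n. Y $$ (i, l) * X $$ (l, j))"
  using assms mult_entry[OF assms] mult_entry[OF assms(2,1,3,4)]
  unfolding lie_bracket_def by (subst index_minus_mat) auto

lemma real_smult_carrier [simp]: "X \<in> carrier_mat n n \<Longrightarrow> real_smult c X \<in> carrier_mat n n"
  by (simp add: real_smult_def)

lemma real_smult_dim [simp]: "dim_row (real_smult c X) = dim_row X" "dim_col (real_smult c X) = dim_col X"
  by (simp_all add: real_smult_def)

lemma real_smult_entry [simp]: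
  "i < dim_row X \<Longrightarrow> j < dim_col X \<Longrightarrow> real_smult c X $$ (i, j) = complex_of_real c * X $$ (i, j)"
  by (simp add: real_smult_def)

lemma lie_bracket_add:
  assumes "X \<in> carrier_mat n n" "Y \<in> carrier_mat n n" "Z \<in> carrier_mat n n"
  shows "lie_bracket X (Y + Z) = lie_bracket X Y + lie_bracket X Z"
proof (rule square_eqI[of _ n])
  fix i j assume ij: "i < n" "j < n"
  have YZ: "Y + Z \<in> carrier_mat n n" using assms by simp
  have "(lie_bracket X Y + lie_bracket X Z) $$ (i, j) = lie_bracket X Y $$ (i, j) + lie_bracket X Z $$ (i, j)"
    using ij carrier_matD[OF lie_bracket_carrier[OF assms(1,3)]] by simp
  then show "lie_bracket X (Y + Z) $$ (i, j) = (lie_bracket X Y + lie_bracket X Z) $$ (i, j)"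
    using ij assms by (simp add: lie_bracket_entry[OF assms(1) YZ] lie_bracket_entry[OF assms(1,2)]
      lie_bracket_entry[OF assms(1,3)] algebra_simps sum.distrib)
qed (use assms in auto)

lemma lie_bracket_smult:
  assumes "X \<in> carrier_mat n n" "Y \<in> carrier_mat n n"
  shows "lie_bracket X (c \<cdot>\<^sub>m Y) = c \<cdot>\<^sub>m lie_bracket X Y"
proof (rule square_eqI[of _ n])
  fix i j assume ij: "i < n" "j < n"
  have cY: "c \<cdot>\<^sub>m Y \<in> carrier_mat n n" using assms by simp
  show "lie_bracket X (c \<cdot>\<^sub>m Y) $$ (i, j) = (c \<cdot>\<^sub>m lie_bracket X Y) $$ (i, j)"
    using ij assms carrier_matD[OF lie_bracket_carrier[OF assms]]
    by (simp add: lie_bracket_entry[OF assms(1) cY] lie_bracket_entry[OF assms]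
      algebra_simps sum_distrib_left)
qed (use assms in auto)

definition matrix_sum :: "nat \<Rightarrow> 'i set \<Rightarrow> ('i \<Rightarrow> complex mat) \<Rightarrow> complex mat" where
  "matrix_sum n I F = mat n n (\<lambda>ij. \<Sum>a\<in>I. F a $$ ij)"

lemma matrix_sum_dim [simp]: "dim_row (matrix_sum n I F) = n" "dim_col (matrix_sum n I F) = n"
  by (simp_all add: matrix_sum_def)

lemma matrix_sum_entry [simp]: "i < n \<Longrightarrow> j < n \<Longrightarrow> matrix_sum n I F $$ (i, j) = (\<Sum>a\<in>I. F a $$ (i, j))"
  by (simp add: matrix_sum_def)

lemma matrix_sum_empty: "matrix_sum n {} F = 0\<^sub>m n n"
  by (rule eq_matI) auto

lemma matrix_sum_insert:
  assumes "finite I" "a \<notin> I" "F a \<in> carrier_mat n n"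
  shows "matrix_sum n (insert a I) F = F a + matrix_sum n I F"
  using assms by (intro eq_matI) auto

lemma real_subspaceD:
  assumes "real_subspace n V"
  shows "X \<in> V \<Longrightarrow> X \<in> carrier_mat n n" "0\<^sub>m n n \<in> V" "X \<in> V \<Longrightarrow> Y \<in> V \<Longrightarrow> X + Y \<in> V"
    "X \<in> V \<Longrightarrow> real_smult c X \<in> V"
  using assms by (auto simp: real_subspace_def)

lemma real_subspace_matrix_sum:
  assumes "real_subspace n V" "finite I" "\<And>a. a \<in> I \<Longrightarrow> F a \<in> V"
  shows "matrix_sum n I F \<in> V"
  using assms(2,3)
  by (induction I rule: finite_induct)
    (auto simp: matrix_sum_empty matrix_sum_insert real_subspaceD[OF assms(1)])

lemma linear_matrix_sum:
  assumes V: "real_subspace n V" and I: "finite I" "\<And>a. a \<in> I \<Longrightarrow> F a \<in> V"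
    and add: "\<And>X Y. X \<in> V \<Longrightarrow> Y \<in> V \<Longrightarrow> \<phi> (X + Y) = \<phi> X + (\<phi> Y :: real)"
  shows "\<phi> (matrix_sum n I F) = (\<Sum>a\<in>I. \<phi> (F a))"
proof -
  have "0\<^sub>m n n + 0\<^sub>m n n = (0\<^sub>m n n :: complex mat)" by simp
  with add[of "0\<^sub>m n n" "0\<^sub>m n n"] have "\<phi> (0\<^sub>m n n) = 0" using real_subspaceD(2)[OF V] by simp
  with I show ?thesis
    by (induction I rule: finite_induct)
      (simp_all add: matrix_sum_empty matrix_sum_insert real_subspaceD[OF V] add real_subspace_matrix_sum[OF V])
qed

lemma real_comb_carrier [simp]: "real_comb n d b c \<in> carrier_mat n n"
  by (simp add: real_comb_def)

lemma real_comb_dim [simp]: "dim_row (real_comb n d b c) = n" "dim_col (real_comb n d b c) = n"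
  by (simp_all add: real_comb_def)

lemma real_comb_entry [simp]:
  "i < n \<Longrightarrow> j < n \<Longrightarrow> real_comb n d b c $$ (i, j) = (\<Sum>k<d. complex_of_real (c k) * b k $$ (i, j))"
  by (simp add: real_comb_def)

lemma real_comb_eq_matrix_sum:
  assumes "\<And>k. k < d \<Longrightarrow> b k \<in> carrier_mat n n"
  shows "real_comb n d b c = matrix_sum n {..<d} (\<lambda>k. real_smult (c k) (b k))"
  using carrier_matD[OF assms] by (intro eq_matI) (auto intro!: sum.cong)

lemma real_comb_in_subspace:
  assumes "real_subspace n V" "\<And>k. k < d \<Longrightarrow> b k \<in> V"
  shows "real_comb n d b c \<in> V"
  using assms by (auto simp: real_comb_eq_matrix_sum real_subspaceD intro!: real_subspace_matrix_sum)

lemma real_basis_mem: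
  assumes "real_basis n V d b" "k < d"
  shows "b k \<in> V"
proof -
  let ?c = "\<lambda>l. if l = k then 1 else 0 :: real"
  have "real_comb n d b ?c = b k"
    using assms by (intro square_eqI[of _ n]) (auto simp: real_basis_def if_distrib if_distribR cong: if_cong)
  moreover have "?c \<in> coefficients d" using assms(2) by (simp add: coefficients_def)
  ultimately show ?thesis using assms(1) unfolding real_basis_def bij_betw_def by (metis image_eqI)
qed

lemma coord_inverse:
  assumes "real_basis n V d b" "X \<in> V"
  shows "coord n d b X \<in> coefficients d" "real_comb n d b (coord n d b X) = X"
  using assms inv_into_into[of X "real_comb n d b" "coefficients d"] f_inv_into_f[of X "real_comb n d b" "coefficients d"]
  by (auto simp: real_basis_def bij_betw_def coord_def)

lemma coord_eqI:
  assumes "real_basis n V d b" "c \<in> coefficients d" "real_comb n d b c = X"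
  shows "coord n d b X = c"
  using assms by (auto simp: real_basis_def bij_betw_def coord_def)

lemma coord_add:
  assumes B: "real_basis n V d b" and V: "real_subspace n V" and X: "X \<in> V" and Y: "Y \<in> V"
  shows "coord n d b (X + Y) k = coord n d b X k + coord n d b Y k"
proof -
  have "real_comb n d b (\<lambda>k. coord n d b X k + coord n d b Y k) =
      real_comb n d b (coord n d b X) + real_comb n d b (coord n d b Y)"
    by (intro square_eqI[of _ n]) (auto simp: algebra_simps sum.distrib)
  then have "coord n d b (X + Y) = (\<lambda>k. coord n d b X k + coord n d b Y k)"
    using coord_inverse[OF B X] coord_inverse[OF B Y]
    by (intro coord_eqI[OF B]) (auto simp: coefficients_def)
  then show ?thesis by simp
qed

lemma coord_real_smult:
  assumes B: "real_basis n V d b" and V: "real_subspace n V" and X: "X \<in> V"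
  shows "coord n d b (real_smult c X) k = c * coord n d b X k"
proof -
  have "real_comb n d b (\<lambda>k. c * coord n d b X k) = real_smult c (real_comb n d b (coord n d b X))"
    by (intro square_eqI[of _ n]) (auto simp: sum_distrib_left algebra_simps)
  then have "coord n d b (real_smult c X) = (\<lambda>k. c * coord n d b X k)"
    using coord_inverse[OF B X] by (intro coord_eqI[OF B]) (auto simp: coefficients_def)
  then show ?thesis by simp
qed

lemma coord_basis:
  assumes "real_basis n V d b" "k < d"
  shows "coord n d b (b k) k = 1"
proof -
  let ?c = "\<lambda>l. if l = k then 1 else 0 :: real"
  have "real_comb n d b ?c = b k"
    using assms by (intro square_eqI[of _ n]) (auto simp: real_basis_def if_distrib if_distribR cong: if_cong)
  then have "coord n d b (b k) = ?c"
    using assms by (intro coord_eqI[OF assms(1)]) (auto simp: coefficients_def)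
  then show ?thesis by simp
qed

text \<open>
  If \<open>P i j\<close> sends an entry to \<open>V\<close> and every element of \<open>V\<close> is the sum of the images of its
  entries, then the trace over \<open>V\<close> is a sum over matrix entries, whatever basis was chosen.
\<close>

lemma trace_formula:
  fixes P :: "nat \<Rightarrow> nat \<Rightarrow> complex \<Rightarrow> complex mat"
  assumes B: "real_basis n V d b" and V: "real_subspace n V"
    and fV: "\<And>X. X \<in> V \<Longrightarrow> f X \<in> V"
    and f_add: "\<And>X Y. X \<in> V \<Longrightarrow> Y \<in> V \<Longrightarrow> f (X + Y) = f X + f Y"
    and f_smult: "\<And>c X. X \<in> V \<Longrightarrow> f (real_smult c X) = real_smult c (f X)"
    and PV: "\<And>i j z. i < n \<Longrightarrow> j < n \<Longrightarrow> P i j z \<in> V"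
    and P_lin: "\<And>i j z. i < n \<Longrightarrow> j < n \<Longrightarrow> P i j z = real_smult (Re z) (P i j 1) + real_smult (Im z) (P i j \<i>)"
    and decomp: "\<And>X. X \<in> V \<Longrightarrow> X = matrix_sum n ({..<n} \<times> {..<n}) (\<lambda>(i, j). P i j (X $$ (i, j)))"
  shows "(\<Sum>k<d. coord n d b (f (b k)) k) =
    (\<Sum>i<n. \<Sum>j<n. Re (f (P i j 1) $$ (i, j)) + Im (f (P i j \<i>) $$ (i, j)))"
proof -
  let ?I = "{..<n} \<times> {..<n}"
  note sub = real_subspaceD[OF V]
  have ent: "(\<Sum>k<d. coord n d b Y k * Re (b k $$ (i, j))) = Re (Y $$ (i, j))"
    "(\<Sum>k<d. coord n d b Y k * Im (b k $$ (i, j))) = Im (Y $$ (i, j))"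
    if "Y \<in> V" "i < n" "j < n" for Y i j
    using arg_cong[OF coord_inverse(2)[OF B that(1)], of "\<lambda>Y. Re (Y $$ (i, j))"]
      arg_cong[OF coord_inverse(2)[OF B that(1)], of "\<lambda>Y. Im (Y $$ (i, j))"] that
    by (simp_all add: Re_sum Im_sum)
  \<comment> \<open>Writing each basis vector as the sum of the images of its entries expresses the
    trace through \<open>f (P i j 1)\<close> and \<open>f (P i j \<i>)\<close>. Once the sum over
    \<open>k\<close> is innermost, \<open>ent\<close> reassembles their coordinates into a single
    matrix entry.\<close>
  have "(\<Sum>k<d. coord n d b (f (b k)) k) =
      (\<Sum>k<d. \<Sum>(i, j)\<in>?I. coord n d b (f (P i j 1)) k * Re (b k $$ (i, j)) +
        coord n d b (f (P i j \<i>)) k * Im (b k $$ (i, j)))"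
  proof (rule sum.cong[OF refl])
    fix k assume "k \<in> {..<d}"
    then have bk: "b k \<in> V" using real_basis_mem[OF B] by simp
    let ?\<phi> = "\<lambda>X. coord n d b (f X) k"
    have add: "?\<phi> (X + Y) = ?\<phi> X + ?\<phi> Y" if "X \<in> V" "Y \<in> V" for X Y
      using that by (simp add: f_add coord_add[OF B V] fV)
    have smult: "?\<phi> (real_smult c X) = c * ?\<phi> X" if "X \<in> V" for X c
      using that by (simp add: f_smult coord_real_smult[OF B V] fV)
    have "?\<phi> (b k) = ?\<phi> (matrix_sum n ?I (\<lambda>(i, j). P i j (b k $$ (i, j))))" using decomp[OF bk] by simp
    also have "\<dots> = (\<Sum>a\<in>?I. ?\<phi> (case a of (i, j) \<Rightarrow> P i j (b k $$ (i, j))))"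
      using add PV by (intro linear_matrix_sum[OF V]) auto
    also have "\<dots> = (\<Sum>(i, j)\<in>?I. coord n d b (f (P i j 1)) k * Re (b k $$ (i, j)) +
        coord n d b (f (P i j \<i>)) k * Im (b k $$ (i, j)))"
    proof (rule sum.cong[OF refl], clarify)
      fix i j assume ij: "i < n" "j < n"
      show "?\<phi> (P i j (b k $$ (i, j))) = ?\<phi> (P i j 1) * Re (b k $$ (i, j)) + ?\<phi> (P i j \<i>) * Im (b k $$ (i, j))"
        by (subst P_lin[OF ij]) (simp add: add smult PV[OF ij] sub(4) mult.commute)
    qed
    finally show "?\<phi> (b k) = (\<Sum>(i, j)\<in>?I. coord n d b (f (P i j 1)) k * Re (b k $$ (i, j)) +
        coord n d b (f (P i j \<i>)) k * Im (b k $$ (i, j)))" .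
  qed
  also have "\<dots> = (\<Sum>(i, j)\<in>?I. Re (f (P i j 1) $$ (i, j)) + Im (f (P i j \<i>) $$ (i, j)))"
    unfolding case_prod_beta
    by (subst sum.swap, rule sum.cong[OF refl]) (auto simp: sum.distrib ent fV PV)
  finally show ?thesis by (simp add: sum.cartesian_product)
qed

section \<open>The Euclidean structure on matrices and existence of bases\<close>

text \<open>The real part of the trace of \<open>X\<close> times the conjugate transpose of
  \<open>Y\<close>. On the symplectic algebra the Killing form is a negative multiple of it.\<close>

definition frobenius :: "nat \<Rightarrow> complex mat \<Rightarrow> complex mat \<Rightarrow> real" where
  "frobenius n X Y = (\<Sum>i<n. \<Sum>j<n. Re (X $$ (i, j) * cnj (Y $$ (i, j))))"

lemma frobenius_commute: "frobenius n X Y = frobenius n Y X"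
  by (auto simp: frobenius_def mult.commute intro!: sum.cong)

lemma frobenius_add_left:
  "X \<in> carrier_mat n n \<Longrightarrow> Y \<in> carrier_mat n n \<Longrightarrow> frobenius n (X + Y) Z = frobenius n X Z + frobenius n Y Z"
  by (simp add: frobenius_def algebra_simps sum.distrib)

lemma frobenius_diff_left:
  "X \<in> carrier_mat n n \<Longrightarrow> Y \<in> carrier_mat n n \<Longrightarrow> frobenius n (X - Y) Z = frobenius n X Z - frobenius n Y Z"
  by (simp add: frobenius_def algebra_simps sum_subtractf)

lemma frobenius_diff_right:
  "X \<in> carrier_mat n n \<Longrightarrow> Y \<in> carrier_mat n n \<Longrightarrow> frobenius n Z (X - Y) = frobenius n Z X - frobenius n Z Y"
  by (metis frobenius_commute frobenius_diff_left)

lemma frobenius_real_smult_left: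
  "X \<in> carrier_mat n n \<Longrightarrow> frobenius n (real_smult c X) Z = c * frobenius n X Z"
  by (simp add: frobenius_def algebra_simps sum_distrib_left)

lemma frobenius_real_smult_right:
  "X \<in> carrier_mat n n \<Longrightarrow> frobenius n Z (real_smult c X) = c * frobenius n Z X"
  by (metis frobenius_commute frobenius_real_smult_left)

lemma frobenius_real_comb:
  "frobenius n (real_comb n d b c) Z = (\<Sum>k<d. c k * frobenius n (b k) Z)"
proof -
  have "frobenius n (real_comb n d b c) Z =
      (\<Sum>i<n. \<Sum>j<n. \<Sum>k<d. c k * Re (b k $$ (i, j) * cnj (Z $$ (i, j))))"
    unfolding frobenius_def
    by (intro sum.cong refl) (simp add: sum_distrib_left Re_sum algebra_simps sum.distrib sum_subtractf)
  also have "\<dots> = (\<Sum>i<n. \<Sum>k<d. \<Sum>j<n. c k * Re (b k $$ (i, j) * cnj (Z $$ (i, j))))"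
    by (intro sum.cong refl sum.swap)
  also have "\<dots> = (\<Sum>k<d. \<Sum>i<n. \<Sum>j<n. c k * Re (b k $$ (i, j) * cnj (Z $$ (i, j))))"
    by (rule sum.swap)
  finally show ?thesis by (simp add: frobenius_def sum_distrib_left)
qed

lemma frobenius_self: "frobenius n X X = (\<Sum>i<n. \<Sum>j<n. (cmod (X $$ (i, j)))^2)"
  unfolding frobenius_def by (simp add: complex_mult_cnj cmod_power2)

lemma frobenius_nonneg: "0 \<le> frobenius n X X"
  by (simp add: frobenius_self sum_nonneg)

lemma frobenius_eq_0:
  assumes "X \<in> carrier_mat n n" "frobenius n X X = 0"
  shows "X = 0\<^sub>m n n"
proof -
  have "\<forall>i\<in>{..<n}. (\<Sum>j<n. (cmod (X $$ (i, j)))^2) = 0"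
    using assms(2) unfolding frobenius_self by (subst (asm) sum_nonneg_eq_0_iff) (auto intro: sum_nonneg)
  then have "\<forall>i<n. \<forall>j<n. X $$ (i, j) = 0" by (simp add: sum_nonneg_eq_0_iff)
  then show ?thesis using assms(1) by (intro eq_matI) auto
qed

definition frobenius_orthonormal :: "nat \<Rightarrow> complex mat set \<Rightarrow> nat \<Rightarrow> (nat \<Rightarrow> complex mat) \<Rightarrow> bool" where
  "frobenius_orthonormal n V d b \<longleftrightarrow> (\<forall>k<d. b k \<in> V) \<and>
     (\<forall>k<d. \<forall>l<d. frobenius n (b k) (b l) = (if k = l then 1 else 0))"

lemma frobenius_orthonormal_comb:
  assumes "frobenius_orthonormal n V d b" "k < d"
  shows "frobenius n (real_comb n d b c) (b k) = c k"
proof -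
  have "frobenius n (real_comb n d b c) (b k) = (\<Sum>l<d. if l = k then c l else 0)"
    using assms unfolding frobenius_real_comb frobenius_orthonormal_def by (intro sum.cong) auto
  then show ?thesis using assms(2) by simp
qed

lemma bessel:
  assumes b: "frobenius_orthonormal n V d b" and X: "X \<in> carrier_mat n n"
  shows "(\<Sum>k<d. (frobenius n (b k) X)^2) \<le> frobenius n X X"
proof -
  define c where "c = (\<lambda>k. frobenius n (b k) X)"
  let ?Y = "real_comb n d b c"
  have YX: "frobenius n ?Y X = (\<Sum>k<d. (c k)^2)"
    by (simp add: frobenius_real_comb c_def power2_eq_square)
  have "frobenius n ?Y ?Y = (\<Sum>k<d. c k * frobenius n ?Y (b k))"
    by (subst frobenius_real_comb, intro sum.cong refl) (metis frobenius_commute)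
  also have "\<dots> = (\<Sum>k<d. (c k)^2)"
    by (intro sum.cong) (auto simp: frobenius_orthonormal_comb[OF b] power2_eq_square)
  finally have YY: "frobenius n ?Y ?Y = (\<Sum>k<d. (c k)^2)" .
  have "0 \<le> frobenius n (X - ?Y) (X - ?Y)" by (rule frobenius_nonneg)
  also have "\<dots> = frobenius n X X - 2 * frobenius n ?Y X + frobenius n ?Y ?Y"
    using X by (simp add: frobenius_diff_left frobenius_diff_right frobenius_commute[of n X ?Y])
  finally show ?thesis using YX YY by (simp add: c_def)
qed

definition unit_mat :: "nat \<Rightarrow> nat \<Rightarrow> nat \<Rightarrow> complex \<Rightarrow> complex mat" where
  "unit_mat n i j z = mat n n (\<lambda>(p, q). if p = i \<and> q = j then z else 0)"

lemma unit_mat_carrier [simp]: "unit_mat n i j z \<in> carrier_mat n n"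
  by (simp add: unit_mat_def)

lemma unit_mat_dim [simp]: "dim_row (unit_mat n i j z) = n" "dim_col (unit_mat n i j z) = n"
  by (simp_all add: unit_mat_def)

lemma unit_mat_entry [simp]:
  "p < n \<Longrightarrow> q < n \<Longrightarrow> unit_mat n i j z $$ (p, q) = (if p = i \<and> q = j then z else 0)"
  by (simp add: unit_mat_def)

lemma sum_delta_pair:
  fixes g :: "nat \<Rightarrow> nat \<Rightarrow> 'b::comm_monoid_add"
  assumes "i < n" "j < n"
  shows "(\<Sum>p<n. \<Sum>q<n. if p = i \<and> q = j then g p q else 0) = g i j"
proof -
  have "(\<Sum>p<n. \<Sum>q<n. if p = i \<and> q = j then g p q else 0) = (\<Sum>p<n. if p = i then g p j else 0)"
    using assms(2) by (intro sum.cong refl) auto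
  then show ?thesis using assms(1) by simp
qed

lemma frobenius_unit_mat:
  assumes "i < n" "j < n"
  shows "frobenius n X (unit_mat n i j z) = Re (X $$ (i, j) * cnj z)"
proof -
  have "frobenius n X (unit_mat n i j z) =
      (\<Sum>p<n. \<Sum>q<n. if p = i \<and> q = j then Re (X $$ (p, q) * cnj z) else 0)"
    unfolding frobenius_def by (intro sum.cong refl) auto
  then show ?thesis by (simp only: sum_delta_pair[OF assms])
qed

text \<open>Each \<open>b k\<close> has norm 1, expanded over the \<open>2 * n * n\<close> unit
  vectors with entry 1 or \<open>\<i>\<close>. With the order of summation exchanged, Bessel's
  inequality bounds the contribution of every unit vector by 1.\<close>

lemma frobenius_orthonormal_bound:
  assumes V: "V \<subseteq> carrier_mat n n" and b: "frobenius_orthonormal n V d b"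
  shows "d \<le> 2 * n * n"
proof -
  have split: "frobenius n X X =
      (\<Sum>i<n. \<Sum>j<n. (frobenius n X (unit_mat n i j 1))^2 + (frobenius n X (unit_mat n i j \<i>))^2)" for X
    unfolding frobenius_self by (intro sum.cong refl) (simp add: frobenius_unit_mat cmod_power2)
  have "real d = (\<Sum>k<d. frobenius n (b k) (b k))" using b by (simp add: frobenius_orthonormal_def)
  also have "\<dots> = (\<Sum>k<d. \<Sum>i<n. \<Sum>j<n. (frobenius n (b k) (unit_mat n i j 1))^2 + (frobenius n (b k) (unit_mat n i j \<i>))^2)"
    unfolding split ..
  also have "\<dots> = (\<Sum>i<n. \<Sum>k<d. \<Sum>j<n. (frobenius n (b k) (unit_mat n i j 1))^2 + (frobenius n (b k) (unit_mat n i j \<i>))^2)"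
    by (rule sum.swap)
  also have "\<dots> = (\<Sum>i<n. \<Sum>j<n. \<Sum>k<d. (frobenius n (b k) (unit_mat n i j 1))^2 + (frobenius n (b k) (unit_mat n i j \<i>))^2)"
    by (intro sum.cong refl sum.swap)
  also have "\<dots> \<le> (\<Sum>i<n. \<Sum>j<n. 1 + 1)"
  proof (intro sum_mono)
    fix i j assume ij: "i \<in> {..<n}" "j \<in> {..<n}"
    have "frobenius n (unit_mat n i j z) (unit_mat n i j z) = (cmod z)^2" for z
      using ij by (simp add: frobenius_unit_mat complex_mult_cnj cmod_power2)
    then show "(\<Sum>k<d. (frobenius n (b k) (unit_mat n i j 1))^2 + (frobenius n (b k) (unit_mat n i j \<i>))^2) \<le> 1 + 1"
      using bessel[OF b, of "unit_mat n i j 1"] bessel[OF b, of "unit_mat n i j \<i>"]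
      by (simp add: sum.distrib)
  qed
  also have "\<dots> = real (2 * n * n)" by simp
  finally show ?thesis by (simp only: of_nat_le_iff)
qed

text \<open>An orthonormal family of greatest size spans: otherwise the normalized residual of a
  missed vector would enlarge it. Existence of a basis is what gives meaning to the trace in
  \<open>endo_trace\<close>, which picks an arbitrary one.\<close>

lemma exists_frobenius_orthonormal_basis:
  assumes V: "real_subspace n V"
  obtains d b where "real_basis n V d b" "frobenius_orthonormal n V d b"
proof -
  note sub = real_subspaceD[OF V]
  have Vc: "V \<subseteq> carrier_mat n n" using sub(1) by blast
  let ?P = "\<lambda>d. \<exists>b. frobenius_orthonormal n V d b"
  have P0: "?P 0" by (simp add: frobenius_orthonormal_def)
  have bound: "d \<le> 2 * n * n" if "?P d" for d using frobenius_orthonormal_bound[OF Vc] that by blast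
  define d where "d = (GREATEST d. ?P d)"
  have "?P d" unfolding d_def using P0 bound by (rule GreatestI_nat)
  then obtain b where b: "frobenius_orthonormal n V d b" by blast
  have maximal: "\<not> ?P (Suc d)"
    using Greatest_le_nat[of ?P "Suc d", OF _ bound] unfolding d_def[symmetric] by auto
  have bV: "b k \<in> V" if "k < d" for k using b that by (simp add: frobenius_orthonormal_def)
  have span: "real_comb n d b (\<lambda>k. if k < d then frobenius n X (b k) else 0) = X" if X: "X \<in> V" for X
  proof (rule ccontr)
    define Y where "Y = real_comb n d b (\<lambda>k. if k < d then frobenius n X (b k) else 0)"
    assume "real_comb n d b (\<lambda>k. if k < d then frobenius n X (b k) else 0) \<noteq> X"
    then have "Y \<noteq> X" by (simp add: Y_def)
    have YV: "Y \<in> V" unfolding Y_def by (rule real_comb_in_subspace[OF V bV])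
    have "X - Y = X + real_smult (-1) Y"
      using sub(1)[OF X] sub(1)[OF YV] by (intro eq_matI) (auto simp: real_smult_def)
    then have DV: "X - Y \<in> V" using sub X YV by simp
    have D0: "frobenius n (X - Y) (X - Y) \<noteq> 0"
    proof
      assume "frobenius n (X - Y) (X - Y) = 0"
      then have D: "X - Y = 0\<^sub>m n n" using frobenius_eq_0 sub(1)[OF DV] by blast
      have "X = Y"
      proof (rule eq_matI)
        fix i j assume "i < dim_row Y" "j < dim_col Y"
        then show "X $$ (i, j) = Y $$ (i, j)"
          using arg_cong[OF D, of "\<lambda>M. M $$ (i, j)"] sub(1)[OF X] sub(1)[OF YV] by auto
      qed (use sub(1)[OF X] sub(1)[OF YV] in auto)
      then show False using \<open>Y \<noteq> X\<close> by simp
    qed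
    define r where "r = frobenius n (X - Y) (X - Y)"
    have r: "0 < r" unfolding r_def using D0 frobenius_nonneg[of n "X - Y"] by simp
    define e where "e = real_smult (1 / sqrt r) (X - Y)"
    have eV: "e \<in> V" unfolding e_def using sub(4) DV by blast
    have ee: "frobenius n e e = 1"
      unfolding e_def using sub(1)[OF DV] r
      by (simp add: frobenius_real_smult_left frobenius_real_smult_right r_def[symmetric] real_sqrt_mult[symmetric])
    have "frobenius n (X - Y) (b k) = 0" if "k < d" for k
      using that sub(1)[OF X] sub(1)[OF YV]
      by (simp add: frobenius_diff_left) (simp add: Y_def frobenius_orthonormal_comb[OF b])
    then have eb: "frobenius n e (b k) = 0" if "k < d" for k
      unfolding e_def using that sub(1)[OF DV] by (simp add: frobenius_real_smult_left)
    have be: "frobenius n (b k) e = 0" if "k < d" for k using eb[OF that] frobenius_commute by metis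
    have "frobenius_orthonormal n V (Suc d) (b(d := e))"
      unfolding frobenius_orthonormal_def
    proof (intro conjI allI impI)
      fix k l assume "k < Suc d" "l < Suc d"
      then show "frobenius n ((b(d := e)) k) ((b(d := e)) l) = (if k = l then 1 else 0)"
        using b ee eb be by (cases "k = d"; cases "l = d") (auto simp: frobenius_orthonormal_def)
    qed (use bV eV in auto)
    with maximal show False by blast
  qed
  have "bij_betw (real_comb n d b) (coefficients d) V"
  proof (rule bij_betwI')
    fix c c' assume c: "c \<in> coefficients d" "c' \<in> coefficients d"
    show "real_comb n d b c = real_comb n d b c' \<longleftrightarrow> c = c'"
    proof
      assume eq: "real_comb n d b c = real_comb n d b c'"
      show "c = c'"
      proof
        fix k
        show "c k = c' k"
        proof (cases "k < d")
          case True
          show ?thesis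
            using frobenius_orthonormal_comb[OF b True, of c] unfolding eq
            unfolding frobenius_orthonormal_comb[OF b True] by (rule sym)
        qed (use c in \<open>auto simp: coefficients_def\<close>)
      qed
    qed simp
  next
    show "real_comb n d b c \<in> V" for c by (rule real_comb_in_subspace[OF V bV])
  next
    fix X assume "X \<in> V"
    then show "\<exists>c\<in>coefficients d. X = real_comb n d b c"
      using span by (intro bexI[of _ "\<lambda>k. if k < d then frobenius n X (b k) else 0"]) (auto simp: coefficients_def)
  qed
  then have "real_basis n V d b" using bV sub(1) by (auto simp: real_basis_def)
  with b show thesis using that by blast
qed

text \<open>The four terms come from \<open>X Y M - X M Y - Y M X + M Y X\<close>, where
  \<open>M\<close> has the single entry \<open>z\<close> at \<open>(a, b)\<close>.\<close>

lemma ad_ad_unit_mat: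
  assumes X: "X \<in> carrier_mat n n" and Y: "Y \<in> carrier_mat n n" and ij: "i < n" "j < n" "a < n" "b < n"
  shows "lie_bracket X (lie_bracket Y (unit_mat n a b z)) $$ (i, j) = z *
    ((if b = j then (X * Y) $$ (i, a) else 0) - X $$ (i, a) * Y $$ (b, j) - Y $$ (i, a) * X $$ (b, j)
      + (if i = a then (Y * X) $$ (b, j) else 0))"
proof -
  let ?W = "lie_bracket Y (unit_mat n a b z)"
  have W: "?W $$ (p, q) = (if b = q then z * Y $$ (p, a) else 0) - (if p = a then z * Y $$ (b, q) else 0)"
    if "p < n" "q < n" for p q
  proof -
    have "(\<Sum>l<n. Y $$ (p, l) * unit_mat n a b z $$ (l, q)) = (\<Sum>l<n. if l = a then (if b = q then z * Y $$ (p, a) else 0) else 0)"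
      using that by (intro sum.cong) auto
    moreover have "(\<Sum>l<n. unit_mat n a b z $$ (p, l) * Y $$ (l, q)) = (\<Sum>l<n. if l = b then (if p = a then z * Y $$ (b, q) else 0) else 0)"
      using that by (intro sum.cong) auto
    ultimately show ?thesis using that Y ij by (simp add: lie_bracket_entry[of _ n])
  qed
  have "(\<Sum>l<n. X $$ (i, l) * ?W $$ (l, j)) =
      (\<Sum>l<n. (if b = j then z * (X $$ (i, l) * Y $$ (l, a)) else 0) - (if l = a then z * X $$ (i, a) * Y $$ (b, j) else 0))"
    using ij by (intro sum.cong) (auto simp: W algebra_simps)
  then have s1: "(\<Sum>l<n. X $$ (i, l) * ?W $$ (l, j)) =
      (if b = j then z * (\<Sum>l<n. X $$ (i, l) * Y $$ (l, a)) else 0) - z * X $$ (i, a) * Y $$ (b, j)"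
    using ij by (simp add: sum_subtractf sum_distrib_left)
  have "(\<Sum>l<n. ?W $$ (i, l) * X $$ (l, j)) =
      (\<Sum>l<n. (if l = b then z * Y $$ (i, a) * X $$ (b, j) else 0) - (if i = a then z * (Y $$ (b, l) * X $$ (l, j)) else 0))"
    using ij by (intro sum.cong) (auto simp: W algebra_simps)
  then have s2: "(\<Sum>l<n. ?W $$ (i, l) * X $$ (l, j)) =
      z * Y $$ (i, a) * X $$ (b, j) - (if i = a then z * (\<Sum>l<n. Y $$ (b, l) * X $$ (l, j)) else 0)"
    using ij by (simp add: sum_subtractf sum_distrib_left)
  show ?thesis
    unfolding lie_bracket_entry[OF X lie_bracket_carrier[OF Y unit_mat_carrier] ij(1,2)] s1 s2
      mult_entry[OF X Y ij(1,3)] mult_entry[OF Y X ij(4,2)]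
    by (simp add: algebra_simps)
qed


section \<open>The compact symplectic Lie algebra\<close>

text \<open>The structure map is \<open>(J v) (\<sigma> i) = \<epsilon> i * cnj (v i)\<close>. It is
  antilinear, the sign change of \<open>\<epsilon>\<close> under \<open>\<sigma>\<close> gives
  \<open>J^2 = -1\<close>, and \<open>quaternionic\<close> below expresses commutation with
  \<open>J\<close>. Thus \<open>N\<close> is twice the quaternionic dimension.\<close>

locale symplectic_form =
  fixes N :: nat and \<sigma> :: "nat \<Rightarrow> nat" and \<epsilon> :: "nat \<Rightarrow> complex"
  assumes \<sigma>_less [simp]: "i < N \<Longrightarrow> \<sigma> i < N"
    and \<sigma>_\<sigma> [simp]: "i < N \<Longrightarrow> \<sigma> (\<sigma> i) = i"
    and \<epsilon>_sq [simp]: "i < N \<Longrightarrow> \<epsilon> i * \<epsilon> i = 1"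
    and \<epsilon>_\<sigma> [simp]: "i < N \<Longrightarrow> \<epsilon> (\<sigma> i) = - \<epsilon> i"
    and \<epsilon>_cnj [simp]: "i < N \<Longrightarrow> cnj (\<epsilon> i) = \<epsilon> i"
begin

lemma \<epsilon>_nonzero: "i < N \<Longrightarrow> \<epsilon> i \<noteq> 0"
  by (metis \<epsilon>_sq mult_zero_left zero_neq_one)

lemma \<epsilon>_sq' [simp]: "i < N \<Longrightarrow> \<epsilon> i * (\<epsilon> i * z) = z"
  by (simp add: mult.assoc[symmetric])

lemma \<sigma>_neq [simp]:
  assumes "i < N"
  shows "\<sigma> i \<noteq> i" "i \<noteq> \<sigma> i"
proof -
  have "\<epsilon> (\<sigma> i) \<noteq> \<epsilon> i" unfolding \<epsilon>_\<sigma>[OF assms] using \<epsilon>_nonzero[OF assms] by simp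
  then show "\<sigma> i \<noteq> i" "i \<noteq> \<sigma> i" by metis+
qed

lemma \<sigma>_inject [simp]: "i < N \<Longrightarrow> j < N \<Longrightarrow> \<sigma> i = \<sigma> j \<longleftrightarrow> i = j"
  by (metis \<sigma>_\<sigma>)

lemma \<sigma>_swap: "i < N \<Longrightarrow> j < N \<Longrightarrow> \<sigma> i = j \<longleftrightarrow> i = \<sigma> j"
  by auto

lemma sum_\<sigma>: "(\<Sum>i<N. g (\<sigma> i)) = (\<Sum>i<N. g i)"
proof -
  have "bij_betw \<sigma> {..<N} {..<N}" by (rule bij_betw_byWitness[of _ \<sigma>]) auto
  then show ?thesis by (rule sum.reindex_bij_betw)
qed

definition quaternionic :: "complex mat \<Rightarrow> bool" where
  "quaternionic X \<longleftrightarrow> X \<in> carrier_mat N N \<and>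
     (\<forall>i<N. \<forall>j<N. X $$ (\<sigma> i, \<sigma> j) = \<epsilon> i * \<epsilon> j * cnj (X $$ (i, j)))"

definition supported :: "(nat \<Rightarrow> nat \<Rightarrow> bool) \<Rightarrow> complex mat \<Rightarrow> bool" where
  "supported E X \<longleftrightarrow> (\<forall>i<N. \<forall>j<N. \<not> E i j \<longrightarrow> X $$ (i, j) = 0)"

text \<open>The pattern \<open>E\<close> of allowed positions lets one family cover all the spaces
  involved: every position gives the algebra of \<open>G\<close>, positions within a block that of
  \<open>H\<close>, positions between two given blocks a module.\<close>

definition sp :: "(nat \<Rightarrow> nat \<Rightarrow> bool) \<Rightarrow> complex mat set" where
  "sp E = {X. quaternionic X \<and> supported E X \<and> (\<forall>i<N. \<forall>j<N. X $$ (j, i) = - cnj (X $$ (i, j)))}"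

text \<open>The equations defining \<open>sp\<close> tie together the positions
  \<open>(i, j)\<close>, \<open>(j, i)\<close>, \<open>(\<sigma> i, \<sigma> j)\<close> and
  \<open>(\<sigma> j, \<sigma> i)\<close>; the pattern must contain such an orbit entirely or miss
  it.\<close>

definition admissible :: "(nat \<Rightarrow> nat \<Rightarrow> bool) \<Rightarrow> bool" where
  "admissible E \<longleftrightarrow> (\<forall>i<N. \<forall>j<N. E i j \<longrightarrow> E j i \<and> E (\<sigma> i) (\<sigma> j))"

lemma spD:
  assumes "X \<in> sp E"
  shows "X \<in> carrier_mat N N"
    and "i < N \<Longrightarrow> j < N \<Longrightarrow> X $$ (\<sigma> i, \<sigma> j) = \<epsilon> i * \<epsilon> j * cnj (X $$ (i, j))"
    and "i < N \<Longrightarrow> j < N \<Longrightarrow> \<not> E i j \<Longrightarrow> X $$ (i, j) = 0"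
    and "i < N \<Longrightarrow> j < N \<Longrightarrow> X $$ (j, i) = - cnj (X $$ (i, j))"
proof -
  have H: "X \<in> carrier_mat N N \<and> (\<forall>i<N. \<forall>j<N. X $$ (\<sigma> i, \<sigma> j) = \<epsilon> i * \<epsilon> j * cnj (X $$ (i, j))) \<and>
    (\<forall>i<N. \<forall>j<N. \<not> E i j \<longrightarrow> X $$ (i, j) = 0) \<and> (\<forall>i<N. \<forall>j<N. X $$ (j, i) = - cnj (X $$ (i, j)))"
    using assms[unfolded sp_def quaternionic_def supported_def mem_Collect_eq, THEN conjunct1, THEN conjunct1]
      assms[unfolded sp_def quaternionic_def supported_def mem_Collect_eq, THEN conjunct1, THEN conjunct2]
      assms[unfolded sp_def quaternionic_def supported_def mem_Collect_eq, THEN conjunct2, THEN conjunct1]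
      assms[unfolded sp_def quaternionic_def supported_def mem_Collect_eq, THEN conjunct2, THEN conjunct2]
    by (intro conjI)
  show "X \<in> carrier_mat N N" using H by (rule conjunct1)
  show "i < N \<Longrightarrow> j < N \<Longrightarrow> X $$ (\<sigma> i, \<sigma> j) = \<epsilon> i * \<epsilon> j * cnj (X $$ (i, j))"
    by (rule H[THEN conjunct2, THEN conjunct1, rule_format])
  show "i < N \<Longrightarrow> j < N \<Longrightarrow> \<not> E i j \<Longrightarrow> X $$ (i, j) = 0"
    by (rule H[THEN conjunct2, THEN conjunct2, THEN conjunct1, rule_format])
  show "i < N \<Longrightarrow> j < N \<Longrightarrow> X $$ (j, i) = - cnj (X $$ (i, j))"
    by (rule H[THEN conjunct2, THEN conjunct2, THEN conjunct2, rule_format])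
qed

lemma spI:
  assumes "X \<in> carrier_mat N N"
    and "\<And>i j. i < N \<Longrightarrow> j < N \<Longrightarrow> X $$ (\<sigma> i, \<sigma> j) = \<epsilon> i * \<epsilon> j * cnj (X $$ (i, j))"
    and "\<And>i j. i < N \<Longrightarrow> j < N \<Longrightarrow> \<not> E i j \<Longrightarrow> X $$ (i, j) = 0"
    and "\<And>i j. i < N \<Longrightarrow> j < N \<Longrightarrow> X $$ (j, i) = - cnj (X $$ (i, j))"
  shows "X \<in> sp E"
  unfolding sp_def quaternionic_def supported_def mem_Collect_eq
  by (intro conjI allI impI assms)

lemma sp_mono: "(\<And>i j. i < N \<Longrightarrow> j < N \<Longrightarrow> E i j \<Longrightarrow> E' i j) \<Longrightarrow> sp E \<subseteq> sp E'"
  unfolding sp_def supported_def by blast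

lemma real_subspace_sp: "real_subspace N (sp E)"
  unfolding real_subspace_def
proof (intro conjI ballI allI)
  show "sp E \<subseteq> carrier_mat N N" using spD(1) by blast
  show "0\<^sub>m N N \<in> sp E" by (rule spI) auto
  fix X assume X: "X \<in> sp E"
  note dX = carrier_matD[OF spD(1)[OF X]]
  show "real_smult c X \<in> sp E" for c
  proof (rule spI)
    show "real_smult c X \<in> carrier_mat N N" using spD(1)[OF X] by simp
    fix i j assume ij: "i < N" "j < N"
    show "real_smult c X $$ (\<sigma> i, \<sigma> j) = \<epsilon> i * \<epsilon> j * cnj (real_smult c X $$ (i, j))"
      using ij dX by (simp add: spD(2)[OF X ij])
    show "real_smult c X $$ (j, i) = - cnj (real_smult c X $$ (i, j))"
      using ij dX by (simp add: spD(4)[OF X ij])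
    show "real_smult c X $$ (i, j) = 0" if "\<not> E i j"
      using ij dX by (simp add: spD(3)[OF X ij that])
  qed
  fix Y assume Y: "Y \<in> sp E"
  note dY = carrier_matD[OF spD(1)[OF Y]]
  show "X + Y \<in> sp E"
  proof (rule spI)
    show "X + Y \<in> carrier_mat N N" using spD(1)[OF X] spD(1)[OF Y] by simp
    fix i j assume ij: "i < N" "j < N"
    show "(X + Y) $$ (\<sigma> i, \<sigma> j) = \<epsilon> i * \<epsilon> j * cnj ((X + Y) $$ (i, j))"
      using ij dX dY by (simp add: spD(2)[OF X ij] spD(2)[OF Y ij] distrib_left)
    show "(X + Y) $$ (j, i) = - cnj ((X + Y) $$ (i, j))"
      using ij dX dY by (simp add: spD(4)[OF X ij] spD(4)[OF Y ij])
    show "(X + Y) $$ (i, j) = 0" if "\<not> E i j"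
      using ij dX dY by (simp add: spD(3)[OF X ij that] spD(3)[OF Y ij that])
  qed
qed

lemma lie_bracket_quaternionic:
  assumes X: "X \<in> sp E" and Y: "Y \<in> sp E'"
  shows "lie_bracket X Y \<in> sp (\<lambda>_ _. True)"
proof (rule spI)
  note cX = spD(1)[OF X] and cY = spD(1)[OF Y]
  show "lie_bracket X Y \<in> carrier_mat N N" using cX cY by simp
  fix i j assume ij: "i < N" "j < N"
  have prod: "(\<Sum>l<N. U $$ (\<sigma> i, l) * W $$ (l, \<sigma> j)) = \<epsilon> i * \<epsilon> j * cnj (\<Sum>l<N. U $$ (i, l) * W $$ (l, j))"
    if U: "U \<in> sp F" and W: "W \<in> sp F'" for U W F F'
  proof -
    have "(\<Sum>l<N. U $$ (\<sigma> i, l) * W $$ (l, \<sigma> j)) = (\<Sum>l<N. U $$ (\<sigma> i, \<sigma> l) * W $$ (\<sigma> l, \<sigma> j))"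
      by (rule sum_\<sigma>[symmetric])
    also have "\<dots> = (\<Sum>l<N. \<epsilon> i * \<epsilon> j * cnj (U $$ (i, l) * W $$ (l, j)))"
    proof (intro sum.cong refl)
      fix l assume "l \<in> {..<N}"
      then have l: "l < N" by simp
      have "U $$ (\<sigma> i, \<sigma> l) * W $$ (\<sigma> l, \<sigma> j) =
          (\<epsilon> l * \<epsilon> l) * (\<epsilon> i * \<epsilon> j * (cnj (U $$ (i, l)) * cnj (W $$ (l, j))))"
        unfolding spD(2)[OF U ij(1) l] spD(2)[OF W l ij(2)] by (simp only: ac_simps)
      then show "U $$ (\<sigma> i, \<sigma> l) * W $$ (\<sigma> l, \<sigma> j) = \<epsilon> i * \<epsilon> j * cnj (U $$ (i, l) * W $$ (l, j))"
        by (simp only: \<epsilon>_sq[OF l] mult_1_left complex_cnj_mult)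
    qed
    finally show ?thesis by (simp add: sum_distrib_left)
  qed
  show "lie_bracket X Y $$ (\<sigma> i, \<sigma> j) = \<epsilon> i * \<epsilon> j * cnj (lie_bracket X Y $$ (i, j))"
    using ij by (simp add: lie_bracket_entry[OF cX cY] prod[OF X Y] prod[OF Y X] right_diff_distrib)
  have swap: "(\<Sum>l<N. U $$ (j, l) * W $$ (l, i)) = cnj (\<Sum>l<N. W $$ (i, l) * U $$ (l, j))"
    if U: "U \<in> sp F" and W: "W \<in> sp F'" for U W F F'
  proof -
    have "U $$ (j, l) * W $$ (l, i) = cnj (W $$ (i, l) * U $$ (l, j))" if "l < N" for l
      unfolding spD(4)[OF U that ij(2)] spD(4)[OF W ij(1) that] by (simp add: mult.commute)
    then show ?thesis unfolding cnj_sum by (intro sum.cong) auto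
  qed
  show "lie_bracket X Y $$ (j, i) = - cnj (lie_bracket X Y $$ (i, j))"
    using ij by (simp add: lie_bracket_entry[OF cX cY] swap[OF X Y] swap[OF Y X])
qed simp

text \<open>
  \<open>four_unit i j z / 4\<close> is the orthogonal projection onto the symplectic Lie algebra of the matrix
  with the single entry \<open>z\<close> at \<open>(i, j)\<close>.
\<close>

definition four_unit :: "nat \<Rightarrow> nat \<Rightarrow> complex \<Rightarrow> complex mat" where
  "four_unit i j z = mat N N (\<lambda>(p, q). (if i = p \<and> j = q then z else 0) - (if i = q \<and> j = p then cnj z else 0)
     + (if i = \<sigma> p \<and> j = \<sigma> q then \<epsilon> i * \<epsilon> j * cnj z else 0) - (if i = \<sigma> q \<and> j = \<sigma> p then \<epsilon> i * \<epsilon> j * z else 0))"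

lemma four_unit_carrier [simp]: "four_unit i j z \<in> carrier_mat N N"
  by (simp add: four_unit_def)

lemma four_unit_dim [simp]: "dim_row (four_unit i j z) = N" "dim_col (four_unit i j z) = N"
  by (simp_all add: four_unit_def)

lemma four_unit_entry:
  "p < N \<Longrightarrow> q < N \<Longrightarrow> four_unit i j z $$ (p, q) =
     (if i = p \<and> j = q then z else 0) - (if i = q \<and> j = p then cnj z else 0)
     + (if i = \<sigma> p \<and> j = \<sigma> q then \<epsilon> i * \<epsilon> j * cnj z else 0) - (if i = \<sigma> q \<and> j = \<sigma> p then \<epsilon> i * \<epsilon> j * z else 0)"
  by (simp add: four_unit_def)

lemma four_unit_0: "p < N \<Longrightarrow> q < N \<Longrightarrow> four_unit i j 0 $$ (p, q) = 0"
  by (simp only: four_unit_entry mult_zero_right complex_cnj_zero if_cancel diff_self add_0_left)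

lemma four_unit_in_sp:
  assumes ij: "i < N" "j < N" and E: "admissible E" "E i j"
  shows "four_unit i j z \<in> sp E"
proof (rule spI)
  fix p q assume pq: "p < N" "q < N"
  \<comment> \<open>The four positions of the orbit can coincide, when \<open>j = i\<close> or
    \<open>j = \<sigma> i\<close>, so the conditions are kept as independent propositions. The
    symmetries only permute them: \<open>\<sigma>\<close> exchanges \<open>A\<close> with
    \<open>C\<close> and \<open>B\<close> with \<open>D\<close>, transposition \<open>A\<close> with
    \<open>B\<close> and \<open>C\<close> with \<open>D\<close>.\<close>
  define A B C D where "A \<longleftrightarrow> i = p \<and> j = q" and "B \<longleftrightarrow> i = q \<and> j = p"
    and "C \<longleftrightarrow> i = \<sigma> p \<and> j = \<sigma> q" and "D \<longleftrightarrow> i = \<sigma> q \<and> j = \<sigma> p"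
  note folds = A_def[symmetric] B_def[symmetric] C_def[symmetric] D_def[symmetric]
  define c e where "c = \<epsilon> p * \<epsilon> q" and "e = \<epsilon> i * \<epsilon> j"
  have e: "cnj e = e" "\<epsilon> j * \<epsilon> i = e" using ij by (simp_all add: e_def mult.commute)
  have ce: "A \<Longrightarrow> c = e" "B \<Longrightarrow> c = e" "C \<Longrightarrow> c * e = 1" "D \<Longrightarrow> c * e = 1"
    using pq by (auto simp: A_def B_def C_def D_def c_def e_def algebra_simps)
  have ent: "four_unit i j z $$ (p, q) = (if A then z else 0) - (if B then cnj z else 0)
      + (if C then e * cnj z else 0) - (if D then e * z else 0)"
    unfolding four_unit_entry[OF pq] folds e_def ..
  have ent': "four_unit i j z $$ (\<sigma> p, \<sigma> q) = (if C then z else 0) - (if D then cnj z else 0)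
      + (if A then e * cnj z else 0) - (if B then e * z else 0)"
    unfolding four_unit_entry[OF \<sigma>_less[OF pq(1)] \<sigma>_less[OF pq(2)]] \<sigma>_\<sigma>[OF pq(1)] \<sigma>_\<sigma>[OF pq(2)] folds e_def ..
  have "c * cnj (four_unit i j z $$ (p, q)) = (if A then c * cnj z else 0) - (if B then c * z else 0)
      + (if C then (c * e) * z else 0) - (if D then (c * e) * cnj z else 0)"
    unfolding ent by (simp add: e algebra_simps)
  also have "\<dots> = four_unit i j z $$ (\<sigma> p, \<sigma> q)"
    unfolding ent' using ce by simp
  finally show "four_unit i j z $$ (\<sigma> p, \<sigma> q) = \<epsilon> p * \<epsilon> q * cnj (four_unit i j z $$ (p, q))"
    unfolding c_def by simp
  have ent'': "four_unit i j z $$ (q, p) = (if B then z else 0) - (if A then cnj z else 0)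
      + (if D then e * cnj z else 0) - (if C then e * z else 0)"
    unfolding four_unit_entry[OF pq(2) pq(1)] folds e_def ..
  show "four_unit i j z $$ (q, p) = - cnj (four_unit i j z $$ (p, q))"
    unfolding ent ent'' by (simp add: e)
  assume "\<not> E p q"
  moreover have "A \<or> B \<or> C \<or> D \<Longrightarrow> E p q"
    using E(1)[unfolded admissible_def, rule_format, OF ij E(2)]
      E(1)[unfolded admissible_def, rule_format, OF \<sigma>_less[OF ij(1)] \<sigma>_less[OF ij(2)]] E(2) pq
    by (auto simp: A_def B_def C_def D_def)
  ultimately show "four_unit i j z $$ (p, q) = 0" unfolding ent by auto
qed simp

definition entry_projection :: "(nat \<Rightarrow> nat \<Rightarrow> bool) \<Rightarrow> nat \<Rightarrow> nat \<Rightarrow> complex \<Rightarrow> complex mat" where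
  "entry_projection E i j z = (if E i j then real_smult (1/4) (four_unit i j z) else 0\<^sub>m N N)"

lemma entry_projection_in_sp:
  assumes "i < N" "j < N" "admissible E"
  shows "entry_projection E i j z \<in> sp E"
  unfolding entry_projection_def using assms four_unit_in_sp real_subspaceD[OF real_subspace_sp] by simp

text \<open>Within \<open>sp E\<close> the entries of one orbit determine each other, so each of the
  four terms of the projection contributes the same value \<open>X $$ (p, q)\<close>, and the factor
  1/4 gives the entry back.\<close>

lemma sp_decomposition:
  assumes X: "X \<in> sp E"
  shows "X = matrix_sum N ({..<N} \<times> {..<N}) (\<lambda>(i, j). entry_projection E i j (X $$ (i, j)))"
proof (rule square_eqI[of _ N])
  show "X \<in> carrier_mat N N" by (rule spD(1)[OF X])
  fix p q assume pq: "p < N" "q < N"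
  have "(\<Sum>(i, j)\<in>{..<N} \<times> {..<N}. entry_projection E i j (X $$ (i, j)) $$ (p, q)) =
    (\<Sum>i<N. \<Sum>j<N. 1/4 * ((if i = p \<and> j = q then X $$ (i, j) else 0) - (if i = q \<and> j = p then cnj (X $$ (i, j)) else 0)
     + (if i = \<sigma> p \<and> j = \<sigma> q then \<epsilon> i * \<epsilon> j * cnj (X $$ (i, j)) else 0)
     - (if i = \<sigma> q \<and> j = \<sigma> p then \<epsilon> i * \<epsilon> j * X $$ (i, j) else 0)))"
    unfolding sum.cartesian_product[symmetric]
  proof (intro sum.cong refl)
    fix i j assume "i \<in> {..<N}" "j \<in> {..<N}"
    then have ij: "i < N" "j < N" by auto
    have "entry_projection E i j (X $$ (i, j)) $$ (p, q) = 1/4 * four_unit i j (X $$ (i, j)) $$ (p, q)"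
    proof (cases "E i j")
      case False
      then have "X $$ (i, j) = 0" using spD(3)[OF X ij] by blast
      then show ?thesis using False pq by (simp add: entry_projection_def four_unit_0)
    qed (use pq in \<open>simp add: entry_projection_def\<close>)
    then show "entry_projection E i j (X $$ (i, j)) $$ (p, q) = 1/4 * ((if i = p \<and> j = q then X $$ (i, j) else 0) - (if i = q \<and> j = p then cnj (X $$ (i, j)) else 0)
     + (if i = \<sigma> p \<and> j = \<sigma> q then \<epsilon> i * \<epsilon> j * cnj (X $$ (i, j)) else 0)
     - (if i = \<sigma> q \<and> j = \<sigma> p then \<epsilon> i * \<epsilon> j * X $$ (i, j) else 0))"
      unfolding four_unit_entry[OF pq] .
  qed
  also have "\<dots> = 1/4 * (X $$ (p, q) - cnj (X $$ (q, p)) + \<epsilon> (\<sigma> p) * \<epsilon> (\<sigma> q) * cnj (X $$ (\<sigma> p, \<sigma> q))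
      - \<epsilon> (\<sigma> q) * \<epsilon> (\<sigma> p) * X $$ (\<sigma> q, \<sigma> p))"
    using pq by (simp only: sum_distrib_left[symmetric] sum.distrib sum_subtractf sum_delta_pair \<sigma>_less)
  also have "\<dots> = X $$ (p, q)"
  proof -
    have "\<epsilon> (\<sigma> p) * \<epsilon> (\<sigma> q) * cnj (X $$ (\<sigma> p, \<sigma> q)) = X $$ (p, q)"
      using pq by (simp add: spD(2)[OF X] algebra_simps)
    moreover have "\<epsilon> (\<sigma> q) * \<epsilon> (\<sigma> p) * X $$ (\<sigma> q, \<sigma> p) = - X $$ (p, q)"
      using pq by (simp add: spD(2)[OF X] spD(4)[OF X, of p q] algebra_simps)
    moreover have "cnj (X $$ (q, p)) = - X $$ (p, q)"
      using pq by (simp add: spD(4)[OF X, of p q])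
    ultimately show ?thesis by simp
  qed
  finally show "X $$ (p, q) = matrix_sum N ({..<N} \<times> {..<N}) (\<lambda>(i, j). entry_projection E i j (X $$ (i, j))) $$ (p, q)"
    using pq by (simp add: case_prod_beta')
qed (simp add: carrier_matI)

text \<open>The part of \<open>four_unit i j z\<close> that is complex linear in \<open>z\<close>,
  with the factor \<open>z\<close> removed.\<close>

definition linear_half :: "nat \<Rightarrow> nat \<Rightarrow> complex mat" where
  "linear_half i j = unit_mat N i j 1 + unit_mat N (\<sigma> j) (\<sigma> i) (- \<epsilon> i * \<epsilon> j)"

lemma linear_half_carrier [simp]: "linear_half i j \<in> carrier_mat N N"
  by (simp add: linear_half_def)

text \<open>The part of the projection that is antilinear in the entry does not contribute to the trace.\<close>

lemma trace_sp:
  assumes B: "real_basis N (sp E) d b" and E: "admissible E"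
    and f_sp: "\<And>X. X \<in> sp E \<Longrightarrow> f X \<in> sp E"
    and f_carrier: "\<And>X. X \<in> carrier_mat N N \<Longrightarrow> f X \<in> carrier_mat N N"
    and f_add: "\<And>X Y. X \<in> carrier_mat N N \<Longrightarrow> Y \<in> carrier_mat N N \<Longrightarrow> f (X + Y) = f X + f Y"
    and f_smult: "\<And>c X. X \<in> carrier_mat N N \<Longrightarrow> f (c \<cdot>\<^sub>m X) = c \<cdot>\<^sub>m f X"
  shows "(\<Sum>k<d. coord N d b (f (b k)) k) =
    (1/2) * (\<Sum>i<N. \<Sum>j<N. if E i j then Re (f (linear_half i j) $$ (i, j)) else 0)"
proof -
  let ?P = "entry_projection E"
  have "(\<Sum>k<d. coord N d b (f (b k)) k) =
    (\<Sum>i<N. \<Sum>j<N. Re (f (?P i j 1) $$ (i, j)) + Im (f (?P i j \<i>) $$ (i, j)))"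
  proof (rule trace_formula[OF B real_subspace_sp f_sp])
    show "f (X + Y) = f X + f Y" if "X \<in> sp E" "Y \<in> sp E" for X Y using that f_add spD(1) by blast
    show "f (real_smult c X) = real_smult c (f X)" if "X \<in> sp E" for c X
      unfolding real_smult_def using that f_smult spD(1) by blast
    show "?P i j z \<in> sp E" if "i < N" "j < N" for i j z using that E by (rule entry_projection_in_sp)
    show "?P i j z = real_smult (Re z) (?P i j 1) + real_smult (Im z) (?P i j \<i>)" if "i < N" "j < N" for i j z
    proof (rule square_eqI[of _ N])
      have c: "?P i j z \<in> carrier_mat N N" for z
        using entry_projection_in_sp[OF that E] spD(1) by blast
      show "?P i j z \<in> carrier_mat N N" "real_smult (Re z) (?P i j 1) + real_smult (Im z) (?P i j \<i>) \<in> carrier_mat N N"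
        using c by simp_all
      fix p q assume pq: "p < N" "q < N"
      show "?P i j z $$ (p, q) = (real_smult (Re z) (?P i j 1) + real_smult (Im z) (?P i j \<i>)) $$ (p, q)"
      proof (cases "E i j")
        case True
        have "(if A then z else 0) - (if B then cnj z else 0) + (if C then e * cnj z else 0) - (if D then e * z else 0) =
            of_real (Re z) * ((if A then 1 else 0) - (if B then cnj 1 else 0) + (if C then e * cnj 1 else 0) - (if D then e * 1 else 0))
            + of_real (Im z) * ((if A then \<i> else 0) - (if B then cnj \<i> else 0) + (if C then e * cnj \<i> else 0) - (if D then e * \<i> else 0))"
          for A B C D and e :: complex
          by (simp add: complex_eq_iff) (simp add: algebra_simps)
        from this[of "i = p \<and> j = q" "i = q \<and> j = p" "i = \<sigma> p \<and> j = \<sigma> q" "\<epsilon> i * \<epsilon> j" "i = \<sigma> q \<and> j = \<sigma> p"]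
        have "four_unit i j z $$ (p, q) = of_real (Re z) * four_unit i j 1 $$ (p, q) + of_real (Im z) * four_unit i j \<i> $$ (p, q)"
          unfolding four_unit_entry[OF pq] .
        then show ?thesis using True pq by (simp add: entry_projection_def algebra_simps)
      qed (use pq in \<open>simp add: entry_projection_def\<close>)
    qed
    show "X = matrix_sum N ({..<N} \<times> {..<N}) (\<lambda>(i, j). ?P i j (X $$ (i, j)))" if "X \<in> sp E" for X
      using that by (rule sp_decomposition)
  qed
  also have "\<dots> = (\<Sum>i<N. \<Sum>j<N. (1/2) * (if E i j then Re (f (linear_half i j) $$ (i, j)) else 0))"
  proof (intro sum.cong refl)
    fix i j assume "i \<in> {..<N}" "j \<in> {..<N}"
    then have ij: "i < N" "j < N" by auto
    show "Re (f (?P i j 1) $$ (i, j)) + Im (f (?P i j \<i>) $$ (i, j)) =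
        (1/2) * (if E i j then Re (f (linear_half i j) $$ (i, j)) else 0)"
    proof (cases "E i j")
      case True
      define A where "A = linear_half i j"
      define B' where "B' = unit_mat N j i (-1) + unit_mat N (\<sigma> i) (\<sigma> j) (\<epsilon> i * \<epsilon> j)"
      have AB: "A \<in> carrier_mat N N" "B' \<in> carrier_mat N N" by (simp_all add: A_def B'_def)
      have entries: "four_unit i j 1 $$ (p, q) = A $$ (p, q) + B' $$ (p, q)"
        "four_unit i j \<i> $$ (p, q) = \<i> * A $$ (p, q) - \<i> * B' $$ (p, q)" if pq: "p < N" "q < N" for p q
      proof -
        have conds: "p = i \<and> q = j \<longleftrightarrow> i = p \<and> j = q" "p = j \<and> q = i \<longleftrightarrow> i = q \<and> j = p"
          "p = \<sigma> i \<and> q = \<sigma> j \<longleftrightarrow> i = \<sigma> p \<and> j = \<sigma> q" "p = \<sigma> j \<and> q = \<sigma> i \<longleftrightarrow> i = \<sigma> q \<and> j = \<sigma> p"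
          using ij pq by (metis \<sigma>_\<sigma>)+
        have sums: "(M + M') $$ (p, q) = M $$ (p, q) + M' $$ (p, q)" if "M' \<in> carrier_mat N N" for M M' :: "complex mat"
          using that pq by simp
        have gen: "(if P then 1 else 0) - (if Q then cnj 1 else 0) + (if R then e * cnj 1 else 0) - (if S then e * 1 else 0) =
            ((if P then 1 else 0) + (if S then - e else 0)) + ((if Q then -1 else 0) + (if R then e else 0))"
          "(if P then \<i> else 0) - (if Q then cnj \<i> else 0) + (if R then e * cnj \<i> else 0) - (if S then e * \<i> else 0) =
            \<i> * ((if P then 1 else 0) + (if S then - e else 0)) - \<i> * ((if Q then -1 else 0) + (if R then e else 0))"
          for P Q R S and e :: complex by (auto simp: algebra_simps)
        show "four_unit i j 1 $$ (p, q) = A $$ (p, q) + B' $$ (p, q)"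
          "four_unit i j \<i> $$ (p, q) = \<i> * A $$ (p, q) - \<i> * B' $$ (p, q)"
          unfolding A_def B'_def linear_half_def sums[OF unit_mat_carrier] unit_mat_entry[OF pq] four_unit_entry[OF pq] conds
            mult_minus_left by (rule gen)+
      qed
      have P1: "?P i j 1 = (1/4) \<cdot>\<^sub>m A + (1/4) \<cdot>\<^sub>m B'"
        using True AB unfolding entry_projection_def real_smult_def
        by (intro square_eqI[of _ N]) (simp_all add: entries)
      have P2: "?P i j \<i> = (\<i>/4) \<cdot>\<^sub>m A + (-\<i>/4) \<cdot>\<^sub>m B'"
        using True AB unfolding entry_projection_def real_smult_def
        by (intro square_eqI[of _ N]) (simp_all add: entries algebra_simps)
      \<comment> \<open>Complex linearity of \<open>f\<close> on all matrices is used here. As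
        \<open>Im (\<i> * w) = Re w\<close>, the contributions of \<open>B'\<close> cancel and those
        of \<open>A\<close> add up to half the real part of its entry.\<close>
      have "f (?P i j 1) = (1/4) \<cdot>\<^sub>m f A + (1/4) \<cdot>\<^sub>m f B'" "f (?P i j \<i>) = (\<i>/4) \<cdot>\<^sub>m f A + (-\<i>/4) \<cdot>\<^sub>m f B'"
        unfolding P1 P2 using AB by (simp_all add: f_add f_smult)
      then show ?thesis
        using True ij carrier_matD[OF f_carrier[OF AB(1)]] carrier_matD[OF f_carrier[OF AB(2)]]
        by (simp add: A_def[symmetric])
    next
      case False
      define Z0 where "Z0 = f (0\<^sub>m N N)"
      have "0 \<cdot>\<^sub>m (0\<^sub>m N N) = (0\<^sub>m N N :: complex mat)" by simp
      then have "Z0 = 0 \<cdot>\<^sub>m Z0" using f_smult[of "0\<^sub>m N N" 0] unfolding Z0_def by simp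
      then have "Z0 $$ (i, j) = (0 \<cdot>\<^sub>m Z0) $$ (i, j)" by (rule arg_cong)
      also have "\<dots> = 0" using f_carrier[of "0\<^sub>m N N"] ij unfolding Z0_def by simp
      finally have "f (0\<^sub>m N N) $$ (i, j) = 0" unfolding Z0_def .
      then show ?thesis using False ij by (simp add: entry_projection_def)
    qed
  qed
  finally show ?thesis by (simp add: sum_distrib_left)
qed

lemma linear_half_diagonal:
  "i < N \<Longrightarrow> j < N \<Longrightarrow> linear_half i j $$ (i, j) = (if j = \<sigma> i then 2 else 1)"
  by (auto simp: linear_half_def \<sigma>_swap)

text \<open>The dimension is the trace of the identity. The \<open>N\<close> positions
  \<open>(i, \<sigma> i)\<close>, where both summands of \<open>linear_half\<close> fall on the same
  entry, count twice.\<close>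

lemma dimension_sp_full:
  assumes B: "real_basis N (sp (\<lambda>_ _. True)) d b"
  shows "2 * d = N * (N + 1)"
proof -
  have "real d = (\<Sum>k<d. coord N d b (b k) k)" using coord_basis[OF B] by simp
  also have "\<dots> = (1/2) * (\<Sum>i<N. \<Sum>j<N. if True then Re (linear_half i j $$ (i, j)) else 0)"
    by (rule trace_sp[OF B, of "\<lambda>X. X"]) (auto simp: admissible_def)
  also have "\<dots> = (1/2) * (\<Sum>i<N. \<Sum>j<N. 1 + (if j = \<sigma> i then 1 else 0))"
    by (intro arg_cong[where f = "\<lambda>x. (1/2) * x"] sum.cong) (auto simp: linear_half_diagonal)
  also have "\<dots> = (1/2) * (\<Sum>i<N. real N + 1)"
    by (intro arg_cong[where f = "\<lambda>x. (1/2) * x"] sum.cong) (auto simp: sum.distrib)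
  finally have "2 * real d = real N * (real N + 1)" by simp
  then have "real (2 * d) = real (N * (N + 1))" by (simp add: algebra_simps)
  then show ?thesis by (simp only: of_nat_eq_iff)
qed

text \<open>The terms with the factor \<open>\<epsilon> i * \<epsilon> j\<close> come from the
  second summand of \<open>linear_half\<close>, the others from the first.\<close>

lemma trace_ad_ad:
  assumes B: "real_basis N (sp E) d b" and E: "admissible E"
    and X: "X \<in> carrier_mat N N" and Y: "Y \<in> carrier_mat N N"
    and f: "\<And>Z. Z \<in> sp E \<Longrightarrow> lie_bracket X (lie_bracket Y Z) \<in> sp E"
  shows "(\<Sum>k<d. coord N d b (lie_bracket X (lie_bracket Y (b k))) k) =
    (1/2) * (\<Sum>i<N. \<Sum>j<N. if E i j then
      Re ((X * Y) $$ (i, i) - X $$ (i, i) * Y $$ (j, j) - Y $$ (i, i) * X $$ (j, j) + (Y * X) $$ (j, j)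
       - \<epsilon> i * \<epsilon> j * ((if \<sigma> i = j then (X * Y) $$ (i, \<sigma> j) + (Y * X) $$ (\<sigma> i, j) else 0)
          - X $$ (i, \<sigma> j) * Y $$ (\<sigma> i, j) - Y $$ (i, \<sigma> j) * X $$ (\<sigma> i, j))) else 0)"
proof -
  have "(\<Sum>k<d. coord N d b (lie_bracket X (lie_bracket Y (b k))) k) =
    (1/2) * (\<Sum>i<N. \<Sum>j<N. if E i j then Re (lie_bracket X (lie_bracket Y (linear_half i j)) $$ (i, j)) else 0)"
  proof (rule trace_sp[OF B E f])
    fix U :: "complex mat" assume U: "U \<in> carrier_mat N N"
    show "lie_bracket X (lie_bracket Y U) \<in> carrier_mat N N" using X Y U by simp
    show "lie_bracket X (lie_bracket Y (c \<cdot>\<^sub>m U)) = c \<cdot>\<^sub>m lie_bracket X (lie_bracket Y U)" for c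
      using lie_bracket_smult[OF Y U] lie_bracket_smult[OF X lie_bracket_carrier[OF Y U]] by simp
    fix W :: "complex mat" assume W: "W \<in> carrier_mat N N"
    show "lie_bracket X (lie_bracket Y (U + W)) = lie_bracket X (lie_bracket Y U) + lie_bracket X (lie_bracket Y W)"
      using lie_bracket_add[OF Y U W] lie_bracket_add[OF X lie_bracket_carrier[OF Y U] lie_bracket_carrier[OF Y W]] by simp
  qed
  also have "\<dots> = (1/2) * (\<Sum>i<N. \<Sum>j<N. if E i j then
      Re ((X * Y) $$ (i, i) - X $$ (i, i) * Y $$ (j, j) - Y $$ (i, i) * X $$ (j, j) + (Y * X) $$ (j, j)
       - \<epsilon> i * \<epsilon> j * ((if \<sigma> i = j then (X * Y) $$ (i, \<sigma> j) + (Y * X) $$ (\<sigma> i, j) else 0)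
          - X $$ (i, \<sigma> j) * Y $$ (\<sigma> i, j) - Y $$ (i, \<sigma> j) * X $$ (\<sigma> i, j))) else 0)"
  proof (intro arg_cong[where f = "\<lambda>x. (1/2) * x"] sum.cong refl if_cong)
    fix i j assume "i \<in> {..<N}" "j \<in> {..<N}"
    then have ij: "i < N" "j < N" by auto
    let ?A = "unit_mat N i j 1" and ?B = "unit_mat N (\<sigma> j) (\<sigma> i) (- \<epsilon> i * \<epsilon> j)"
    have split: "lie_bracket X (lie_bracket Y (linear_half i j)) = lie_bracket X (lie_bracket Y ?A) + lie_bracket X (lie_bracket Y ?B)"
      unfolding linear_half_def
      using lie_bracket_add[OF Y unit_mat_carrier unit_mat_carrier, of i j 1 "\<sigma> j" "\<sigma> i" "- \<epsilon> i * \<epsilon> j"]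
        lie_bracket_add[OF X lie_bracket_carrier[OF Y unit_mat_carrier] lie_bracket_carrier[OF Y unit_mat_carrier],
          of i j 1 "\<sigma> j" "\<sigma> i" "- \<epsilon> i * \<epsilon> j"] by simp
    have entry: "lie_bracket X (lie_bracket Y (linear_half i j)) $$ (i, j) =
        lie_bracket X (lie_bracket Y ?A) $$ (i, j) + lie_bracket X (lie_bracket Y ?B) $$ (i, j)"
      unfolding split using ij X Y
      by (subst index_add_mat) (auto simp: carrier_matD[OF lie_bracket_carrier[OF X lie_bracket_carrier[OF Y unit_mat_carrier]]])
    have \<sigma>ij: "\<sigma> j = i \<longleftrightarrow> \<sigma> i = j" "i = \<sigma> j \<longleftrightarrow> \<sigma> i = j" using ij by auto
    show "Re (lie_bracket X (lie_bracket Y (linear_half i j)) $$ (i, j)) =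
      Re ((X * Y) $$ (i, i) - X $$ (i, i) * Y $$ (j, j) - Y $$ (i, i) * X $$ (j, j) + (Y * X) $$ (j, j)
       - \<epsilon> i * \<epsilon> j * ((if \<sigma> i = j then (X * Y) $$ (i, \<sigma> j) + (Y * X) $$ (\<sigma> i, j) else 0)
          - X $$ (i, \<sigma> j) * Y $$ (\<sigma> i, j) - Y $$ (i, \<sigma> j) * X $$ (\<sigma> i, j)))"
      unfolding entry ad_ad_unit_mat[OF X Y ij ij] ad_ad_unit_mat[OF X Y ij \<sigma>_less[OF ij(2)] \<sigma>_less[OF ij(1)]] \<sigma>ij
      by (rule arg_cong[where f = Re]) (simp add: algebra_simps)
  qed
  finally show ?thesis .
qed

lemma diagonal_product:
  assumes X: "X \<in> sp E" and Y: "Y \<in> sp E'" and i: "i < N"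
  shows "(X * Y) $$ (i, i) = - (\<Sum>l<N. X $$ (i, l) * cnj (Y $$ (i, l)))"
  using i by (simp add: mult_entry[OF spD(1)[OF X] spD(1)[OF Y]] spD(4)[OF Y, of i] sum_negf[symmetric] del: index_mult_mat)

lemma trace_product:
  assumes X: "X \<in> sp E" and Y: "Y \<in> sp E'"
  shows "(\<Sum>i<N. Re ((X * Y) $$ (i, i))) = - frobenius N X Y"
proof -
  have "(\<Sum>i<N. Re ((X * Y) $$ (i, i))) = (\<Sum>i<N. - (\<Sum>l<N. Re (X $$ (i, l) * cnj (Y $$ (i, l)))))"
    by (intro sum.cong refl) (simp add: diagonal_product[OF X Y] Re_sum del: index_mult_mat)
  then show ?thesis by (simp add: frobenius_def sum_negf)
qed

lemma diagonal_\<sigma>: "X \<in> sp E \<Longrightarrow> i < N \<Longrightarrow> X $$ (\<sigma> i, \<sigma> i) = - X $$ (i, i)"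
  using spD(2)[of X E i i] arg_cong[OF spD(4)[of X E i i], of uminus] by simp

lemma trace_zero:
  assumes X: "X \<in> sp E"
  shows "(\<Sum>i<N. X $$ (i, i)) = 0"
proof -
  have "(\<Sum>i<N. X $$ (i, i)) = (\<Sum>i<N. X $$ (\<sigma> i, \<sigma> i))" by (rule sum_\<sigma>[symmetric])
  also have "\<dots> = - (\<Sum>i<N. X $$ (i, i))"
    unfolding sum_negf[symmetric] by (intro sum.cong refl) (simp add: diagonal_\<sigma>[OF X])
  finally show ?thesis by simp
qed

text \<open>In the double sum the two diagonal terms of the products give \<open>N\<close> times the
  trace of \<open>X Y\<close> each, the products of diagonal entries vanish since traces are zero,
  the positions \<open>j = \<sigma> i\<close> give two more traces, and the remaining terms become
  two inner products by the quaternionic relation. Half of the total is \<open>- (N + 2)\<close>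
  inner products.\<close>

lemma killing_trace:
  assumes B: "real_basis N (sp (\<lambda>_ _. True)) d b"
    and X: "X \<in> sp (\<lambda>_ _. True)" and Y: "Y \<in> sp (\<lambda>_ _. True)"
  shows "(\<Sum>k<d. coord N d b (lie_bracket X (lie_bracket Y (b k))) k) = - (real N + 2) * frobenius N X Y"
proof -
  note cX = spD(1)[OF X] and cY = spD(1)[OF Y]
  have inv: "lie_bracket X (lie_bracket Y Z) \<in> sp (\<lambda>_ _. True)" if "Z \<in> sp (\<lambda>_ _. True)" for Z
    using lie_bracket_quaternionic X Y that by blast
  have adm: "admissible (\<lambda>_ _. True)" by (simp add: admissible_def)
  let ?h = "\<lambda>i j. Re ((X * Y) $$ (i, i)) - Re (X $$ (i, i) * Y $$ (j, j)) - Re (Y $$ (i, i) * X $$ (j, j)) + Re ((Y * X) $$ (j, j))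
      + (if j = \<sigma> i then Re ((X * Y) $$ (i, i)) + Re ((Y * X) $$ (\<sigma> i, \<sigma> i)) else 0)
      - Re (X $$ (\<sigma> i, j) * cnj (Y $$ (\<sigma> i, j))) - Re (Y $$ (\<sigma> i, j) * cnj (X $$ (\<sigma> i, j)))"
  have prod: "(\<Sum>i<N. \<Sum>j<N. Re (U $$ (i, i) * W $$ (j, j))) = Re ((\<Sum>i<N. U $$ (i, i)) * (\<Sum>j<N. W $$ (j, j)))"
    for U W :: "complex mat" by (simp only: sum_product Re_sum)
  have "(\<Sum>k<d. coord N d b (lie_bracket X (lie_bracket Y (b k))) k) = (1/2) * (\<Sum>i<N. \<Sum>j<N. ?h i j)"
  proof (rule trans[OF trace_ad_ad[OF B adm cX cY inv]], assumption, unfold if_True, rule arg_cong[where f = "\<lambda>x. (1/2) * x"], intro sum.cong refl)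
    fix i j assume "i \<in> {..<N}" "j \<in> {..<N}"
    then have ij: "i < N" "j < N" by auto
    have q: "\<epsilon> i * \<epsilon> j * U $$ (i, \<sigma> j) = - cnj (U $$ (\<sigma> i, j))" if U: "U \<in> sp (\<lambda>_ _. True)" for U
      using spD(2)[OF U \<sigma>_less[OF ij(1)] ij(2)] ij by (simp add: algebra_simps)
    show "Re ((X * Y) $$ (i, i) - X $$ (i, i) * Y $$ (j, j) - Y $$ (i, i) * X $$ (j, j) + (Y * X) $$ (j, j)
       - \<epsilon> i * \<epsilon> j * ((if \<sigma> i = j then (X * Y) $$ (i, \<sigma> j) + (Y * X) $$ (\<sigma> i, j) else 0)
          - X $$ (i, \<sigma> j) * Y $$ (\<sigma> i, j) - Y $$ (i, \<sigma> j) * X $$ (\<sigma> i, j))) = ?h i j"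
    proof -
      have "\<epsilon> i * \<epsilon> j * ((if \<sigma> i = j then (X * Y) $$ (i, \<sigma> j) + (Y * X) $$ (\<sigma> i, j) else 0)
          - X $$ (i, \<sigma> j) * Y $$ (\<sigma> i, j) - Y $$ (i, \<sigma> j) * X $$ (\<sigma> i, j)) =
        (if j = \<sigma> i then - ((X * Y) $$ (i, i) + (Y * X) $$ (\<sigma> i, \<sigma> i)) else 0)
        - (\<epsilon> i * \<epsilon> j * X $$ (i, \<sigma> j)) * Y $$ (\<sigma> i, j) - (\<epsilon> i * \<epsilon> j * Y $$ (i, \<sigma> j)) * X $$ (\<sigma> i, j)"
        using ij by (auto simp: right_diff_distrib mult.assoc simp del: index_mult_mat)
      then show ?thesis unfolding q[OF X] q[OF Y]
        by (simp add: mult.commute del: index_mult_mat times_complex.sel)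
    qed
  qed
  also have "(\<Sum>i<N. \<Sum>j<N. ?h i j) = real N * (\<Sum>i<N. Re ((X * Y) $$ (i, i))) - Re ((\<Sum>i<N. X $$ (i, i)) * (\<Sum>j<N. Y $$ (j, j)))
      - Re ((\<Sum>i<N. Y $$ (i, i)) * (\<Sum>j<N. X $$ (j, j))) + real N * (\<Sum>j<N. Re ((Y * X) $$ (j, j)))
      + ((\<Sum>i<N. Re ((X * Y) $$ (i, i))) + (\<Sum>i<N. Re ((Y * X) $$ (\<sigma> i, \<sigma> i))))
      - (\<Sum>i<N. \<Sum>j<N. Re (X $$ (\<sigma> i, j) * cnj (Y $$ (\<sigma> i, j)))) - (\<Sum>i<N. \<Sum>j<N. Re (Y $$ (\<sigma> i, j) * cnj (X $$ (\<sigma> i, j))))"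
    using prod[of X Y] prod[of Y X]
    by (simp add: sum.distrib sum_subtractf sum_distrib_left del: index_mult_mat times_complex.sel)
  also have "\<dots> = - 2 * ((real N + 2) * frobenius N X Y)"
    unfolding sum_\<sigma>[of "\<lambda>i. Re ((Y * X) $$ (i, i))"] sum_\<sigma>[of "\<lambda>i. \<Sum>j<N. Re (X $$ (i, j) * cnj (Y $$ (i, j)))"]
      sum_\<sigma>[of "\<lambda>i. \<Sum>j<N. Re (Y $$ (i, j) * cnj (X $$ (i, j)))"] frobenius_def[symmetric]
      trace_product[OF X Y] trace_product[OF Y X] trace_zero[OF X] trace_zero[OF Y] frobenius_commute[of N Y X]
    by (simp add: algebra_simps)
  finally show ?thesis by (simp add: algebra_simps)
qed

lemma killing_form_sp:
  assumes X: "X \<in> sp (\<lambda>_ _. True)" and Y: "Y \<in> sp (\<lambda>_ _. True)"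
  shows "killing_form N (sp (\<lambda>_ _. True)) X Y = - (real N + 2) * frobenius N X Y"
proof -
  obtain d0 b0 where "real_basis N (sp (\<lambda>_ _. True)) d0 b0"
    using exists_frobenius_orthonormal_basis[OF real_subspace_sp] by blast
  then have ex: "\<exists>x. (\<lambda>(d, b). real_basis N (sp (\<lambda>_ _. True)) d b) x" by auto
  \<comment> \<open>Because some basis exists, the one selected in \<open>endo_trace\<close> is a
    basis, and the trace formula holds for every basis.\<close>
  obtain d b where db: "(SOME (d, b). real_basis N (sp (\<lambda>_ _. True)) d b) = (d, b)" by (rule prod.exhaust)
  from someI_ex[OF ex] have B: "real_basis N (sp (\<lambda>_ _. True)) d b" by (simp add: db)
  show ?thesis
    unfolding killing_form_def endo_trace_def db by (simp add: killing_trace[OF B X Y])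
qed

lemma ip_sp:
  "X \<in> sp (\<lambda>_ _. True) \<Longrightarrow> Y \<in> sp (\<lambda>_ _. True) \<Longrightarrow> ip N (sp (\<lambda>_ _. True)) X Y = (real N + 2) * frobenius N X Y"
  by (simp add: ip_def killing_form_sp algebra_simps)

end


section \<open>The compact symplectic group\<close>

lemma continuous_map_complex_mult:
  fixes f g :: "'a \<Rightarrow> complex"
  assumes "continuous_map X euclidean f" "continuous_map X euclidean g"
  shows "continuous_map X euclidean (\<lambda>x. f x * g x)"
proof -
  have "continuous_map X (prod_topology euclidean euclidean) (\<lambda>x. (f x, g x))"
    using assms unfolding continuous_map_pairwise o_def fst_conv snd_conv by blast
  moreover have "continuous_map (prod_topology euclidean euclidean) euclidean (\<lambda>p :: complex \<times> complex. fst p * snd p)"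
    unfolding euclidean_product_topology by (simp add: continuous_on_fst continuous_on_snd continuous_intros)
  ultimately have "continuous_map X euclidean ((\<lambda>p. fst p * snd p) \<circ> (\<lambda>x. (f x, g x)))"
    by (rule continuous_map_compose)
  then show ?thesis by (simp add: o_def)
qed

lemma continuous_map_cnj:
  assumes "continuous_map X euclidean f"
  shows "continuous_map X euclidean (\<lambda>x. cnj (f x))"
proof -
  have "continuous_map euclidean euclidean cnj" by (simp add: continuous_on_cnj continuous_on_id)
  from continuous_map_compose[OF assms this] show ?thesis by (simp add: o_def)
qed

lemma topspace_mat_topology [simp]: "topspace (mat_topology n) = carrier_mat n n"
  unfolding mat_topology_def topspace_pullback_topology by (auto simp: PiE_def)

lemma continuous_map_entry:
  assumes "i < n" "j < n"
  shows "continuous_map (mat_topology n) euclidean (\<lambda>A. A $$ (i, j))"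
proof -
  have "continuous_map (product_topology (\<lambda>_. euclidean :: complex topology) ({..<n} \<times> {..<n})) euclidean (\<lambda>f. f (i, j))"
    using assms by (intro continuous_map_product_projection) auto
  from continuous_map_pullback[OF this, of "carrier_mat n n" "\<lambda>A. \<lambda>ij \<in> {..<n} \<times> {..<n}. A $$ ij"]
  show ?thesis using assms by (simp add: mat_topology_def o_def)
qed

lemma closedin_zero_set:
  fixes g :: "'c \<Rightarrow> 'a \<Rightarrow> complex"
  assumes "\<And>c. c \<in> I \<Longrightarrow> continuous_map X euclidean (g c)"
  shows "closedin X {A \<in> topspace X. \<forall>c\<in>I. g c A = 0}"
proof -
  have "closedin X {A \<in> topspace X. g c A \<in> {0}}" if "c \<in> I" for c
    using assms[OF that] by (rule closedin_continuous_map_preimage) simp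
  then have "closedin X (\<Inter> (insert (topspace X) ((\<lambda>c. {A \<in> topspace X. g c A \<in> {0}}) ` I)))"
    by (intro closedin_Inter) auto
  moreover have "\<Inter> (insert (topspace X) ((\<lambda>c. {A \<in> topspace X. g c A \<in> {0}}) ` I)) = {A \<in> topspace X. \<forall>c\<in>I. g c A = 0}"
    by auto
  ultimately show ?thesis by simp
qed

text \<open>The set is the continuous image of a product of closed unit discs, which is
  compact.\<close>

lemma compactin_bounded_matrices:
  "compactin (mat_topology n) {A \<in> carrier_mat n n. \<forall>i<n. \<forall>j<n. cmod (A $$ (i, j)) \<le> 1}"
proof -
  let ?I = "{..<n} \<times> {..<n}"
  let ?P = "product_topology (\<lambda>_. euclidean :: complex topology) ?I"
  let ?K = "PiE ?I (\<lambda>_. cball (0::complex) 1)"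
  have K: "compactin ?P ?K" by (simp add: compactin_PiE)
  have "continuous_map ?P (mat_topology n) (\<lambda>f. mat n n f)"
    unfolding mat_topology_def
  proof (rule continuous_map_pullback')
    show "continuous_map ?P ?P ((\<lambda>A. \<lambda>ij \<in> ?I. A $$ ij) \<circ> (\<lambda>f. mat n n f))"
    proof (rule continuous_map_eq[OF continuous_map_id])
      fix f assume "f \<in> topspace ?P"
      then show "id f = ((\<lambda>A. \<lambda>ij \<in> ?I. A $$ ij) \<circ> (\<lambda>f. mat n n f)) f"
        by (intro ext) (auto simp: PiE_def extensional_def)
    qed
  qed auto
  from image_compactin[OF K this] have C: "compactin (mat_topology n) ((\<lambda>f. mat n n f) ` ?K)" .
  have "{A \<in> carrier_mat n n. \<forall>i<n. \<forall>j<n. cmod (A $$ (i, j)) \<le> 1} = (\<lambda>f. mat n n f) ` ?K"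
  proof (intro equalityI subsetI)
    fix A :: "complex mat" assume A: "A \<in> {A \<in> carrier_mat n n. \<forall>i<n. \<forall>j<n. cmod (A $$ (i, j)) \<le> 1}"
    then have "A = mat n n (\<lambda>ij \<in> ?I. A $$ ij)" "(\<lambda>ij \<in> ?I. A $$ ij) \<in> ?K" by (auto intro!: eq_matI)
    then show "A \<in> (\<lambda>f. mat n n f) ` ?K" by blast
  next
    fix A assume "A \<in> (\<lambda>f. mat n n f) ` ?K"
    then obtain f where f: "f \<in> ?K" "A = mat n n f" by blast
    have "cmod (f (i, j)) \<le> 1" if "i < n" "j < n" for i j
      using PiE_mem[OF f(1), of "(i, j)"] that by simp
    then show "A \<in> {A \<in> carrier_mat n n. \<forall>i<n. \<forall>j<n. cmod (A $$ (i, j)) \<le> 1}" by (simp add: f(2))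
  qed
  with C show ?thesis by simp
qed

lemma group_general_linear: "group (general_linear n)"
  unfolding general_linear_def
  by (intro monoid.units_group ring.is_monoid ring_mat)

lemma general_linear_simps [simp]:
  "x \<otimes>\<^bsub>general_linear n\<^esub> y = x * y" "\<one>\<^bsub>general_linear n\<^esub> = 1\<^sub>m n"
  by (simp_all add: general_linear_def units_of_mult units_of_one ring_mat_simps)

lemma general_linearI:
  assumes "U \<in> carrier_mat n n" "V \<in> carrier_mat n n" "V * U = 1\<^sub>m n" "U * V = 1\<^sub>m n"
  shows "U \<in> carrier (general_linear n)"
  using assms unfolding general_linear_def units_of_carrier Units_def by (auto simp: ring_mat_simps)

section \<open>The group and its subgroups of block matrices\<close>

context symplectic_form begin

definition adj :: "complex mat \<Rightarrow> complex mat" where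
  "adj U = mat N N (\<lambda>(i, j). cnj (U $$ (j, i)))"

lemma adj_carrier [simp]: "adj U \<in> carrier_mat N N"
  by (simp add: adj_def)

lemma adj_entry [simp]: "i < N \<Longrightarrow> j < N \<Longrightarrow> adj U $$ (i, j) = cnj (U $$ (j, i))"
  by (simp add: adj_def)

text \<open>Unitarity is stated as orthonormality of the rows; that of the columns follows because a
  right inverse of a square matrix is also a left inverse.\<close>

definition Sp :: "(nat \<Rightarrow> nat \<Rightarrow> bool) \<Rightarrow> complex mat set" where
  "Sp E = {U. quaternionic U \<and> supported E U \<and>
     (\<forall>i<N. \<forall>j<N. (\<Sum>l<N. U $$ (i, l) * cnj (U $$ (j, l))) = (if i = j then 1 else 0))}"

text \<open>An equivalence relation with classes stable under \<open>\<sigma>\<close>. Reflexivity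
  admits the identity, transitivity products and symmetry inverses; patterns of modules are merely
  \<open>admissible\<close>.\<close>

definition block_relation :: "(nat \<Rightarrow> nat \<Rightarrow> bool) \<Rightarrow> bool" where
  "block_relation E \<longleftrightarrow> (\<forall>i<N. E i i \<and> E i (\<sigma> i)) \<and> (\<forall>i<N. \<forall>j<N. E i j \<longrightarrow> E j i) \<and>
     (\<forall>i<N. \<forall>j<N. \<forall>l<N. E i j \<longrightarrow> E j l \<longrightarrow> E i l)"

lemma block_relationD:
  assumes "block_relation E"
  shows "i < N \<Longrightarrow> E i i" "i < N \<Longrightarrow> E i (\<sigma> i)" "i < N \<Longrightarrow> j < N \<Longrightarrow> E i j \<Longrightarrow> E j i"
    "i < N \<Longrightarrow> j < N \<Longrightarrow> l < N \<Longrightarrow> E i j \<Longrightarrow> E j l \<Longrightarrow> E i l"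
  using assms unfolding block_relation_def by blast+

lemma block_relation_\<sigma>:
  assumes E: "block_relation E" and ij: "i < N" "j < N" "E i j"
  shows "E (\<sigma> i) (\<sigma> j)"
proof -
  have "E (\<sigma> i) i" using block_relationD(2)[OF E \<sigma>_less[OF ij(1)]] ij by simp
  then have "E (\<sigma> i) j" using block_relationD(4)[OF E] ij by (meson \<sigma>_less)
  then show ?thesis using block_relationD(2)[OF E ij(2)] block_relationD(4)[OF E] ij by (meson \<sigma>_less)
qed

lemma block_relation_admissible: "block_relation E \<Longrightarrow> admissible E"
  unfolding admissible_def using block_relation_\<sigma> block_relationD(3) by blast

lemma SpD:
  assumes "U \<in> Sp E"
  shows "U \<in> carrier_mat N N"
    and "i < N \<Longrightarrow> j < N \<Longrightarrow> U $$ (\<sigma> i, \<sigma> j) = \<epsilon> i * \<epsilon> j * cnj (U $$ (i, j))"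
    and "i < N \<Longrightarrow> j < N \<Longrightarrow> \<not> E i j \<Longrightarrow> U $$ (i, j) = 0"
    and "i < N \<Longrightarrow> j < N \<Longrightarrow> (\<Sum>l<N. U $$ (i, l) * cnj (U $$ (j, l))) = (if i = j then 1 else 0)"
proof -
  note H = assms[unfolded Sp_def quaternionic_def supported_def mem_Collect_eq]
  show "U \<in> carrier_mat N N" by (rule H[THEN conjunct1, THEN conjunct1])
  show "i < N \<Longrightarrow> j < N \<Longrightarrow> U $$ (\<sigma> i, \<sigma> j) = \<epsilon> i * \<epsilon> j * cnj (U $$ (i, j))"
    by (rule H[THEN conjunct1, THEN conjunct2, rule_format])
  show "i < N \<Longrightarrow> j < N \<Longrightarrow> \<not> E i j \<Longrightarrow> U $$ (i, j) = 0"
    by (rule H[THEN conjunct2, THEN conjunct1, rule_format])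
  show "i < N \<Longrightarrow> j < N \<Longrightarrow> (\<Sum>l<N. U $$ (i, l) * cnj (U $$ (j, l))) = (if i = j then 1 else 0)"
    by (rule H[THEN conjunct2, THEN conjunct2, rule_format])
qed

lemma SpI:
  assumes "U \<in> carrier_mat N N"
    and "\<And>i j. i < N \<Longrightarrow> j < N \<Longrightarrow> U $$ (\<sigma> i, \<sigma> j) = \<epsilon> i * \<epsilon> j * cnj (U $$ (i, j))"
    and "\<And>i j. i < N \<Longrightarrow> j < N \<Longrightarrow> \<not> E i j \<Longrightarrow> U $$ (i, j) = 0"
    and "\<And>i j. i < N \<Longrightarrow> j < N \<Longrightarrow> (\<Sum>l<N. U $$ (i, l) * cnj (U $$ (j, l))) = (if i = j then 1 else 0)"
  shows "U \<in> Sp E"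
  unfolding Sp_def quaternionic_def supported_def mem_Collect_eq
  by (intro conjI allI impI assms)

lemma Sp_adj_right: "U \<in> Sp E \<Longrightarrow> U * adj U = 1\<^sub>m N"
  by (rule square_eqI[OF mult_carrier_mat[OF SpD(1) adj_carrier]])
    (auto simp: mult_entry[OF SpD(1) adj_carrier] SpD(4) simp del: index_mult_mat)

lemma Sp_adj_left: "U \<in> Sp E \<Longrightarrow> adj U * U = 1\<^sub>m N"
  using mat_mult_left_right_inverse[OF SpD(1) adj_carrier Sp_adj_right] by blast

lemma Sp_one:
  assumes E: "block_relation E"
  shows "1\<^sub>m N \<in> Sp E"
proof (rule SpI)
  fix i j assume ij: "i < N" "j < N"
  show "1\<^sub>m N $$ (\<sigma> i, \<sigma> j) = \<epsilon> i * \<epsilon> j * cnj (1\<^sub>m N $$ (i, j))" using ij by auto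
  show "1\<^sub>m N $$ (i, j) = 0" if "\<not> E i j" using ij that block_relationD(1)[OF E] by auto
  have "(\<Sum>l<N. 1\<^sub>m N $$ (i, l) * cnj (1\<^sub>m N $$ (j, l))) = (\<Sum>l<N. if l = i then (if i = j then 1 else 0) else 0)"
    using ij by (intro sum.cong) auto
  then show "(\<Sum>l<N. 1\<^sub>m N $$ (i, l) * cnj (1\<^sub>m N $$ (j, l))) = (if i = j then 1 else 0)" using ij by simp
qed simp

lemma Sp_mult:
  assumes E: "block_relation E" and U: "U \<in> Sp E" and W: "W \<in> Sp E"
  shows "U * W \<in> Sp E"
proof (rule SpI)
  note UW = SpD(1)[OF U] SpD(1)[OF W]
  show c: "U * W \<in> carrier_mat N N" using UW by (rule mult_carrier_mat)
  fix i j assume ij: "i < N" "j < N"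
  have "(\<Sum>l<N. U $$ (\<sigma> i, l) * W $$ (l, \<sigma> j)) = (\<Sum>l<N. U $$ (\<sigma> i, \<sigma> l) * W $$ (\<sigma> l, \<sigma> j))"
    by (rule sum_\<sigma>[symmetric])
  also have "\<dots> = (\<Sum>l<N. \<epsilon> i * \<epsilon> j * cnj (U $$ (i, l) * W $$ (l, j)))"
  proof (intro sum.cong refl)
    fix l assume "l \<in> {..<N}"
    then have l: "l < N" by simp
    have "U $$ (\<sigma> i, \<sigma> l) * W $$ (\<sigma> l, \<sigma> j) =
        (\<epsilon> l * \<epsilon> l) * (\<epsilon> i * \<epsilon> j * (cnj (U $$ (i, l)) * cnj (W $$ (l, j))))"
      unfolding SpD(2)[OF U ij(1) l] SpD(2)[OF W l ij(2)] by (simp only: ac_simps)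
    then show "U $$ (\<sigma> i, \<sigma> l) * W $$ (\<sigma> l, \<sigma> j) = \<epsilon> i * \<epsilon> j * cnj (U $$ (i, l) * W $$ (l, j))"
      by (simp only: \<epsilon>_sq[OF l] mult_1_left complex_cnj_mult)
  qed
  finally show "(U * W) $$ (\<sigma> i, \<sigma> j) = \<epsilon> i * \<epsilon> j * cnj ((U * W) $$ (i, j))"
    using ij by (simp add: mult_entry[OF UW] sum_distrib_left del: index_mult_mat)
  show "(U * W) $$ (i, j) = 0" if "\<not> E i j"
  proof -
    have "U $$ (i, l) * W $$ (l, j) = 0" if "l < N" for l
      using SpD(3)[OF U ij(1) that] SpD(3)[OF W that ij(2)] block_relationD(4)[OF E ij(1) that ij(2)] \<open>\<not> E i j\<close>
      by (metis mult_zero_left mult_zero_right)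
    then show ?thesis unfolding mult_entry[OF UW ij] by (intro sum.neutral) simp
  qed
  have adj: "adj (U * W) = adj W * adj U"
    using ij UW mult_carrier_mat[OF adj_carrier adj_carrier, of W U]
    by (intro square_eqI[of _ N]) (auto simp: mult_entry[OF UW] mult_entry[OF adj_carrier adj_carrier] mult.commute simp del: index_mult_mat intro!: sum.cong)
  have "(U * W) * adj (U * W) = U * ((W * adj W) * adj U)"
    unfolding adj
    using assoc_mult_mat[OF UW mult_carrier_mat[OF adj_carrier adj_carrier], of W U]
      assoc_mult_mat[OF UW(2) adj_carrier adj_carrier, of W U] by simp
  also have "\<dots> = 1\<^sub>m N"
    unfolding Sp_adj_right[OF W] left_mult_one_mat[OF adj_carrier] by (rule Sp_adj_right[OF U])
  finally have "((U * W) * adj (U * W)) $$ (i, j) = (1\<^sub>m N :: complex mat) $$ (i, j)" by simp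
  then show "(\<Sum>l<N. (U * W) $$ (i, l) * cnj ((U * W) $$ (j, l))) = (if i = j then 1 else 0)"
    using ij by (simp add: mult_entry[OF c adj_carrier] del: index_mult_mat)
qed

lemma Sp_adj:
  assumes E: "block_relation E" and U: "U \<in> Sp E"
  shows "adj U \<in> Sp E"
proof (rule SpI)
  fix i j assume ij: "i < N" "j < N"
  show "adj U $$ (\<sigma> i, \<sigma> j) = \<epsilon> i * \<epsilon> j * cnj (adj U $$ (i, j))"
    using ij by (simp add: SpD(2)[OF U])
  show "adj U $$ (i, j) = 0" if "\<not> E i j"
    using that SpD(3)[OF U ij(2,1)] block_relationD(3)[OF E ij(2,1)] ij by auto
  have "(adj U * U) $$ (i, j) = (1\<^sub>m N :: complex mat) $$ (i, j)" by (simp add: Sp_adj_left[OF U])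
  then show "(\<Sum>l<N. adj U $$ (i, l) * cnj (adj U $$ (j, l))) = (if i = j then 1 else 0)"
    using ij by (simp add: mult_entry[OF adj_carrier SpD(1)[OF U]] del: index_mult_mat)
qed simp

lemma Sp_general_linear: "U \<in> Sp E \<Longrightarrow> U \<in> carrier (general_linear N)"
  by (rule general_linearI[of _ _ "adj U"]) (simp_all add: SpD(1) Sp_adj_left Sp_adj_right)

lemma adj_general_linear: "U \<in> Sp E \<Longrightarrow> adj U \<in> carrier (general_linear N)"
  by (rule general_linearI[of _ _ U]) (simp_all add: SpD(1) Sp_adj_left Sp_adj_right)

lemma inv_Sp: "U \<in> Sp E \<Longrightarrow> inv\<^bsub>general_linear N\<^esub> U = adj U"
  by (rule group.inv_equality[OF group_general_linear])
    (simp_all add: Sp_adj_left Sp_general_linear adj_general_linear)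

lemma Ad_Sp: "U \<in> Sp E \<Longrightarrow> Ad N U X = U * X * adj U"
  by (simp add: Ad_def inv_Sp)

lemma subgroup_Sp: "block_relation E \<Longrightarrow> subgroup (Sp E) (general_linear N)"
  by (rule subgroup.intro) (auto simp: Sp_general_linear Sp_mult Sp_one inv_Sp Sp_adj)

lemma Sp_mono: "(\<And>i j. i < N \<Longrightarrow> j < N \<Longrightarrow> E i j \<Longrightarrow> E' i j) \<Longrightarrow> Sp E \<subseteq> Sp E'"
  unfolding Sp_def supported_def by blast

lemma Sp_entry_bound:
  assumes U: "U \<in> Sp E" and ij: "i < N" "j < N"
  shows "cmod (U $$ (i, j)) \<le> 1"
proof -
  have "complex_of_real (\<Sum>l<N. (cmod (U $$ (i, l)))^2) = (\<Sum>l<N. U $$ (i, l) * cnj (U $$ (i, l)))"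
    by (simp add: complex_norm_square del: of_real_power)
  also have "\<dots> = 1" using SpD(4)[OF U ij(1) ij(1)] by simp
  finally have "(\<Sum>l<N. (cmod (U $$ (i, l)))^2) = 1" by (metis of_real_eq_1_iff)
  moreover have "(cmod (U $$ (i, j)))^2 \<le> (\<Sum>l<N. (cmod (U $$ (i, l)))^2)"
    using ij by (intro member_le_sum) auto
  ultimately show ?thesis by (simp add: power2_le_iff_abs_le abs_square_le_1)
qed

lemma closedin_Sp: "closedin (mat_topology N) (Sp E)"
proof -
  let ?J = "{..<N} \<times> {..<N}"
  \<comment> \<open>The index \<open>k\<close> numbers the three families of defining equations:
    quaternionic, support, unitary.\<close>
  let ?g = "\<lambda>(c :: nat \<times> nat \<times> nat) (A :: complex mat). case c of (k, i, j) \<Rightarrow>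
    if k = 0 then A $$ (\<sigma> i, \<sigma> j) - \<epsilon> i * \<epsilon> j * cnj (A $$ (i, j))
    else if k = 1 then (if E i j then 0 else A $$ (i, j))
    else (\<Sum>l<N. A $$ (i, l) * cnj (A $$ (j, l))) - (if i = j then 1 else 0)"
  have cont: "continuous_map (mat_topology N) euclidean (?g c)" if "c \<in> {..2} \<times> ?J" for c
  proof -
    obtain k i j where c: "c = (k, i, j)" by (cases c)
    then have ij: "i < N" "j < N" using that by auto
    have c0: "continuous_map (mat_topology N) euclidean (\<lambda>A. A $$ (\<sigma> i, \<sigma> j) - \<epsilon> i * \<epsilon> j * cnj (A $$ (i, j)))"
      using ij by (intro continuous_map_diff continuous_map_entry continuous_map_complex_mult continuous_map_cnj) auto
    have c1: "continuous_map (mat_topology N) euclidean (\<lambda>A. if E i j then 0 else A $$ (i, j))"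
      using ij by (cases "E i j") (auto intro: continuous_map_entry)
    have c2: "continuous_map (mat_topology N) euclidean (\<lambda>A. (\<Sum>l<N. A $$ (i, l) * cnj (A $$ (j, l))) - (if i = j then 1 else 0))"
      using ij by (intro continuous_map_diff continuous_map_sum continuous_map_entry continuous_map_complex_mult continuous_map_cnj) auto
    show ?thesis unfolding c prod.case
      using c0 c1 c2 by (cases "k = 0"; cases "k = 1") simp_all
  qed
  have Sp_eq: "Sp E = {A \<in> topspace (mat_topology N). \<forall>c\<in>{..2} \<times> ?J. ?g c A = 0}"
  proof (intro equalityI subsetI)
    fix A assume A: "A \<in> Sp E"
    have "?g c A = 0" if "c \<in> {..2} \<times> ?J" for c
    proof -
      obtain k i j where c: "c = (k, i, j)" by (cases c)
      then have ij: "i < N" "j < N" using that by auto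
      show ?thesis unfolding c prod.case using SpD(2,3,4)[OF A ij] by auto
    qed
    then show "A \<in> {A \<in> topspace (mat_topology N). \<forall>c\<in>{..2} \<times> ?J. ?g c A = 0}"
      unfolding mem_Collect_eq topspace_mat_topology using SpD(1)[OF A] by blast
  next
    fix A assume A: "A \<in> {A \<in> topspace (mat_topology N). \<forall>c\<in>{..2} \<times> ?J. ?g c A = 0}"
    then have g: "?g (k, i, j) A = 0" if "k \<le> 2" "i < N" "j < N" for k i j using that by blast
    show "A \<in> Sp E"
    proof (rule SpI)
      show "A \<in> carrier_mat N N" using A by simp
      fix i j assume ij: "i < N" "j < N"
      show "A $$ (\<sigma> i, \<sigma> j) = \<epsilon> i * \<epsilon> j * cnj (A $$ (i, j))" using g[of 0 i j] ij by simp
      show "A $$ (i, j) = 0" if "\<not> E i j" using g[of 1 i j] ij that by simp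
      show "(\<Sum>l<N. A $$ (i, l) * cnj (A $$ (j, l))) = (if i = j then 1 else 0)" using g[of 2 i j] ij by simp
    qed
  qed
  show ?thesis
    unfolding Sp_eq by (rule closedin_zero_set[where g = ?g and I = "{..2} \<times> ?J"]) (rule cont)
qed

lemma compactin_Sp: "compactin (mat_topology N) (Sp E)"
  by (rule closed_compactin[OF compactin_bounded_matrices _ closedin_Sp])
    (use SpD(1) Sp_entry_bound in blast)

lemma compact_lie_group_Sp: "block_relation E \<Longrightarrow> compact_lie_group N (Sp E)"
  by (simp add: compact_lie_group_def subgroup_Sp compactin_Sp)

lemma closed_subgroup_Sp:
  assumes "block_relation E" "Sp E \<subseteq> G"
  shows "closed_subgroup N G (Sp E)"
  using assms closedin_subset_topspace[OF closedin_Sp assms(2)] by (simp add: closed_subgroup_def subgroup_Sp)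

section \<open>Identification of the Lie algebra\<close>

text \<open>Each defining equation of the group, differentiated at the identity along the curve,
  becomes the corresponding equation of \<open>sp E\<close>; the unitary one becomes
  skew-Hermitian.\<close>

lemma lie_algebra_Sp_subset: "lie_algebra N (Sp E) \<subseteq> sp E"
proof
  fix X assume "X \<in> lie_algebra N (Sp E)"
  then obtain \<gamma> :: "real \<Rightarrow> complex mat" where X: "X \<in> carrier_mat N N"
    and \<gamma>: "\<And>t. \<gamma> t \<in> Sp E" "\<gamma> 0 = 1\<^sub>m N"
    and d: "\<And>i j. i < N \<Longrightarrow> j < N \<Longrightarrow> ((\<lambda>s. \<gamma> s $$ (i, j)) has_vector_derivative X $$ (i, j)) (at 0)"
    unfolding lie_algebra_def by blast
  note cnj_d = bounded_linear.has_vector_derivative[OF bounded_linear_cnj]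
  show "X \<in> sp E"
  proof (rule spI[OF X])
    fix i j assume ij: "i < N" "j < N"
    have "((\<lambda>s. \<gamma> s $$ (\<sigma> i, \<sigma> j)) has_vector_derivative \<epsilon> i * \<epsilon> j * cnj (X $$ (i, j))) (at 0)"
      unfolding SpD(2)[OF \<gamma>(1) ij] by (intro has_vector_derivative_mult_right cnj_d d ij)
    with d[OF \<sigma>_less[OF ij(1)] \<sigma>_less[OF ij(2)]]
    show "X $$ (\<sigma> i, \<sigma> j) = \<epsilon> i * \<epsilon> j * cnj (X $$ (i, j))" by (rule vector_derivative_unique_at)
    show "X $$ (i, j) = 0" if "\<not> E i j"
    proof -
      have "((\<lambda>s. \<gamma> s $$ (i, j)) has_vector_derivative 0) (at 0)"
        unfolding SpD(3)[OF \<gamma>(1) ij that] by (rule has_vector_derivative_const)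
      with d[OF ij] show ?thesis by (rule vector_derivative_unique_at)
    qed
    have "((\<lambda>s. \<Sum>l<N. \<gamma> s $$ (i, l) * cnj (\<gamma> s $$ (j, l))) has_vector_derivative
        (\<Sum>l<N. \<gamma> 0 $$ (i, l) * cnj (X $$ (j, l)) + X $$ (i, l) * cnj (\<gamma> 0 $$ (j, l)))) (at 0)"
      using ij by (intro has_vector_derivative_sum has_vector_derivative_mult cnj_d d) auto
    moreover have "((\<lambda>s. \<Sum>l<N. \<gamma> s $$ (i, l) * cnj (\<gamma> s $$ (j, l))) has_vector_derivative 0) (at 0)"
      unfolding SpD(4)[OF \<gamma>(1) ij] by (rule has_vector_derivative_const)
    ultimately have "(\<Sum>l<N. \<gamma> 0 $$ (i, l) * cnj (X $$ (j, l)) + X $$ (i, l) * cnj (\<gamma> 0 $$ (j, l))) = 0"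
      by (rule vector_derivative_unique_at)
    moreover have "(\<Sum>l<N. \<gamma> 0 $$ (i, l) * cnj (X $$ (j, l)) + X $$ (i, l) * cnj (\<gamma> 0 $$ (j, l))) =
        (\<Sum>l<N. (if l = i then cnj (X $$ (j, l)) else 0) + (if l = j then X $$ (i, l) else 0))"
      using ij by (intro sum.cong) (auto simp: \<gamma>(2))
    ultimately have "cnj (X $$ (j, i)) + X $$ (i, j) = 0" using ij by (simp add: sum.distrib)
    then have "cnj (cnj (X $$ (j, i)) + X $$ (i, j)) = 0" by simp
    then show "X $$ (j, i) = - cnj (X $$ (i, j))" by (simp add: eq_neg_iff_add_eq_0)
  qed
qed

text \<open>Rescaling time realizes scalar multiples and the pointwise product of two curves
  realizes sums. Hence spanning velocities suffice for the converse inclusion.\<close>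

lemma real_subspace_lie_algebra:
  assumes E: "block_relation E"
  shows "real_subspace N (lie_algebra N (Sp E))"
  unfolding real_subspace_def
proof (intro conjI ballI allI)
  show "lie_algebra N (Sp E) \<subseteq> carrier_mat N N" unfolding lie_algebra_def by blast
  show "0\<^sub>m N N \<in> lie_algebra N (Sp E)"
    unfolding lie_algebra_def mem_Collect_eq
    by (intro conjI exI[of _ "\<lambda>_. 1\<^sub>m N"]) (auto simp: Sp_one[OF E])
  fix X assume "X \<in> lie_algebra N (Sp E)"
  then obtain \<gamma> :: "real \<Rightarrow> complex mat" where X: "X \<in> carrier_mat N N"
    and \<gamma>: "\<And>t. \<gamma> t \<in> Sp E" "\<gamma> 0 = 1\<^sub>m N"
    and diff: "\<And>i j t. i < N \<Longrightarrow> j < N \<Longrightarrow> (\<lambda>s. \<gamma> s $$ (i, j)) differentiable (at t)"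
    and d: "\<And>i j. i < N \<Longrightarrow> j < N \<Longrightarrow> ((\<lambda>s. \<gamma> s $$ (i, j)) has_vector_derivative X $$ (i, j)) (at 0)"
    unfolding lie_algebra_def by blast
  show "real_smult c X \<in> lie_algebra N (Sp E)" for c
    unfolding lie_algebra_def mem_Collect_eq
  proof (intro conjI exI[of _ "\<lambda>t. \<gamma> (c * t)"] allI impI)
    show "real_smult c X \<in> carrier_mat N N" using X by simp
    show "\<gamma> (c * t) \<in> Sp E" for t by (rule \<gamma>(1))
    show "\<gamma> (c * 0) = 1\<^sub>m N" by (simp add: \<gamma>(2))
    fix i j assume ij: "i < N" "j < N"
    have lin: "((\<lambda>t. c * t) has_vector_derivative c) (at t)" for t :: real
      by (auto intro!: derivative_eq_intros)
    show "(\<lambda>s. \<gamma> (c * s) $$ (i, j)) differentiable (at t)" for t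
      using differentiable_chain_at[of "\<lambda>t. c * t" t "\<lambda>s. \<gamma> s $$ (i, j)"] diff[OF ij] by (simp add: o_def)
    have "((\<lambda>s. \<gamma> s $$ (i, j)) \<circ> (\<lambda>t. c * t) has_vector_derivative c *\<^sub>R X $$ (i, j)) (at 0)"
      by (rule vector_diff_chain_at[OF lin]) (simp add: d[OF ij])
    then show "((\<lambda>s. \<gamma> (c * s) $$ (i, j)) has_vector_derivative real_smult c X $$ (i, j)) (at 0)"
      using ij X by (simp add: o_def scaleR_conv_of_real)
  qed
  fix Y assume "Y \<in> lie_algebra N (Sp E)"
  then obtain \<eta> :: "real \<Rightarrow> complex mat" where Y: "Y \<in> carrier_mat N N"
    and \<eta>: "\<And>t. \<eta> t \<in> Sp E" "\<eta> 0 = 1\<^sub>m N"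
    and diff': "\<And>i j t. i < N \<Longrightarrow> j < N \<Longrightarrow> (\<lambda>s. \<eta> s $$ (i, j)) differentiable (at t)"
    and d': "\<And>i j. i < N \<Longrightarrow> j < N \<Longrightarrow> ((\<lambda>s. \<eta> s $$ (i, j)) has_vector_derivative Y $$ (i, j)) (at 0)"
    unfolding lie_algebra_def by blast
  show "X + Y \<in> lie_algebra N (Sp E)"
    unfolding lie_algebra_def mem_Collect_eq
  proof (intro conjI exI[of _ "\<lambda>t. \<gamma> t * \<eta> t"] allI impI)
    show "X + Y \<in> carrier_mat N N" using X Y by simp
    show "\<gamma> t * \<eta> t \<in> Sp E" for t by (intro Sp_mult E \<gamma> \<eta>)
    show "\<gamma> 0 * \<eta> 0 = 1\<^sub>m N" by (simp add: \<gamma>(2) \<eta>(2))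
    fix i j assume ij: "i < N" "j < N"
    have prod: "(\<lambda>s. (\<gamma> s * \<eta> s) $$ (i, j)) = (\<lambda>s. \<Sum>l<N. \<gamma> s $$ (i, l) * \<eta> s $$ (l, j))"
      using mult_entry[OF SpD(1)[OF \<gamma>(1)] SpD(1)[OF \<eta>(1)] ij] by (rule ext)
    show "(\<lambda>s. (\<gamma> s * \<eta> s) $$ (i, j)) differentiable (at t)" for t
      unfolding prod using ij by (intro differentiable_sum ballI differentiable_mult[OF diff diff']) auto
    have "((\<lambda>s. \<Sum>l<N. \<gamma> s $$ (i, l) * \<eta> s $$ (l, j)) has_vector_derivative
        (\<Sum>l<N. \<gamma> 0 $$ (i, l) * Y $$ (l, j) + X $$ (i, l) * \<eta> 0 $$ (l, j))) (at 0)"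
      using ij by (intro has_vector_derivative_sum has_vector_derivative_mult d d') auto
    also have "(\<Sum>l<N. \<gamma> 0 $$ (i, l) * Y $$ (l, j) + X $$ (i, l) * \<eta> 0 $$ (l, j)) =
        (\<Sum>l<N. (if l = i then Y $$ (l, j) else 0) + (if l = j then X $$ (i, l) else 0))"
      using ij by (intro sum.cong) (auto simp: \<gamma>(2) \<eta>(2))
    also have "\<dots> = (X + Y) $$ (i, j)" using ij X Y by (simp add: sum.distrib)
    finally show "((\<lambda>s. (\<gamma> s * \<eta> s) $$ (i, j)) has_vector_derivative (X + Y) $$ (i, j)) (at 0)"
      unfolding prod .
  qed
qed

text \<open>
  A skew-Hermitian monomial matrix, with entry \<open>c p\<close> at \<open>(p, \<pi> p)\<close>, \<open>\<pi>\<close> an involution and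
  \<open>cmod (c p) \<in> {0, 1}\<close>, is the velocity at the identity of a one-parameter group of rotations.
\<close>

definition skew_monomial :: "(nat \<Rightarrow> nat \<Rightarrow> bool) \<Rightarrow> (nat \<Rightarrow> nat) \<Rightarrow> (nat \<Rightarrow> complex) \<Rightarrow> bool" where
  "skew_monomial E \<pi> c \<longleftrightarrow> (\<forall>p<N. \<pi> p < N \<and> \<pi> (\<pi> p) = p \<and> \<pi> (\<sigma> p) = \<sigma> (\<pi> p) \<and> E p (\<pi> p) \<and>
     c (\<pi> p) = - cnj (c p) \<and> (c p = 0 \<or> cmod (c p) = 1) \<and> (c p = 0 \<longrightarrow> \<pi> p = p) \<and>
     c (\<sigma> p) = \<epsilon> p * \<epsilon> (\<pi> p) * cnj (c p))"

text \<open>The exponential of \<open>t\<close> times the monomial matrix in closed form: that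
  matrix squares to \<open>-1\<close> on the rows with \<open>c p \<noteq> 0\<close> and vanishes on
  the others, where the rotation is the identity.\<close>

definition rotation :: "(nat \<Rightarrow> nat) \<Rightarrow> (nat \<Rightarrow> complex) \<Rightarrow> real \<Rightarrow> complex mat" where
  "rotation \<pi> c t = mat N N (\<lambda>(p, q). (if p = q then (if c p = 0 then 1 else of_real (cos t)) else 0)
     + (if q = \<pi> p then of_real (sin t) * c p else 0))"

lemma rotation_carrier [simp]: "rotation \<pi> c t \<in> carrier_mat N N"
  by (simp add: rotation_def)

lemma rotation_entry:
  "p < N \<Longrightarrow> q < N \<Longrightarrow> rotation \<pi> c t $$ (p, q) =
     (if p = q then (if c p = 0 then 1 else of_real (cos t)) else 0) + (if q = \<pi> p then of_real (sin t) * c p else 0)"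
  by (simp add: rotation_def)

lemma rotation_in_Sp:
  assumes E: "block_relation E" and sm: "skew_monomial E \<pi> c"
  shows "rotation \<pi> c t \<in> Sp E"
proof (rule SpI)
  fix p q assume pq: "p < N" "q < N"
  note P = sm[unfolded skew_monomial_def, rule_format, OF pq(1)]
    and Q = sm[unfolded skew_monomial_def, rule_format, OF pq(2)]
  define a where "a = (\<lambda>p. if c p = 0 then 1 else complex_of_real (cos t))"
  define s where "s = complex_of_real (sin t)"
  have ent: "rotation \<pi> c t $$ (p, q) = (if p = q then a p else 0) + (if q = \<pi> p then s * c p else 0)"
    if "p < N" "q < N" for p q using that by (simp add: rotation_entry a_def s_def)
  have cnj_as: "cnj (a p) = a p" "cnj s = s" for p by (simp_all add: a_def s_def)
  have a_\<sigma>: "a (\<sigma> p) = a p" "a (\<pi> q) = a q" "a (\<sigma> q) = a q"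
    using P Q \<epsilon>_nonzero[OF pq(1)] \<epsilon>_nonzero[of "\<pi> p"] \<epsilon>_nonzero[OF pq(2)] \<epsilon>_nonzero[of "\<pi> q"] by (simp_all add: a_def)
  have \<sigma>q: "\<sigma> q = \<pi> (\<sigma> p) \<longleftrightarrow> q = \<pi> p" using P pq by simp
  show "rotation \<pi> c t $$ (\<sigma> p, \<sigma> q) = \<epsilon> p * \<epsilon> q * cnj (rotation \<pi> c t $$ (p, q))"
  proof -
    have "rotation \<pi> c t $$ (\<sigma> p, \<sigma> q) = (if p = q then a p else 0) + (if q = \<pi> p then s * (\<epsilon> p * \<epsilon> q * cnj (c p)) else 0)"
      using P pq by (simp add: ent a_\<sigma> \<sigma>q del: \<epsilon>_sq')
    also have "\<dots> = \<epsilon> p * \<epsilon> q * cnj (rotation \<pi> c t $$ (p, q))"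
      using pq by (simp add: ent cnj_as algebra_simps)
    finally show ?thesis .
  qed
  show "rotation \<pi> c t $$ (p, q) = 0" if "\<not> E p q"
    using that P block_relationD(1)[OF E pq(1)] pq by (auto simp: rotation_entry)
  have "(\<Sum>l<N. rotation \<pi> c t $$ (p, l) * cnj (rotation \<pi> c t $$ (q, l))) =
      (\<Sum>l<N. (if l = p then a p * cnj (rotation \<pi> c t $$ (q, l)) else 0)
        + (if l = \<pi> p then s * c p * cnj (rotation \<pi> c t $$ (q, l)) else 0))"
    using pq by (intro sum.cong refl) (simp add: ent[of p] distrib_right)
  also have "\<dots> = a p * cnj (rotation \<pi> c t $$ (q, p)) + s * c p * cnj (rotation \<pi> c t $$ (q, \<pi> p))"
    using pq P by (simp add: sum.distrib)
  also have "\<dots> = (if p = q then 1 else 0)"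
  proof -
    have sq: "a p * a p + s * s * (c p * cnj (c p)) = 1"
    proof (cases "c p = 0")
      case False
      then have "c p * cnj (c p) = 1" using P by (simp add: complex_norm_square[symmetric])
      moreover have "complex_of_real (cos t) * of_real (cos t) + of_real (sin t) * of_real (sin t) = of_real 1"
        unfolding of_real_mult[symmetric] of_real_add[symmetric]
        by (metis power2_eq_square sin_cos_squared_add2)
      ultimately show ?thesis using False by (simp add: a_def s_def)
    qed (simp add: a_def)
    have \<pi>q: "\<pi> p = \<pi> q \<longleftrightarrow> p = q" "\<pi> p = q \<longleftrightarrow> p = \<pi> q" using P Q by metis+
    have "a p * cnj (rotation \<pi> c t $$ (q, p)) + s * c p * cnj (rotation \<pi> c t $$ (q, \<pi> p)) =
        (if p = q then a p * a p + s * s * (c p * cnj (c p)) else 0) + (if p = \<pi> q then s * (a p * cnj (c q) + c p * a q) else 0)"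
      using pq P by (simp add: ent cnj_as \<pi>q eq_commute[of q] algebra_simps)
    moreover have "(if p = \<pi> q then s * (a p * cnj (c q) + c p * a q) else 0) = 0"
    \<comment> \<open>The inner product of two rows paired by \<open>\<pi>\<close> vanishes since
      \<open>c (\<pi> q) = - cnj (c q)\<close>.\<close>
    proof (cases "p = \<pi> q")
      case True
      have "a p * cnj (c q) + c p * a q = 0"
        using True Q a_\<sigma>(2) by (simp add: algebra_simps)
      then show ?thesis unfolding if_P[OF True] by (simp only: mult_zero_right)
    qed simp
    ultimately show ?thesis unfolding sq by simp
  qed
  finally show "(\<Sum>l<N. rotation \<pi> c t $$ (p, l) * cnj (rotation \<pi> c t $$ (q, l))) = (if p = q then 1 else 0)" .
qed simp

definition monomial_mat :: "(nat \<Rightarrow> nat) \<Rightarrow> (nat \<Rightarrow> complex) \<Rightarrow> complex mat" where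
  "monomial_mat \<pi> c = mat N N (\<lambda>(p, q). if q = \<pi> p then c p else 0)"

lemma monomial_in_lie_algebra:
  assumes E: "block_relation E" and sm: "skew_monomial E \<pi> c"
  shows "monomial_mat \<pi> c \<in> lie_algebra N (Sp E)"
  unfolding lie_algebra_def mem_Collect_eq
proof (intro conjI exI[of _ "rotation \<pi> c"] allI impI)
  show "monomial_mat \<pi> c \<in> carrier_mat N N" by (simp add: monomial_mat_def)
  show "rotation \<pi> c t \<in> Sp E" for t by (rule rotation_in_Sp[OF E sm])
  show "rotation \<pi> c 0 = 1\<^sub>m N" by (rule square_eqI[of _ N]) (auto simp: rotation_entry)
  fix p q assume pq: "p < N" "q < N"
  have d: "((\<lambda>s. rotation \<pi> c s $$ (p, q)) has_vector_derivative
      (if p = q then (if c p = 0 then 0 else of_real (- sin t)) else 0) + (if q = \<pi> p then of_real (cos t) * c p else 0)) (at t)" for t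
  proof -
    have "((\<lambda>s. complex_of_real (cos s)) has_vector_derivative of_real (- sin t)) (at t)"
      "((\<lambda>s. complex_of_real (sin s)) has_vector_derivative of_real (cos t)) (at t)"
      by (intro has_vector_derivative_of_real DERIV_cos DERIV_sin)+
    then show ?thesis
      unfolding rotation_entry[OF pq]
      by (intro has_vector_derivative_add) (auto intro: has_vector_derivative_mult_left)
  qed
  from d show "(\<lambda>s. rotation \<pi> c s $$ (p, q)) differentiable (at t)" for t
    unfolding has_vector_derivative_def differentiable_def by blast
  have "(if p = q then (if c p = 0 then 0 else complex_of_real (- sin 0)) else 0) + (if q = \<pi> p then of_real (cos 0) * c p else 0) =
      monomial_mat \<pi> c $$ (p, q)"
    using pq by (simp add: monomial_mat_def)
  with d[of 0] show "((\<lambda>s. rotation \<pi> c s $$ (p, q)) has_vector_derivative monomial_mat \<pi> c $$ (p, q)) (at 0)"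
    by (simp only:)
qed

text \<open>With \<open>four_coeff\<close> this presents \<open>four_unit i j u\<close> for
  unimodular \<open>u\<close>, up to a real factor, as a monomial matrix. In the degenerate cases
  \<open>j = i\<close> and \<open>j = \<sigma> i\<close> the first matching branch decides; for
  \<open>j = i\<close> the entry must be imaginary, which is why \<open>u = \<i>\<close> is demanded
  there.\<close>

definition four_perm :: "nat \<Rightarrow> nat \<Rightarrow> nat \<Rightarrow> nat" where
  "four_perm i j p = (if p = i then j else if p = j then i else if p = \<sigma> i then \<sigma> j else if p = \<sigma> j then \<sigma> i else p)"

definition four_coeff :: "nat \<Rightarrow> nat \<Rightarrow> complex \<Rightarrow> nat \<Rightarrow> complex" where
  "four_coeff i j u p = (if p = i then u else if p = j then - cnj u else if p = \<sigma> i then \<epsilon> i * \<epsilon> j * cnj u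
     else if p = \<sigma> j then - (\<epsilon> i * \<epsilon> j * u) else 0)"

lemma cmod_\<epsilon> [simp]:
  assumes "i < N"
  shows "cmod (\<epsilon> i) = 1"
proof -
  have "(cmod (\<epsilon> i))^2 = 1"
    using arg_cong[OF \<epsilon>_sq[OF assms], of cmod] by (simp only: norm_mult power2_eq_square norm_one)
  then show ?thesis using norm_ge_zero[of "\<epsilon> i"] by (auto simp: power2_eq_1_iff)
qed

lemma skew_monomial_four:
  assumes E: "block_relation E" and ij: "i < N" "j < N" "E i j"
    and u: "cmod u = 1" "i = j \<Longrightarrow> u = \<i>"
  shows "skew_monomial E (four_perm i j) (four_coeff i j u)"
proof -
  have Eij: "E j i" "E (\<sigma> i) (\<sigma> j)" "E (\<sigma> j) (\<sigma> i)"
    using E ij block_relationD(3) block_relation_\<sigma> by (metis \<sigma>_less)+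
  have refl: "E p p" if "p < N" for p using that block_relationD(1)[OF E] by blast
  have un: "cmod (\<epsilon> i) = 1" "cmod (\<epsilon> j) = 1" "u \<noteq> 0" "\<epsilon> i \<noteq> 0" "\<epsilon> j \<noteq> 0"
    using u \<epsilon>_nonzero ij by auto
  consider "i = j" | "j = \<sigma> i" | "j \<noteq> i" "i \<noteq> j" "j \<noteq> \<sigma> i" "\<sigma> i \<noteq> j" "i \<noteq> \<sigma> j" "\<sigma> j \<noteq> i"
    using ij by (metis \<sigma>_\<sigma>)
  then show ?thesis
  proof cases
    case 1
    have \<pi>: "four_perm i j p = p" for p unfolding four_perm_def 1 by simp
    have c: "four_coeff i j u p = (if p = i then \<i> else if p = \<sigma> i then - \<i> else 0)" for p
      using ij u(2) unfolding four_coeff_def 1[symmetric] by (simp add: 1)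
    have "\<sigma> p = i \<longleftrightarrow> p = \<sigma> i" if "p < N" for p using \<sigma>_swap[OF that ij(1)] .
    then show ?thesis unfolding skew_monomial_def \<pi> c using refl ij by simp
  next
    case 2
    have \<pi>: "four_perm i j p = (if p = i then \<sigma> i else if p = \<sigma> i then i else p)" for p
      unfolding four_perm_def 2 using ij by simp
    have c: "four_coeff i j u p = (if p = i then u else if p = \<sigma> i then - cnj u else 0)" for p
      using ij unfolding four_coeff_def 2 by simp
    have sw: "\<sigma> p = i \<longleftrightarrow> p = \<sigma> i" if "p < N" for p using \<sigma>_swap[OF that ij(1)] .
    show ?thesis
      unfolding skew_monomial_def
    proof (intro allI impI)
      fix p assume p: "p < N"
      consider "p = i" | "p = \<sigma> i" | "p \<noteq> i" "p \<noteq> \<sigma> i" by blast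
      then show "four_perm i j p < N \<and> four_perm i j (four_perm i j p) = p \<and> four_perm i j (\<sigma> p) = \<sigma> (four_perm i j p) \<and>
        E p (four_perm i j p) \<and> four_coeff i j u (four_perm i j p) = - cnj (four_coeff i j u p) \<and>
        (four_coeff i j u p = 0 \<or> cmod (four_coeff i j u p) = 1) \<and> (four_coeff i j u p = 0 \<longrightarrow> four_perm i j p = p) \<and>
        four_coeff i j u (\<sigma> p) = \<epsilon> p * \<epsilon> (four_perm i j p) * cnj (four_coeff i j u p)"
      proof cases
        case 1
        then show ?thesis unfolding \<pi> c using ij u(1) un 2 by simp
      next
        case p\<sigma>: 2
        then show ?thesis unfolding \<pi> c using ij u(1) un Eij 2 by simp
      next
        case 3
        then show ?thesis unfolding \<pi> c using refl p sw[OF p] ij by simp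
      qed
    qed
  next
    case 3
    have sw: "\<sigma> p = i \<longleftrightarrow> p = \<sigma> i" "\<sigma> p = j \<longleftrightarrow> p = \<sigma> j" if "p < N" for p
      using \<sigma>_swap[OF that ij(1)] \<sigma>_swap[OF that ij(2)] .
    show ?thesis
      unfolding skew_monomial_def
    proof (intro allI impI)
      fix p assume p: "p < N"
      consider "p = i" | "p = j" | "p = \<sigma> i" | "p = \<sigma> j" | "p \<noteq> i" "p \<noteq> j" "p \<noteq> \<sigma> i" "p \<noteq> \<sigma> j" by blast
      then show "four_perm i j p < N \<and> four_perm i j (four_perm i j p) = p \<and> four_perm i j (\<sigma> p) = \<sigma> (four_perm i j p) \<and>
        E p (four_perm i j p) \<and> four_coeff i j u (four_perm i j p) = - cnj (four_coeff i j u p) \<and>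
        (four_coeff i j u p = 0 \<or> cmod (four_coeff i j u p) = 1) \<and> (four_coeff i j u p = 0 \<longrightarrow> four_perm i j p = p) \<and>
        four_coeff i j u (\<sigma> p) = \<epsilon> p * \<epsilon> (four_perm i j p) * cnj (four_coeff i j u p)"
      proof cases
        case 1
        then show ?thesis unfolding four_perm_def four_coeff_def using ij u(1) un 3 Eij by (simp add: norm_mult)
      next
        case 2
        then show ?thesis unfolding four_perm_def four_coeff_def using ij u(1) un 3 Eij by (simp add: norm_mult mult.commute[of "\<epsilon> j"])
      next
        case p3: 3
        then show ?thesis unfolding four_perm_def four_coeff_def using ij u(1) un 3 Eij by (simp add: norm_mult algebra_simps)
      next
        case 4
        then show ?thesis unfolding four_perm_def four_coeff_def using ij u(1) un 3 Eij by (simp add: norm_mult algebra_simps)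
      next
        case 5
        then show ?thesis unfolding four_perm_def four_coeff_def using refl p sw[OF p] 3 ij by simp
      qed
    qed
  qed
qed

text \<open>The real factor \<open>r\<close> is \<open>cmod z\<close> in general,
  \<open>2 * cmod z\<close> for \<open>j = \<sigma> i\<close>, where positions of the orbit coincide
  in pairs, and \<open>2 * Im z\<close> for \<open>j = i\<close>, where only the imaginary part
  survives. For \<open>z = 0\<close> the unimodular entry defaults to 1 off the diagonal
  case.\<close>

lemma four_unit_monomial:
  assumes ij: "i < N" "j < N"
  obtains r u where "cmod u = 1" "i = j \<Longrightarrow> u = \<i>"
    "four_unit i j z = real_smult r (monomial_mat (four_perm i j) (four_coeff i j u))"
proof -
  define v where "v = (if z = 0 then 1 else sgn z)"
  define r where "r = cmod z"
  have v: "cmod v = 1" "z = of_real r * v"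
    by (simp add: v_def norm_sgn, simp add: v_def r_def sgn_div_norm scaleR_conv_of_real)
  have cz: "cnj z = of_real r * cnj v" using arg_cong[OF v(2), of cnj] by simp
  have mono: "real_smult r (monomial_mat \<pi> c) $$ (p, q) = of_real r * (if q = \<pi> p then c p else 0)"
    if "p < N" "q < N" for r \<pi> c p q using that by (simp add: monomial_mat_def)
  consider "i = j" | "j = \<sigma> i" | "j \<noteq> i" "i \<noteq> j" "j \<noteq> \<sigma> i" "\<sigma> i \<noteq> j" "i \<noteq> \<sigma> j" "\<sigma> j \<noteq> i"
    using ij by (metis \<sigma>_\<sigma>)
  then show thesis
  proof cases
    case 1
    show thesis
    proof (rule that[of \<i> "2 * Im z"])
      show "four_unit i j z = real_smult (2 * Im z) (monomial_mat (four_perm i j) (four_coeff i j \<i>))"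
      proof (rule square_eqI[of _ N])
        fix p q assume pq: "p < N" "q < N"
        have s: "i = \<sigma> q \<longleftrightarrow> q = \<sigma> i" "i = \<sigma> p \<longleftrightarrow> p = \<sigma> i" using pq ij by auto
        have z: "z - cnj z = of_real (2 * Im z) * \<i>" by (simp add: complex_eq_iff)
        show "four_unit i j z $$ (p, q) = real_smult (2 * Im z) (monomial_mat (four_perm i j) (four_coeff i j \<i>)) $$ (p, q)"
        proof (cases "p = q")
          case False
          then have ne: "\<not> (i = p \<and> i = q)" "\<not> (i = q \<and> i = p)" "\<not> (i = \<sigma> p \<and> i = \<sigma> q)" "\<not> (i = \<sigma> q \<and> i = \<sigma> p)"
            using pq by (metis \<sigma>_\<sigma>)+
          have "four_unit i j z $$ (p, q) = 0"
            unfolding four_unit_entry[OF pq] 1[symmetric] by (simp only: ne if_False diff_self add_0_left)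
          moreover have "four_perm i j p = p" unfolding four_perm_def 1[symmetric] by simp
          ultimately show ?thesis using False unfolding mono[OF pq] by simp
        next
          case True
          have s': "i = p \<longleftrightarrow> p = i" by auto
          have e: "\<epsilon> i * \<epsilon> i = 1" using ij by simp
          have pp: "four_unit i j z $$ (p, q) = (if p = i then z - cnj z else 0) + (if p = \<sigma> i then cnj z - z else 0)"
            unfolding four_unit_entry[OF pq] unfolding 1[symmetric] True[symmetric] s(2) s' conj_absorb e by simp
          have "real_smult (2 * Im z) (monomial_mat (four_perm i j) (four_coeff i j \<i>)) $$ (p, q) =
              of_real (2 * Im z) * (if p = i then \<i> else if p = \<sigma> i then - \<i> else 0)"
            unfolding mono[OF pq] unfolding 1[symmetric] four_perm_def four_coeff_def True[symmetric] e by simp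
          also have "\<dots> = (if p = i then z - cnj z else 0) + (if p = \<sigma> i then cnj z - z else 0)"
          proof -
            have "cnj z - z = - (of_real (2 * Im z) * \<i>)" using z by (simp add: algebra_simps)
            moreover have "p = i \<Longrightarrow> p \<noteq> \<sigma> i" using ij by simp
            ultimately show ?thesis unfolding z by (cases "p = i"; cases "p = \<sigma> i") simp_all
          qed
          finally show ?thesis unfolding pp ..
        qed
      qed (simp_all add: monomial_mat_def)
    qed auto
  next
    case 2
    show thesis
    proof (rule that[of v "2 * r"])
      show "four_unit i j z = real_smult (2 * r) (monomial_mat (four_perm i j) (four_coeff i j v))"
      proof (rule square_eqI[of _ N])
        fix p q assume pq: "p < N" "q < N"
        have s: "i = \<sigma> q \<longleftrightarrow> q = \<sigma> i" "i = \<sigma> p \<longleftrightarrow> p = \<sigma> i" "\<sigma> i = \<sigma> q \<longleftrightarrow> i = q" "\<sigma> i = \<sigma> p \<longleftrightarrow> i = p"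
          "\<sigma> i = q \<longleftrightarrow> q = \<sigma> i" "\<sigma> i = p \<longleftrightarrow> p = \<sigma> i" "i = p \<longleftrightarrow> p = i" "i = q \<longleftrightarrow> q = i"
          using pq ij by auto
        have e: "\<epsilon> i * \<epsilon> (\<sigma> i) = - 1" using ij by simp
        have gen: "(if A then z else 0) - (if B then w else 0) + (if B then - 1 * w else 0) - (if A then - 1 * z else 0) =
            (if A then 2 * z else 0) - (if B then 2 * w else 0)" for A B and z w :: complex
          by simp
        have "four_unit i j z $$ (p, q) = (if p = i \<and> q = \<sigma> i then 2 * z else 0) - (if p = \<sigma> i \<and> q = i then 2 * cnj z else 0)"
          unfolding four_unit_entry[OF pq]
          unfolding 2 s e conj_commute[of "q = \<sigma> i" "p = i"] conj_commute[of "q = i" "p = \<sigma> i"]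
          by (rule gen)
        also have "\<dots> = of_real (2 * r) * ((if p = i \<and> q = \<sigma> i then v else 0) - (if p = \<sigma> i \<and> q = i then cnj v else 0))"
        proof -
          have gen: "(if A then 2 * (x * v) else 0) - (if B then 2 * (x * w) else 0) = (2 * x) * ((if A then v else 0) - (if B then w else 0))"
            for A B and x v w :: complex by (simp add: algebra_simps)
          show ?thesis unfolding cz unfolding v(2) of_real_mult of_real_numeral by (rule gen)
        qed
        also have "\<dots> = real_smult (2 * r) (monomial_mat (four_perm i j) (four_coeff i j v)) $$ (p, q)"
        proof (cases "p = i \<or> p = \<sigma> i")
          case True
          then show ?thesis unfolding mono[OF pq] four_perm_def four_coeff_def 2 using ij by auto
        next
          case False
          then show ?thesis unfolding mono[OF pq] four_perm_def four_coeff_def 2 using ij by simp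
        qed
        finally show "four_unit i j z $$ (p, q) = real_smult (2 * r) (monomial_mat (four_perm i j) (four_coeff i j v)) $$ (p, q)" .
      qed (simp_all add: monomial_mat_def)
      show "i = j \<Longrightarrow> v = \<i>" using 2 ij by simp
    qed (rule v)
  next
    case 3
    show thesis
    proof (rule that[of v r])
      show "four_unit i j z = real_smult r (monomial_mat (four_perm i j) (four_coeff i j v))"
      proof (rule square_eqI[of _ N])
        fix p q assume pq: "p < N" "q < N"
        have s: "i = \<sigma> q \<longleftrightarrow> q = \<sigma> i" "i = \<sigma> p \<longleftrightarrow> p = \<sigma> i" "j = \<sigma> q \<longleftrightarrow> q = \<sigma> j" "j = \<sigma> p \<longleftrightarrow> p = \<sigma> j"
          "i = p \<longleftrightarrow> p = i" "i = q \<longleftrightarrow> q = i" "j = p \<longleftrightarrow> p = j" "j = q \<longleftrightarrow> q = j"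
          using pq ij by auto
        have gen: "(if A then x * v else 0) - (if B then x * w else 0) + (if C then e * (x * w) else 0) - (if D then e * (x * v) else 0) =
            x * ((if A then v else 0) - (if B then w else 0) + (if C then e * w else 0) - (if D then e * v else 0))"
          for A B C D and x v w e :: complex by (simp add: algebra_simps)
        have d: "i \<noteq> \<sigma> i" "\<sigma> i \<noteq> i" "j \<noteq> \<sigma> j" "\<sigma> j \<noteq> j" "\<sigma> i \<noteq> \<sigma> j" "\<sigma> j \<noteq> \<sigma> i" using ij 3 by auto
        have "four_unit i j z $$ (p, q) = of_real r * (
          (if p = i \<and> q = j then v else 0) - (if q = i \<and> p = j then cnj v else 0)
          + (if p = \<sigma> i \<and> q = \<sigma> j then \<epsilon> i * \<epsilon> j * cnj v else 0) - (if q = \<sigma> i \<and> p = \<sigma> j then \<epsilon> i * \<epsilon> j * v else 0))"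
          unfolding four_unit_entry[OF pq] unfolding s cz unfolding v(2) by (rule gen)
        also have "\<dots> = real_smult r (monomial_mat (four_perm i j) (four_coeff i j v)) $$ (p, q)"
        proof -
          consider "p = i" | "p = j" | "p = \<sigma> i" | "p = \<sigma> j" | "p \<noteq> i" "p \<noteq> j" "p \<noteq> \<sigma> i" "p \<noteq> \<sigma> j" by blast
          then show ?thesis
            unfolding mono[OF pq] four_perm_def four_coeff_def
            by cases (use 3 d in simp_all)
        qed
        finally show "four_unit i j z $$ (p, q) = real_smult r (monomial_mat (four_perm i j) (four_coeff i j v)) $$ (p, q)" .
      qed (simp_all add: monomial_mat_def)
      show "i = j \<Longrightarrow> v = \<i>" using 3 by simp
    qed (rule v)
  qed
qed

text \<open>The nontrivial inclusion holds because \<open>sp E\<close> is spanned by the entry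
  projections, each zero or a real multiple of a monomial matrix that is the velocity of a rotation
  group.\<close>

theorem lie_algebra_Sp:
  assumes E: "block_relation E"
  shows "lie_algebra N (Sp E) = sp E"
proof
  show "lie_algebra N (Sp E) \<subseteq> sp E" by (rule lie_algebra_Sp_subset)
  note L = real_subspace_lie_algebra[OF E]
  show "sp E \<subseteq> lie_algebra N (Sp E)"
  proof
    fix X assume X: "X \<in> sp E"
    have "entry_projection E i j z \<in> lie_algebra N (Sp E)" if ij: "i < N" "j < N" for i j z
    proof (cases "E i j")
      case True
      have "four_unit i j z \<in> lie_algebra N (Sp E)"
      proof (rule four_unit_monomial[OF ij, where z = z])
        fix r u assume u: "cmod u = 1" "i = j \<Longrightarrow> u = \<i>"
          and F: "four_unit i j z = real_smult r (monomial_mat (four_perm i j) (four_coeff i j u))"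
        show ?thesis
          unfolding F by (intro real_subspaceD(4)[OF L] monomial_in_lie_algebra[OF E] skew_monomial_four[OF E ij True] u)
      qed
      then show ?thesis using True by (simp add: entry_projection_def real_subspaceD(4)[OF L])
    qed (simp add: entry_projection_def real_subspaceD(2)[OF L])
    then show "X \<in> lie_algebra N (Sp E)"
      by (subst sp_decomposition[OF X], intro real_subspace_matrix_sum[OF L]) auto
  qed
qed

end


section \<open>The spaces \<open>Sp(3k)/Sp(k)\<^sup>3\<close>\<close>

context symplectic_form begin

text \<open>Supports compose along paths: a nonzero product entry at \<open>(i, j)\<close> needs an
  intermediate \<open>l\<close> with both factors nonzero.\<close>

lemma lie_bracket_sp:
  assumes X: "X \<in> sp E" and Y: "Y \<in> sp E'"
    and S: "\<And>i l j. i < N \<Longrightarrow> l < N \<Longrightarrow> j < N \<Longrightarrow> E i l \<Longrightarrow> E' l j \<Longrightarrow> E'' i j"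
      "\<And>i l j. i < N \<Longrightarrow> l < N \<Longrightarrow> j < N \<Longrightarrow> E' i l \<Longrightarrow> E l j \<Longrightarrow> E'' i j"
  shows "lie_bracket X Y \<in> sp E''"
proof (rule spI)
  note B = lie_bracket_quaternionic[OF X Y]
  show "lie_bracket X Y \<in> carrier_mat N N" by (rule spD(1)[OF B])
  fix i j assume ij: "i < N" "j < N"
  show "lie_bracket X Y $$ (\<sigma> i, \<sigma> j) = \<epsilon> i * \<epsilon> j * cnj (lie_bracket X Y $$ (i, j))" by (rule spD(2)[OF B ij])
  show "lie_bracket X Y $$ (j, i) = - cnj (lie_bracket X Y $$ (i, j))" by (rule spD(4)[OF B ij])
  assume n: "\<not> E'' i j"
  have "X $$ (i, l) * Y $$ (l, j) = 0" if l: "l < N" for l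
    using S(1)[OF ij(1) l ij(2)] n spD(3)[OF X ij(1) l] spD(3)[OF Y l ij(2)] mult_zero_left mult_zero_right by metis
  moreover have "Y $$ (i, l) * X $$ (l, j) = 0" if l: "l < N" for l
    using S(2)[OF ij(1) l ij(2)] n spD(3)[OF Y ij(1) l] spD(3)[OF X l ij(2)] mult_zero_left mult_zero_right by metis
  ultimately show "lie_bracket X Y $$ (i, j) = 0"
    unfolding lie_bracket_entry[OF spD(1)[OF X] spD(1)[OF Y] ij] by (subst (1 2) sum.neutral) auto
qed

lemma frobenius_disjoint:
  assumes X: "X \<in> sp E" and Y: "Y \<in> sp E'" and E: "\<And>i j. i < N \<Longrightarrow> j < N \<Longrightarrow> E i j \<Longrightarrow> \<not> E' i j"
  shows "frobenius N X Y = 0"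
proof -
  have "Re (X $$ (i, j) * cnj (Y $$ (i, j))) = 0" if ij: "i < N" "j < N" for i j
    using E[OF ij] spD(3)[OF X ij] spD(3)[OF Y ij] by (cases "E i j") simp_all
  then show ?thesis by (simp add: frobenius_def)
qed

text \<open>For admissible \<open>E\<close> this is the orthogonal projection of the symplectic
  algebra onto \<open>sp E\<close>.\<close>

definition restrict_entries :: "(nat \<Rightarrow> nat \<Rightarrow> bool) \<Rightarrow> complex mat \<Rightarrow> complex mat" where
  "restrict_entries E X = mat N N (\<lambda>(i, j). if E i j then X $$ (i, j) else 0)"

lemma restrict_entries_entry [simp]:
  "i < N \<Longrightarrow> j < N \<Longrightarrow> restrict_entries E X $$ (i, j) = (if E i j then X $$ (i, j) else 0)"
  by (simp add: restrict_entries_def)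

lemma restrict_entries_sp:
  assumes X: "X \<in> sp E'" and E: "admissible E"
  shows "restrict_entries E X \<in> sp E"
proof (rule spI)
  show "restrict_entries E X \<in> carrier_mat N N" by (simp add: restrict_entries_def)
  fix i j assume ij: "i < N" "j < N"
  note A = E[unfolded admissible_def, rule_format]
  have "E (\<sigma> i) (\<sigma> j) \<longleftrightarrow> E i j" using A[OF ij] A[OF \<sigma>_less[OF ij(1)] \<sigma>_less[OF ij(2)]] ij by auto
  then show "restrict_entries E X $$ (\<sigma> i, \<sigma> j) = \<epsilon> i * \<epsilon> j * cnj (restrict_entries E X $$ (i, j))"
    using ij spD(2)[OF X ij] by simp
  have "E j i \<longleftrightarrow> E i j" using A[OF ij] A[OF ij(2,1)] by blast
  then show "restrict_entries E X $$ (j, i) = - cnj (restrict_entries E X $$ (i, j))"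
    using ij spD(4)[OF X ij] by simp
  show "restrict_entries E X $$ (i, j) = 0" if "\<not> E i j" using ij that by simp
qed

lemma frobenius_restrict: "frobenius N X (restrict_entries E X) = frobenius N (restrict_entries E X) (restrict_entries E X)"
  unfolding frobenius_def by (intro sum.cong refl) auto

definition row_norm :: "complex mat \<Rightarrow> nat \<Rightarrow> real" where
  "row_norm X i = (\<Sum>l<N. (cmod (X $$ (i, l)))^2)"

lemma row_norm_nonneg: "0 \<le> row_norm X i"
  by (simp add: row_norm_def sum_nonneg)

lemma frobenius_row_norm: "frobenius N X X = (\<Sum>i<N. row_norm X i)"
  by (simp add: frobenius_self row_norm_def)

lemma square_diagonal:
  assumes X: "X \<in> sp E" and i: "i < N"
  shows "Re ((X * X) $$ (i, i)) = - row_norm X i"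
  unfolding diagonal_product[OF X X i] row_norm_def
  by (simp add: Re_sum complex_mult_cnj cmod_power2 del: times_complex.sel)

lemma frobenius_ad_skew:
  assumes X: "X \<in> sp E" and Y: "Y \<in> sp E'" and Z: "Z \<in> sp E''"
  shows "frobenius N (lie_bracket X Y) Z = - frobenius N Y (lie_bracket X Z)"
proof -
  \<comment> \<open>This is the trace of \<open>A B C\<close>; its cyclic invariance is the
    invariance of the form.\<close>
  define t where "t = (\<lambda>A B C :: complex mat. \<Sum>i<N. \<Sum>j<N. \<Sum>l<N. A $$ (i, l) * B $$ (l, j) * C $$ (j, i))"
  have cyc: "t A B C = t B C A" for A B C
  proof -
    have "t A B C = (\<Sum>j<N. \<Sum>i<N. \<Sum>l<N. A $$ (i, l) * B $$ (l, j) * C $$ (j, i))"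
      unfolding t_def by (rule sum.swap)
    also have "\<dots> = (\<Sum>j<N. \<Sum>l<N. \<Sum>i<N. A $$ (i, l) * B $$ (l, j) * C $$ (j, i))"
      by (intro sum.cong refl sum.swap)
    also have "\<dots> = (\<Sum>l<N. \<Sum>j<N. \<Sum>i<N. B $$ (l, j) * C $$ (j, i) * A $$ (i, l))"
      by (subst sum.swap) (intro sum.cong refl, simp only: ac_simps)
    also have "\<dots> = (\<Sum>l<N. \<Sum>i<N. \<Sum>j<N. B $$ (l, j) * C $$ (j, i) * A $$ (i, l))"
      by (intro sum.cong refl sum.swap)
    finally show ?thesis unfolding t_def .
  qed
  have br: "frobenius N (lie_bracket A B) C = - Re (t A B C - t B A C)"
    if A: "A \<in> sp F" and B: "B \<in> sp F'" and C: "C \<in> sp F''" for A B C F F' F''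
  proof -
    have "frobenius N (lie_bracket A B) C = (\<Sum>i<N. \<Sum>j<N.
        - Re ((\<Sum>l<N. A $$ (i, l) * B $$ (l, j) * C $$ (j, i)) - (\<Sum>l<N. B $$ (i, l) * A $$ (l, j) * C $$ (j, i))))"
      unfolding frobenius_def
    proof (intro sum.cong refl)
      fix i j assume "i \<in> {..<N}" "j \<in> {..<N}"
      then have ij: "i < N" "j < N" by auto
      have c: "cnj (C $$ (i, j)) = - C $$ (j, i)" using spD(4)[OF C ij] by simp
      show "Re (lie_bracket A B $$ (i, j) * cnj (C $$ (i, j))) =
          - Re ((\<Sum>l<N. A $$ (i, l) * B $$ (l, j) * C $$ (j, i)) - (\<Sum>l<N. B $$ (i, l) * A $$ (l, j) * C $$ (j, i)))"
        unfolding c lie_bracket_entry[OF spD(1)[OF A] spD(1)[OF B] ij] sum_distrib_right[symmetric] left_diff_distrib[symmetric]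
        by simp
    qed
    then show ?thesis unfolding t_def by (simp add: Re_sum sum_negf sum_subtractf del: times_complex.sel)
  qed
  have "frobenius N (lie_bracket X Y) Z = - Re (t X Y Z - t Y X Z)" by (rule br[OF X Y Z])
  moreover have "frobenius N (lie_bracket X Z) Y = - Re (t X Z Y - t Z X Y)" by (rule br[OF X Z Y])
  moreover have "t X Z Y = t Y X Z" "t Z X Y = t X Y Z" using cyc by metis+
  ultimately show ?thesis using frobenius_commute[of N Y "lie_bracket X Z"] by simp
qed

lemma lie_bracket_swap:
  assumes "X \<in> carrier_mat N N" "Y \<in> carrier_mat N N"
  shows "lie_bracket X Y = real_smult (-1) (lie_bracket Y X)"
  using assms carrier_matD[OF lie_bracket_carrier[OF assms(2,1)]]
  by (intro square_eqI[of _ N]) (auto simp: lie_bracket_entry[OF assms] lie_bracket_entry[OF assms(2,1)])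

lemma lie_bracket_zero [simp]: "X \<in> carrier_mat N N \<Longrightarrow> lie_bracket X (0\<^sub>m N N) = 0\<^sub>m N N"
  by (rule square_eqI[of _ N]) (auto simp: lie_bracket_entry[of _ N])

lemma coord_zero:
  assumes "real_basis N V d b" "real_subspace N V"
  shows "coord N d b (0\<^sub>m N N) k = 0"
proof -
  have "real_smult 0 (0\<^sub>m N N) = 0\<^sub>m N N" by (rule square_eqI[of _ N]) auto
  then show ?thesis using coord_real_smult[OF assms real_subspaceD(2)[OF assms(2)], of 0 k] by simp
qed

text \<open>For \<open>X\<close> in an abelian ideal \<open>I\<close>, \<open>ad X\<close> maps
  everything into \<open>I\<close> and then \<open>I\<close> to zero. So \<open>(ad X)^2\<close> has
  trace zero, and the definite Killing form gives \<open>X = 0\<close>.\<close>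

lemma semisimple_sp: "semisimple N (sp (\<lambda>_ _. True))"
  unfolding semisimple_def
proof (intro allI impI)
  fix I assume I: "lie_ideal N (sp (\<lambda>_ _. True)) I \<and> (\<forall>X\<in>I. \<forall>Y\<in>I. lie_bracket X Y = 0\<^sub>m N N)"
  then have sub: "real_subspace N I" and Ig: "I \<subseteq> sp (\<lambda>_ _. True)"
    and ideal: "\<And>X Y. X \<in> sp (\<lambda>_ _. True) \<Longrightarrow> Y \<in> I \<Longrightarrow> lie_bracket X Y \<in> I"
    and abelian: "\<And>X Y. X \<in> I \<Longrightarrow> Y \<in> I \<Longrightarrow> lie_bracket X Y = 0\<^sub>m N N"
    unfolding lie_ideal_def by blast+
  have "X = 0\<^sub>m N N" if X: "X \<in> I" for X
  proof -
    have Xg: "X \<in> sp (\<lambda>_ _. True)" using X Ig by blast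
    obtain d b where B: "real_basis N (sp (\<lambda>_ _. True)) d b"
      using exists_frobenius_orthonormal_basis[OF real_subspace_sp] by blast
    have "coord N d b (lie_bracket X (lie_bracket X (b k))) k = 0" if k: "k < d" for k
    proof -
      have bk: "b k \<in> sp (\<lambda>_ _. True)" by (rule real_basis_mem[OF B k])
      have "lie_bracket X (b k) \<in> I"
        unfolding lie_bracket_swap[OF spD(1)[OF Xg] spD(1)[OF bk]]
        by (intro real_subspaceD(4)[OF sub] ideal bk X)
      then show ?thesis using abelian[OF X] coord_zero[OF B real_subspace_sp] by simp
    qed
    then have "- (real N + 2) * frobenius N X X = 0" using killing_trace[OF B Xg Xg] by simp
    then have "frobenius N X X = 0" by simp
    then show ?thesis using frobenius_eq_0 spD(1)[OF Xg] by blast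
  qed
  then show "I = {0\<^sub>m N N}" using real_subspaceD(2)[OF sub] by blast
qed

end

section \<open>The three modules\<close>

text \<open>Each block is stable under \<open>\<sigma>\<close>, so \<open>m\<close>, which counts
  complex rows, is twice the quaternionic size of a block. Equal sizes are what make the three
  parameters equal.\<close>

locale three_blocks = symplectic_form +
  fixes blk :: "nat \<Rightarrow> 3" and m :: nat
  assumes blk_\<sigma> [simp]: "i < N \<Longrightarrow> blk (\<sigma> i) = blk i"
    and card_block: "card {i. i < N \<and> blk i = c} = m"
    and m_pos: "0 < m"
begin

abbreviation "full \<equiv> \<lambda>(_::nat) (_::nat). True"

definition same :: "nat \<Rightarrow> nat \<Rightarrow> bool" where
  "same i j \<longleftrightarrow> blk i = blk j"

text \<open>A module is labelled by the block that it avoids: its entries lie between the two other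
  blocks.\<close>

definition off :: "3 \<Rightarrow> nat \<Rightarrow> nat \<Rightarrow> bool" where
  "off c i j \<longleftrightarrow> blk i \<noteq> c \<and> blk j \<noteq> c \<and> blk i \<noteq> blk j"

lemma block_relation_full: "block_relation full"
  by (simp add: block_relation_def)

lemma block_relation_same: "block_relation same"
  by (simp add: block_relation_def same_def)

lemma admissible_off: "admissible (off c)"
  by (auto simp: admissible_def off_def)

lemma third: "i \<noteq> j \<Longrightarrow> j \<noteq> k \<Longrightarrow> k \<noteq> i \<Longrightarrow> l = i \<or> l = j \<or> l = (k::3)"
  using exhaust_3[of i] exhaust_3[of j] exhaust_3[of k] exhaust_3[of l] by auto

lemma exists_third: "\<exists>k::3. k \<noteq> i \<and> k \<noteq> j"
proof -
  have "card {i, j} \<le> 2" by (simp add: card_insert_if)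
  moreover have "card (UNIV :: 3 set) = 3" by simp
  ultimately have "{i, j} \<noteq> UNIV" by auto
  then show ?thesis by blast
qed

lemma off_unique: "off c i j \<Longrightarrow> off c' i j \<Longrightarrow> c = c'"
  unfolding off_def by (metis third)

lemma off_exists: "blk i \<noteq> blk j \<Longrightarrow> \<exists>c. off c i j"
  unfolding off_def using exists_third[of "blk i" "blk j"] by metis

lemma bracket_same_off: "X \<in> sp same \<Longrightarrow> Y \<in> sp (off c) \<Longrightarrow> lie_bracket X Y \<in> sp (off c)"
  by (rule lie_bracket_sp[of X same Y "off c"]) (auto simp: same_def off_def)

text \<open>A path of two steps, each crossing between the same two blocks, ends in the block where
  it began.\<close>

lemma bracket_off_off: "X \<in> sp (off c) \<Longrightarrow> Y \<in> sp (off c) \<Longrightarrow> lie_bracket X Y \<in> sp same"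
  by (rule lie_bracket_sp[of X "off c" Y "off c"]) (auto simp: same_def off_def, (metis third)+)

text \<open>In a path whose first step avoids \<open>c\<close> and whose second avoids
  \<open>c'\<close>, the middle vertex must lie in block \<open>c''\<close>, so the end points lie
  in the blocks \<open>c'\<close> and \<open>c\<close>.\<close>

lemma bracket_off_distinct:
  assumes "c \<noteq> c'" "c' \<noteq> c''" "c'' \<noteq> c" and X: "X \<in> sp (off c)" and Y: "Y \<in> sp (off c')"
  shows "lie_bracket X Y \<in> sp (off c'')"
proof (rule lie_bracket_sp[OF X Y])
  have third': "l = c \<or> l = c' \<or> l = c''" for l using third[OF assms(1-3)] .
  show "off c'' i j" if "off c i l" "off c' l j" for i l j
    using that assms(1-3) third'[of "blk i"] third'[of "blk l"] third'[of "blk j"] unfolding off_def by metis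
  show "off c'' i j" if "off c' i l" "off c l j" for i l j
    using that assms(1-3) third'[of "blk i"] third'[of "blk l"] third'[of "blk j"] unfolding off_def by metis
qed

lemma N_eq: "N = 3 * m"
proof -
  have "card {..<N} = card (\<Union>c\<in>(UNIV::3 set). {i. i < N \<and> blk i = c})"
    by (rule arg_cong[where f = card]) auto
  also have "\<dots> = (\<Sum>c\<in>(UNIV::3 set). card {i. i < N \<and> blk i = c})"
    by (rule card_UN_disjoint) auto
  finally show ?thesis by (simp add: card_block)
qed

text \<open>The assumption \<open>cross\<close> removes the terms with \<open>\<sigma>\<close> from
  \<open>trace_ad_ad\<close>, and products of diagonal entries cancel between \<open>j\<close> and
  \<open>\<sigma> j\<close>. What remains is a sum of row norms, where each row outside block
  \<open>c\<close> has \<open>m\<close> partners. It serves for elements of the isotropy algebra and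
  for elements of another module.\<close>

lemma trace_off:
  assumes B: "real_basis N (sp (off c)) d b" and X: "X \<in> sp E"
    and cross: "\<And>i j. i < N \<Longrightarrow> j < N \<Longrightarrow> off c i j \<Longrightarrow> X $$ (i, j) = 0"
    and inv: "\<And>Z. Z \<in> sp (off c) \<Longrightarrow> lie_bracket X (lie_bracket X Z) \<in> sp (off c)"
  shows "(\<Sum>k<d. coord N d b (lie_bracket X (lie_bracket X (b k))) k) =
    - real m * (\<Sum>i<N. if blk i \<noteq> c then row_norm X i else 0)"
proof -
  let ?r = "row_norm X"
  have "(\<Sum>k<d. coord N d b (lie_bracket X (lie_bracket X (b k))) k) =
    (1/2) * (\<Sum>i<N. \<Sum>j<N. (if off c i j then - ?r i else 0) + (if off c i j then - ?r j else 0)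
      - 2 * (if off c i j then Re (X $$ (i, i) * X $$ (j, j)) else 0))"
  proof (rule trans[OF trace_ad_ad[OF B admissible_off spD(1)[OF X] spD(1)[OF X] inv]], assumption,
      rule arg_cong[where f = "\<lambda>x. (1/2) * x"], intro sum.cong refl)
    fix i j assume "i \<in> {..<N}" "j \<in> {..<N}"
    then have ij: "i < N" "j < N" by auto
    show "(if off c i j then Re ((X * X) $$ (i, i) - X $$ (i, i) * X $$ (j, j) - X $$ (i, i) * X $$ (j, j) + (X * X) $$ (j, j)
       - \<epsilon> i * \<epsilon> j * ((if \<sigma> i = j then (X * X) $$ (i, \<sigma> j) + (X * X) $$ (\<sigma> i, j) else 0)
          - X $$ (i, \<sigma> j) * X $$ (\<sigma> i, j) - X $$ (i, \<sigma> j) * X $$ (\<sigma> i, j))) else 0) =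
      (if off c i j then - ?r i else 0) + (if off c i j then - ?r j else 0)
      - 2 * (if off c i j then Re (X $$ (i, i) * X $$ (j, j)) else 0)"
    proof (cases "off c i j")
      case True
      then have "\<sigma> i \<noteq> j" using ij by (auto simp: off_def)
      moreover have "X $$ (i, \<sigma> j) = 0" using cross[of i "\<sigma> j"] True ij by (simp add: off_def)
      moreover have "Re (2 * z) = 2 * Re z" for z by simp
      ultimately show ?thesis
        using True square_diagonal[OF X ij(1)] square_diagonal[OF X ij(2)] by (simp del: index_mult_mat times_complex.sel)
    qed simp
  qed
  also have "\<dots> = (1/2) * ((\<Sum>i<N. \<Sum>j<N. if off c i j then - ?r i else 0) + (\<Sum>i<N. \<Sum>j<N. if off c i j then - ?r j else 0)
      - 2 * (\<Sum>i<N. \<Sum>j<N. if off c i j then Re (X $$ (i, i) * X $$ (j, j)) else 0))"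
    by (simp only: sum.distrib sum_subtractf sum_distrib_left)
  also have "(\<Sum>i<N. \<Sum>j<N. if off c i j then - ?r j else 0) = (\<Sum>i<N. \<Sum>j<N. if off c i j then - ?r i else 0)"
  proof (subst sum.swap, intro sum.cong refl)
    show "(if off c j i then - ?r i else 0) = (if off c i j then - ?r i else 0)" for i j
      by (auto simp: off_def)
  qed
  also have "(\<Sum>i<N. \<Sum>j<N. if off c i j then Re (X $$ (i, i) * X $$ (j, j)) else 0) = 0"
  proof (rule sum.neutral, rule ballI)
    fix i assume "i \<in> {..<N}"
    let ?g = "\<lambda>j. if off c i j then Re (X $$ (i, i) * X $$ (j, j)) else 0"
    have "(\<Sum>j<N. ?g j) = (\<Sum>j<N. ?g (\<sigma> j))" by (rule sum_\<sigma>[symmetric])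
    also have "\<dots> = (\<Sum>j<N. - ?g j)"
      by (intro sum.cong refl) (auto simp: off_def diagonal_\<sigma>[OF X] simp del: times_complex.sel)
    finally show "(\<Sum>j<N. ?g j) = 0" by (simp add: sum_negf)
  qed
  also have "(\<Sum>i<N. \<Sum>j<N. if off c i j then - ?r i else 0) = (\<Sum>i<N. - real m * (if blk i \<noteq> c then ?r i else 0))"
  proof (intro sum.cong refl)
    fix i assume "i \<in> {..<N}"
    show "(\<Sum>j<N. if off c i j then - ?r i else 0) = - real m * (if blk i \<noteq> c then ?r i else 0)"
    proof (cases "blk i = c")
      case True
      then show ?thesis by (simp add: off_def)
    next
      case False
      then obtain e where e: "e \<noteq> c" "e \<noteq> blk i" using exists_third[of c "blk i"] by metis
      have "off c i j \<longleftrightarrow> blk j = e" for j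
        using third[of c "blk i" e "blk j"] e False unfolding off_def by metis
      then have "{..<N} \<inter> {j. off c i j} = {j. j < N \<and> blk j = e}" by auto
      then show ?thesis using False card_block[of e] by (simp add: sum.If_cases)
    qed
  qed
  finally show ?thesis by (simp add: sum_distrib_left)
qed

text \<open>The entries of \<open>X\<close> run between block \<open>c\<close> and one other block.
  Entries at transposed positions have equal modulus, so the rows of the other block carry half of
  the square norm.\<close>

lemma row_norm_off:
  assumes X: "X \<in> sp (off c')" and c: "c' \<noteq> c"
  shows "(\<Sum>i<N. if blk i \<noteq> c then row_norm X i else 0) = frobenius N X X / 2"
proof -
  let ?e = "\<lambda>i l. (cmod (X $$ (i, l)))^2"
  let ?S = "\<Sum>i<N. if blk i \<noteq> c then row_norm X i else 0" and ?S' = "\<Sum>i<N. if blk i = c then row_norm X i else 0"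
  have sym: "?e l i = ?e i l" if "i < N" "l < N" for i l using spD(4)[OF X that] by simp
  have "?S = (\<Sum>i<N. \<Sum>l<N. if blk i \<noteq> c then ?e i l else 0)"
    unfolding row_norm_def by (intro sum.cong refl) simp
  also have "\<dots> = (\<Sum>l<N. \<Sum>i<N. if blk i \<noteq> c then ?e i l else 0)" by (rule sum.swap)
  also have "\<dots> = (\<Sum>l<N. \<Sum>i<N. if blk l = c then ?e l i else 0)"
  proof (intro sum.cong refl)
    fix l i assume "l \<in> {..<N}" "i \<in> {..<N}"
    then have li: "l < N" "i < N" by auto
    show "(if blk i \<noteq> c then ?e i l else 0) = (if blk l = c then ?e l i else 0)"
    proof (cases "off c' i l")
      case True
      then have "blk i \<noteq> c \<longleftrightarrow> blk l = c" using c third[of c' "blk i" "blk l" c] unfolding off_def by metis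
      then show ?thesis using sym[OF li] by simp
    next
      case False
      then have "X $$ (i, l) = 0" "X $$ (l, i) = 0"
        using spD(3)[OF X li(2,1)] spD(3)[OF X li] by (auto simp: off_def)
      then show ?thesis by simp
    qed
  qed
  also have "\<dots> = ?S'" unfolding row_norm_def by (intro sum.cong refl) simp
  finally have "?S = ?S'" .
  moreover have "frobenius N X X = ?S + ?S'"
    unfolding frobenius_row_norm sum.distrib[symmetric] by (intro sum.cong refl) simp
  ultimately show ?thesis by simp
qed

text \<open>For \<open>X\<close> in such an ideal, the bracket with a module lies both in the module
  and in \<open>sp same\<close>, hence is zero. By \<open>trace_off\<close> all rows of
  \<open>X\<close> outside block \<open>c\<close> vanish, for every \<open>c\<close>, and each row
  lies outside some block.\<close>

lemma almost_effective_sp: "almost_effective N (sp full) (sp same)"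
  unfolding almost_effective_def
proof (intro allI impI)
  fix I assume "lie_ideal N (sp full) I \<and> I \<subseteq> sp same"
  then have sub: "real_subspace N I" and Ih: "I \<subseteq> sp same"
    and ideal: "\<And>X Y. X \<in> sp full \<Longrightarrow> Y \<in> I \<Longrightarrow> lie_bracket X Y \<in> I"
    unfolding lie_ideal_def by blast+
  have "X = 0\<^sub>m N N" if X: "X \<in> I" for X
  proof -
    have Xh: "X \<in> sp same" using X Ih by blast
    have "(\<Sum>i<N. if blk i \<noteq> c then row_norm X i else 0) = 0" for c
    proof -
      obtain d b where B: "real_basis N (sp (off c)) d b"
        using exists_frobenius_orthonormal_basis[OF real_subspace_sp] by blast
      have cent: "lie_bracket X Z = 0\<^sub>m N N" if Z: "Z \<in> sp (off c)" for Z
      proof -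
        have Zg: "Z \<in> sp full" using Z sp_mono[of "off c" full] by blast
        have "lie_bracket X Z \<in> I"
          unfolding lie_bracket_swap[OF spD(1)[OF Xh] spD(1)[OF Z]]
          by (intro real_subspaceD(4)[OF sub] ideal Zg X)
        then have W: "lie_bracket X Z \<in> sp same" using Ih by blast
        have W': "lie_bracket X Z \<in> sp (off c)" by (rule bracket_same_off[OF Xh Z])
        have "frobenius N (lie_bracket X Z) (lie_bracket X Z) = 0"
          by (rule frobenius_disjoint[OF W W']) (simp add: same_def off_def)
        then show ?thesis using frobenius_eq_0 spD(1)[OF W] by blast
      qed
      have "(\<Sum>k<d. coord N d b (lie_bracket X (lie_bracket X (b k))) k) = 0"
        using cent[OF real_basis_mem[OF B]] coord_zero[OF B real_subspace_sp] spD(1)[OF Xh] by simp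
      moreover have "(\<Sum>k<d. coord N d b (lie_bracket X (lie_bracket X (b k))) k) =
          - real m * (\<Sum>i<N. if blk i \<noteq> c then row_norm X i else 0)"
      proof (rule trace_off[OF B Xh])
        show "X $$ (i, j) = 0" if "i < N" "j < N" "off c i j" for i j
          using spD(3)[OF Xh that(1,2)] that(3) by (simp add: same_def off_def)
        show "lie_bracket X (lie_bracket X Z) \<in> sp (off c)" if "Z \<in> sp (off c)" for Z
          by (intro bracket_same_off Xh that)
      qed
      ultimately show ?thesis using m_pos by simp
    qed
    then have "\<forall>i\<in>{..<N}. (if blk i \<noteq> c then row_norm X i else 0) = 0" for c
      using sum_nonneg_eq_0_iff[of "{..<N}" "\<lambda>i. if blk i \<noteq> c then row_norm X i else 0"] row_norm_nonneg by simp
    moreover have "\<exists>c. blk i \<noteq> c" for i using exists_third[of "blk i" "blk i"] by metis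
    ultimately have "row_norm X i = 0" if "i < N" for i using that by (metis lessThan_iff)
    then have "frobenius N X X = 0" by (simp add: frobenius_row_norm)
    then show ?thesis using frobenius_eq_0 spD(1)[OF Xh] by blast
  qed
  then show "I = {0\<^sub>m N N}" using real_subspaceD(2)[OF sub] by blast
qed

lemma sp_full: "X \<in> sp E \<Longrightarrow> X \<in> sp full"
  using sp_mono[of E full] by blast

text \<open>Testing \<open>X\<close> against its own restriction to the diagonal blocks shows that
  this restriction is zero; the remaining positions each belong to exactly one of the three
  patterns.\<close>

lemma orthogonal_complement_same:
  "orthogonal_complement N (sp full) (sp same) = {X 0 + X 1 + X 2 | X. \<forall>c. X c \<in> sp (off c)}"
proof (intro equalityI subsetI)
  fix X assume "X \<in> orthogonal_complement N (sp full) (sp same)"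
  then have X: "X \<in> sp full" and orth: "\<And>Y. Y \<in> sp same \<Longrightarrow> ip N (sp full) X Y = 0"
    unfolding orthogonal_complement_def by blast+
  define R where "R = restrict_entries same X"
  have R: "R \<in> sp same" unfolding R_def
    by (rule restrict_entries_sp[OF X block_relation_admissible[OF block_relation_same]])
  have "frobenius N R R = 0"
    using orth[OF R] ip_sp[OF X sp_full[OF R]] frobenius_restrict[of X same] by (simp add: R_def)
  then have R0: "R = 0\<^sub>m N N" using frobenius_eq_0 spD(1)[OF R] by blast
  define Y where "Y = (\<lambda>c. restrict_entries (off c) X)"
  have Y: "Y c \<in> sp (off c)" for c unfolding Y_def by (rule restrict_entries_sp[OF X admissible_off])
  note dY = carrier_matD[OF spD(1)[OF Y]]
  have "X = Y 0 + Y 1 + Y 2"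
  proof (rule square_eqI[OF spD(1)[OF X]])
    show "Y 0 + Y 1 + Y 2 \<in> carrier_mat N N" using spD(1)[OF Y] by simp
    fix i j assume ij: "i < N" "j < N"
    have three: "c = 0 \<or> c = 1 \<or> c = (2::3)" for c using exhaust_3[of c] by auto
    have ne: "(0::3) \<noteq> 1" "(0::3) \<noteq> 2" "(1::3) \<noteq> 2" by simp_all
    have ent: "(Y 0 + Y 1 + Y 2) $$ (i, j) = (if off 0 i j then X $$ (i, j) else 0)
        + (if off 1 i j then X $$ (i, j) else 0) + (if off 2 i j then X $$ (i, j) else 0)"
      using ij dY by (simp add: Y_def)
    show "X $$ (i, j) = (Y 0 + Y 1 + Y 2) $$ (i, j)"
    proof (cases "blk i = blk j")
      case True
      then have "X $$ (i, j) = 0"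
        using ij arg_cong[OF R0, of "\<lambda>M. M $$ (i, j)"] by (simp add: R_def same_def)
      then show ?thesis unfolding ent by simp
    next
      case False
      then obtain c where c: "off c i j" using off_exists by blast
      then have "off c' i j \<longleftrightarrow> c' = c" for c' using off_unique by blast
      then show ?thesis unfolding ent using three[of c] ne by auto
    qed
  qed
  then show "X \<in> {X 0 + X 1 + X 2 | X. \<forall>c. X c \<in> sp (off c)}" using Y by blast
next
  fix Z assume "Z \<in> {X 0 + X 1 + X 2 | X. \<forall>c. X c \<in> sp (off c)}"
  then obtain X where Z: "Z = X 0 + X 1 + X 2" and X: "\<And>c. X c \<in> sp (off c)" by blast
  have Zg: "Z \<in> sp full"
    unfolding Z by (intro real_subspaceD(3)[OF real_subspace_sp] sp_full[OF X])
  have "ip N (sp full) Z Y = 0" if Y: "Y \<in> sp same" for Y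
  proof -
    have "frobenius N (X c) Y = 0" for c
      by (rule frobenius_disjoint[OF X Y]) (simp add: same_def off_def)
    then have "frobenius N Z Y = 0"
      unfolding Z using spD(1)[OF X] by (simp add: frobenius_add_left[of _ N])
    then show ?thesis using ip_sp[OF Zg sp_full[OF Y]] by simp
  qed
  then show "Z \<in> orthogonal_complement N (sp full) (sp same)"
    unfolding orthogonal_complement_def using Zg by blast
qed

lemma off_orthogonal:
  assumes "c \<noteq> c'" "X \<in> sp (off c)" "Y \<in> sp (off c')"
  shows "ip N (sp full) X Y = 0"
proof -
  have "frobenius N X Y = 0"
    by (rule frobenius_disjoint[OF assms(2,3)]) (use assms(1) off_unique in blast)
  then show ?thesis using ip_sp[OF sp_full sp_full] assms by simp
qed

end

section \<open>Conjugation by quarter turns\<close>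

context symplectic_form begin

lemma conjugate_entry:
  assumes "U \<in> carrier_mat N N" "X \<in> carrier_mat N N" "i < N" "j < N"
  shows "(U * X * adj U) $$ (i, j) = (\<Sum>l<N. \<Sum>r<N. U $$ (i, l) * X $$ (l, r) * cnj (U $$ (j, r)))"
proof -
  have "(U * X * adj U) $$ (i, j) = (\<Sum>r<N. (\<Sum>l<N. U $$ (i, l) * X $$ (l, r)) * cnj (U $$ (j, r)))"
    using assms by (simp add: mult_entry[OF mult_carrier_mat[OF assms(1,2)] adj_carrier] mult_entry[OF assms(1,2)] del: index_mult_mat)
  also have "\<dots> = (\<Sum>r<N. \<Sum>l<N. U $$ (i, l) * X $$ (l, r) * cnj (U $$ (j, r)))"
    by (simp add: sum_distrib_right)
  finally show ?thesis by (subst sum.swap)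
qed

lemma conjugate_sp:
  assumes U: "U \<in> Sp E" and X: "X \<in> sp E'"
    and S: "\<And>i l r j. i < N \<Longrightarrow> l < N \<Longrightarrow> r < N \<Longrightarrow> j < N \<Longrightarrow> E i l \<Longrightarrow> E' l r \<Longrightarrow> E j r \<Longrightarrow> E' i j"
  shows "Ad N U X \<in> sp E'"
  unfolding Ad_Sp[OF U]
proof (rule spI)
  note UX = SpD(1)[OF U] spD(1)[OF X]
  show "U * X * adj U \<in> carrier_mat N N" by (intro mult_carrier_mat[OF mult_carrier_mat[OF UX]] adj_carrier)
  fix i j assume ij: "i < N" "j < N"
  note ent = conjugate_entry[OF UX]
  show "(U * X * adj U) $$ (\<sigma> i, \<sigma> j) = \<epsilon> i * \<epsilon> j * cnj ((U * X * adj U) $$ (i, j))"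
  proof -
    have "(U * X * adj U) $$ (\<sigma> i, \<sigma> j) = (\<Sum>l<N. \<Sum>r<N. U $$ (\<sigma> i, l) * X $$ (l, r) * cnj (U $$ (\<sigma> j, r)))"
      using ij by (simp only: ent \<sigma>_less)
    also have "\<dots> = (\<Sum>l<N. \<Sum>r<N. U $$ (\<sigma> i, \<sigma> l) * X $$ (\<sigma> l, r) * cnj (U $$ (\<sigma> j, r)))"
      by (rule sum_\<sigma>[symmetric])
    also have "\<dots> = (\<Sum>l<N. \<Sum>r<N. U $$ (\<sigma> i, \<sigma> l) * X $$ (\<sigma> l, \<sigma> r) * cnj (U $$ (\<sigma> j, \<sigma> r)))"
      by (rule sum.cong[OF refl]) (rule sum_\<sigma>[symmetric])
    also have "\<dots> = (\<Sum>l<N. \<Sum>r<N. \<epsilon> i * \<epsilon> j * cnj (U $$ (i, l) * X $$ (l, r) * cnj (U $$ (j, r))))"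
    proof (intro sum.cong refl)
      fix l r assume "l \<in> {..<N}" "r \<in> {..<N}"
      then have lr: "l < N" "r < N" by auto
      have "U $$ (\<sigma> i, \<sigma> l) * X $$ (\<sigma> l, \<sigma> r) * cnj (U $$ (\<sigma> j, \<sigma> r)) =
        (\<epsilon> l * \<epsilon> l) * (\<epsilon> r * \<epsilon> r) * (\<epsilon> i * \<epsilon> j * (cnj (U $$ (i, l)) * cnj (X $$ (l, r)) * U $$ (j, r)))"
        unfolding SpD(2)[OF U ij(1) lr(1)] SpD(2)[OF U ij(2) lr(2)] spD(2)[OF X lr] complex_cnj_mult complex_cnj_cnj
          \<epsilon>_cnj[OF ij(2)] \<epsilon>_cnj[OF lr(2)] by (simp only: ac_simps)
      then show "U $$ (\<sigma> i, \<sigma> l) * X $$ (\<sigma> l, \<sigma> r) * cnj (U $$ (\<sigma> j, \<sigma> r)) =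
          \<epsilon> i * \<epsilon> j * cnj (U $$ (i, l) * X $$ (l, r) * cnj (U $$ (j, r)))"
        by (simp only: \<epsilon>_sq[OF lr(1)] \<epsilon>_sq[OF lr(2)] mult_1_left complex_cnj_mult complex_cnj_cnj)
    qed
    finally show ?thesis unfolding ent[OF ij] by (simp only: cnj_sum sum_distrib_left)
  qed
  show "(U * X * adj U) $$ (j, i) = - cnj ((U * X * adj U) $$ (i, j))"
  proof -
    have "(\<Sum>l<N. \<Sum>r<N. U $$ (j, l) * X $$ (l, r) * cnj (U $$ (i, r))) =
        (\<Sum>r<N. \<Sum>l<N. U $$ (j, l) * X $$ (l, r) * cnj (U $$ (i, r)))" by (rule sum.swap)
    also have "\<dots> = (\<Sum>r<N. \<Sum>l<N. - cnj (U $$ (i, r) * X $$ (r, l) * cnj (U $$ (j, l))))"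
    proof (intro sum.cong refl)
      fix r l assume "r \<in> {..<N}" "l \<in> {..<N}"
      then have lr: "r < N" "l < N" by auto
      show "U $$ (j, l) * X $$ (l, r) * cnj (U $$ (i, r)) = - cnj (U $$ (i, r) * X $$ (r, l) * cnj (U $$ (j, l)))"
        unfolding spD(4)[OF X lr] by simp
    qed
    finally show ?thesis unfolding ent[OF ij] ent[OF ij(2,1)] by (simp only: cnj_sum sum_negf)
  qed
  show "(U * X * adj U) $$ (i, j) = 0" if n: "\<not> E' i j"
    unfolding ent[OF ij]
  proof (rule sum.neutral, rule ballI, rule sum.neutral, rule ballI)
    fix l r assume "l \<in> {..<N}" "r \<in> {..<N}"
    then have lr: "l < N" "r < N" by auto
    have "\<not> E i l \<or> \<not> E' l r \<or> \<not> E j r" using S[OF ij(1) lr ij(2)] n by blast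
    then show "U $$ (i, l) * X $$ (l, r) * cnj (U $$ (j, r)) = 0"
      using SpD(3)[OF U ij(1) lr(1)] spD(3)[OF X lr] SpD(3)[OF U ij(2) lr(2)] by auto
  qed
qed

text \<open>At the angle \<open>pi/2\<close> the cosine vanishes and the rotation is a monomial
  unitary matrix, with entries \<open>c p\<close>, replaced by 1 where \<open>c\<close> is
  zero.\<close>

lemma conjugate_monomial_entry:
  assumes E: "block_relation E" and sm: "skew_monomial E \<pi> c" and X: "X \<in> carrier_mat N N" and pq: "p < N" "q < N"
  defines "\<kappa> \<equiv> \<lambda>p. if c p = 0 then 1 else c p"
  shows "Ad N (rotation \<pi> c (pi/2)) X $$ (p, q) = \<kappa> p * X $$ (\<pi> p, \<pi> q) * cnj (\<kappa> q)"
proof -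
  let ?U = "rotation \<pi> c (pi/2)"
  have U: "?U \<in> Sp E" by (rule rotation_in_Sp[OF E sm])
  note P = sm[unfolded skew_monomial_def, rule_format]
  have ent: "?U $$ (p, l) = (if l = \<pi> p then \<kappa> p else 0)" if "p < N" "l < N" for p l
    using P[OF that(1)] unfolding rotation_entry[OF that] \<kappa>_def by (auto simp: cos_pi_half)
  have "Ad N ?U X $$ (p, q) = (\<Sum>l<N. \<Sum>r<N. ?U $$ (p, l) * X $$ (l, r) * cnj (?U $$ (q, r)))"
    unfolding Ad_Sp[OF U] by (rule conjugate_entry[OF SpD(1)[OF U] X pq])
  also have "\<dots> = (\<Sum>l<N. \<Sum>r<N. if l = \<pi> p \<and> r = \<pi> q then \<kappa> p * X $$ (l, r) * cnj (\<kappa> q) else 0)"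
    using pq by (intro sum.cong refl) (simp add: ent)
  also have "\<dots> = \<kappa> p * X $$ (\<pi> p, \<pi> q) * cnj (\<kappa> q)"
    using P pq by (intro sum_delta_pair) auto
  finally show ?thesis .
qed

lemma four_unit_linear:
  "four_unit i j (of_real a * z + of_real b * w) = real_smult a (four_unit i j z) + real_smult b (four_unit i j w)"
proof (rule square_eqI[of _ N])
  fix p q assume pq: "p < N" "q < N"
  have gen: "(if A then of_real a * z + of_real b * w else 0) - (if B then cnj (of_real a * z + of_real b * w) else 0)
    + (if C then e * cnj (of_real a * z + of_real b * w) else 0) - (if D then e * (of_real a * z + of_real b * w) else 0) =
    of_real a * ((if A then z else 0) - (if B then cnj z else 0) + (if C then e * cnj z else 0) - (if D then e * z else 0))
    + of_real b * ((if A then w else 0) - (if B then cnj w else 0) + (if C then e * cnj w else 0) - (if D then e * w else 0))"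
    for A B C D and e :: complex by (simp add: algebra_simps)
  have "(real_smult a (four_unit i j z) + real_smult b (four_unit i j w)) $$ (p, q) =
      of_real a * four_unit i j z $$ (p, q) + of_real b * four_unit i j w $$ (p, q)" using pq by simp
  also have "\<dots> = four_unit i j (of_real a * z + of_real b * w) $$ (p, q)"
    unfolding four_unit_entry[OF pq] by (rule gen[symmetric])
  finally show "four_unit i j (of_real a * z + of_real b * w) $$ (p, q) =
      (real_smult a (four_unit i j z) + real_smult b (four_unit i j w)) $$ (p, q)" ..
qed simp_all

lemma four_unit_swap:
  assumes "i < N" "j < N"
  shows "four_unit j i (- cnj z) = four_unit i j z"
proof (rule square_eqI[of _ N])
  fix p q assume pq: "p < N" "q < N"
  have gen: "(if A then - cnj z else 0) - (if B then cnj (- cnj z) else 0) + (if C then f * cnj (- cnj z) else 0) - (if D then f * (- cnj z) else 0)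
    = (if B then z else 0) - (if A then cnj z else 0) + (if D then f * cnj z else 0) - (if C then f * z else 0)"
    for A B C D and f :: complex by (simp add: algebra_simps)
  show "four_unit j i (- cnj z) $$ (p, q) = four_unit i j z $$ (p, q)"
    unfolding four_unit_entry[OF pq]
    unfolding conj_commute[of "i = p" "j = q"] conj_commute[of "i = q" "j = p"] conj_commute[of "i = \<sigma> p" "j = \<sigma> q"]
      conj_commute[of "i = \<sigma> q" "j = \<sigma> p"] mult.commute[of "\<epsilon> i" "\<epsilon> j"]
    by (rule gen)
qed simp_all

text \<open>The device that moves entries: the first index passes from \<open>i\<close> to
  \<open>i'\<close> and the value is multiplied by \<open>c i'\<close>, while \<open>c j = 0\<close>
  keeps the second index fixed.\<close>

lemma conjugate_four_unit:
  assumes E: "block_relation E" and sm: "skew_monomial E \<pi> c" and ij: "i < N" "j < N" "i' < N"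
    and \<pi>: "\<pi> i' = i" "c i' \<noteq> 0" "c j = 0"
  shows "Ad N (rotation \<pi> c (pi/2)) (four_unit i j z) = four_unit i' j (c i' * z)"
proof (rule square_eqI[of _ N])
  have U: "rotation \<pi> c (pi/2) \<in> Sp E" by (rule rotation_in_Sp[OF E sm])
  show "Ad N (rotation \<pi> c (pi/2)) (four_unit i j z) \<in> carrier_mat N N"
    unfolding Ad_Sp[OF U] by (intro mult_carrier_mat) auto
  fix p q assume pq: "p < N" "q < N"
  note P = sm[unfolded skew_monomial_def, rule_format]
  define \<kappa> where "\<kappa> = (\<lambda>p. if c p = 0 then 1 else c p)"
  have \<kappa>i: "\<kappa> i' = c i'" using \<pi> by (simp add: \<kappa>_def)
  have \<kappa>j: "\<kappa> j = 1" using \<pi> by (simp add: \<kappa>_def)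
  have "c (\<sigma> j) = 0" using P[OF ij(2)] \<pi>(3) by simp
  then have \<kappa>\<sigma>j: "\<kappa> (\<sigma> j) = 1" by (simp add: \<kappa>_def)
  have "c (\<sigma> i') = \<epsilon> i' * \<epsilon> i * cnj (c i')" using P[OF ij(3)] \<pi>(1) by simp
  moreover from this have "c (\<sigma> i') \<noteq> 0" using \<pi>(2) \<epsilon>_nonzero ij by simp
  ultimately have \<kappa>\<sigma>i: "\<kappa> (\<sigma> i') = \<epsilon> i' * \<epsilon> i * cnj (c i')" by (simp add: \<kappa>_def)
  have \<pi>j: "\<pi> j = j" using P[OF ij(2)] \<pi>(3) by simp
  have conds: "i = \<pi> x \<longleftrightarrow> i' = x" "j = \<pi> x \<longleftrightarrow> j = x" "i = \<sigma> (\<pi> x) \<longleftrightarrow> i' = \<sigma> x" "j = \<sigma> (\<pi> x) \<longleftrightarrow> j = \<sigma> x"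
    if x: "x < N" for x
  proof -
    show 1: "i = \<pi> x \<longleftrightarrow> i' = x" for x' using P[OF x] P[OF ij(3)] \<pi>(1) by metis
    show 2: "j = \<pi> x \<longleftrightarrow> j = x" using P[OF x] \<pi>j by metis
    have s: "\<sigma> (\<pi> x) = \<pi> (\<sigma> x)" using P[OF x] by simp
    show "i = \<sigma> (\<pi> x) \<longleftrightarrow> i' = \<sigma> x" unfolding s using P[OF \<sigma>_less[OF x]] P[OF ij(3)] \<pi>(1) by metis
    show "j = \<sigma> (\<pi> x) \<longleftrightarrow> j = \<sigma> x" unfolding s using P[OF \<sigma>_less[OF x]] \<pi>j by metis
  qed
  define A B C D where "A \<longleftrightarrow> i' = p \<and> j = q" and "B \<longleftrightarrow> i' = q \<and> j = p"
    and "C \<longleftrightarrow> i' = \<sigma> p \<and> j = \<sigma> q" and "D \<longleftrightarrow> i' = \<sigma> q \<and> j = \<sigma> p"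
  note folds = A_def[symmetric] B_def[symmetric] C_def[symmetric] D_def[symmetric]
  define e f where "e = \<epsilon> i * \<epsilon> j" and "f = \<epsilon> i' * \<epsilon> j"
  have pv: "C \<Longrightarrow> p = \<sigma> i' \<and> q = \<sigma> j" "D \<Longrightarrow> q = \<sigma> i' \<and> p = \<sigma> j"
    using pq by (auto simp: C_def D_def)
  have ee: "\<epsilon> i' * \<epsilon> i * e = f" using ij by (simp add: e_def f_def mult.assoc)
  have cA: "\<kappa> p * cnj (\<kappa> q) = c i'" if A using that \<kappa>i \<kappa>j by (simp add: A_def)
  have cB: "\<kappa> p * cnj (\<kappa> q) = cnj (c i')" if B using that \<kappa>i \<kappa>j by (simp add: B_def)
  have cC: "\<kappa> p * cnj (\<kappa> q) * e = f * cnj (c i')" if C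
    using pv(1)[OF that] \<kappa>\<sigma>i \<kappa>\<sigma>j by (simp add: ee[symmetric] mult_ac)
  have cD: "\<kappa> p * cnj (\<kappa> q) * e = f * c i'" if D
    using pv(2)[OF that] \<kappa>\<sigma>i \<kappa>\<sigma>j ij by (simp add: ee[symmetric] mult_ac)
  have "Ad N (rotation \<pi> c (pi/2)) (four_unit i j z) $$ (p, q) = \<kappa> p * four_unit i j z $$ (\<pi> p, \<pi> q) * cnj (\<kappa> q)"
    unfolding \<kappa>_def by (rule conjugate_monomial_entry[OF E sm four_unit_carrier pq])
  also have "four_unit i j z $$ (\<pi> p, \<pi> q) = (if A then z else 0) - (if B then cnj z else 0)
      + (if C then e * cnj z else 0) - (if D then e * z else 0)"
  proof -
    have pq': "\<pi> p < N" "\<pi> q < N" using P pq by blast+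
    show ?thesis unfolding four_unit_entry[OF pq'] unfolding conds[OF pq(1)] conds[OF pq(2)] folds e_def ..
  qed
  also have "\<kappa> p * ((if A then z else 0) - (if B then cnj z else 0) + (if C then e * cnj z else 0) - (if D then e * z else 0)) * cnj (\<kappa> q) =
      (if A then (\<kappa> p * cnj (\<kappa> q)) * z else 0) - (if B then (\<kappa> p * cnj (\<kappa> q)) * cnj z else 0)
      + (if C then (\<kappa> p * cnj (\<kappa> q) * e) * cnj z else 0) - (if D then (\<kappa> p * cnj (\<kappa> q) * e) * z else 0)"
    by (simp add: algebra_simps)
  also have "\<dots> = (if A then c i' * z else 0) - (if B then cnj (c i') * cnj z else 0)
      + (if C then f * cnj (c i') * cnj z else 0) - (if D then f * c i' * z else 0)"
    using cA cB cC cD by (simp cong: if_cong)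
  also have "\<dots> = four_unit i' j (c i' * z) $$ (p, q)"
    unfolding four_unit_entry[OF pq] folds f_def[symmetric] by (simp add: mult.assoc)
  finally show "Ad N (rotation \<pi> c (pi/2)) (four_unit i j z) $$ (p, q) = four_unit i' j (c i' * z) $$ (p, q)" .
qed simp

end

section \<open>Irreducibility of the modules\<close>

context three_blocks begin

lemma Ad_off: "U \<in> Sp same \<Longrightarrow> X \<in> sp (off c) \<Longrightarrow> Ad N U X \<in> sp (off c)"
  by (rule conjugate_sp[of U same X "off c"]) (auto simp: same_def off_def)

text \<open>The diagonal matrix with \<open>\<i>\<close> in row \<open>i\<close>,
  \<open>- \<i>\<close> in row \<open>\<sigma> i\<close> and 1 elsewhere; \<open>phase\<close> lists
  its diagonal.\<close>

definition torus :: "nat \<Rightarrow> complex mat" where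
  "torus i = rotation (four_perm i i) (four_coeff i i \<i>) (pi/2)"

definition phase :: "nat \<Rightarrow> nat \<Rightarrow> complex" where
  "phase i p = (if p = i then \<i> else if p = \<sigma> i then - \<i> else 1)"

lemma torus_monomial: "i < N \<Longrightarrow> skew_monomial same (four_perm i i) (four_coeff i i \<i>)"
  by (rule skew_monomial_four[OF block_relation_same]) (auto simp: same_def)

lemma torus_in_Sp: "i < N \<Longrightarrow> torus i \<in> Sp same"
  unfolding torus_def by (intro rotation_in_Sp block_relation_same torus_monomial)

lemma Ad_torus:
  assumes i: "i < N" and X: "X \<in> carrier_mat N N" and pq: "p < N" "q < N"
  shows "Ad N (torus i) X $$ (p, q) = phase i p * X $$ (p, q) * cnj (phase i q)"
proof -
  have \<pi>: "four_perm i i p = p" for p by (simp add: four_perm_def)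
  have "four_coeff i i \<i> p = (if p = i then \<i> else if p = \<sigma> i then - \<i> else 0)" for p
    using i by (simp add: four_coeff_def)
  then have \<kappa>: "(if four_coeff i i \<i> p = 0 then 1 else four_coeff i i \<i> p) = phase i p" for p
    by (simp add: phase_def)
  show ?thesis
    using conjugate_monomial_entry[OF block_relation_same torus_monomial[OF i] X pq] unfolding \<pi> \<kappa> torus_def .
qed

text \<open>
  Conjugation by \<open>torus i\<close> multiplies row \<open>i\<close> by \<open>\<i>\<close>, so suitable real combinations of such
  conjugates isolate a single quaternionic entry.
\<close>

lemma isolate_entry:
  assumes W: "real_subspace N W" "W \<subseteq> sp (off c)" and inv: "\<And>h X. h \<in> Sp same \<Longrightarrow> X \<in> W \<Longrightarrow> Ad N h X \<in> W"
    and X: "X \<in> W" and ij: "i < N" "j < N" "off c i j"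
  shows "four_unit i j (X $$ (i, j)) \<in> W"
proof -
  note sub = real_subspaceD[OF W(1)]
  have diff: "A - B \<in> W" if "A \<in> W" "B \<in> W" for A B
  proof -
    have "A - B = A + real_smult (-1) B"
      using sub(1)[OF that(1)] sub(1)[OF that(2)] by (intro square_eqI[of _ N]) auto
    then show ?thesis using sub that by simp
  qed
  have Ad_W: "Ad N (torus k) A \<in> W" if "k < N" "A \<in> W" for k A
    using inv torus_in_Sp that by blast
  have Ad_e: "Ad N (torus k) A $$ (p, q) = phase k p * cnj (phase k q) * A $$ (p, q)"
    if "k < N" "A \<in> W" "p < N" "q < N" for k A p q
    using Ad_torus[OF that(1) sub(1)[OF that(2)] that(3,4)] by simp
  \<comment> \<open>Conjugating twice negates the entries with exactly one index in
    \<open>{i, \<sigma> i}\<close> and fixes all others, so the difference doubles the former and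
    kills the latter. \<open>X2\<close> does the same for \<open>j\<close>, leaving only entries
    between the two pairs, multiplied by 4.\<close>
  define X1 where "X1 = X - Ad N (torus i) (Ad N (torus i) X)"
  have X1: "X1 \<in> W" unfolding X1_def using ij X by (intro diff Ad_W)
  define X2 where "X2 = X1 - Ad N (torus j) (Ad N (torus j) X1)"
  have X2: "X2 \<in> W" unfolding X2_def using ij X1 by (intro diff Ad_W)
  \<comment> \<open>The product of the two phases is 1 on the orbit of \<open>(i, j)\<close> and -1
    on that of \<open>(i, \<sigma> j)\<close>: the first is doubled, the second disappears. This
    makes the total factor 8.\<close>
  define X3 where "X3 = X2 + Ad N (torus i) (Ad N (torus j) X2)"
  have X3: "X3 \<in> W" unfolding X3_def using ij X2 by (intro sub(3) Ad_W)
  have XC: "X \<in> sp (off c)" using X W(2) by blast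
  have ne: "i \<noteq> j" "j \<noteq> i" "i \<noteq> \<sigma> j" "\<sigma> j \<noteq> i" "j \<noteq> \<sigma> i" "\<sigma> i \<noteq> j" "\<sigma> i \<noteq> \<sigma> j" "\<sigma> j \<noteq> \<sigma> i"
    "\<sigma> i \<noteq> i" "i \<noteq> \<sigma> i" "\<sigma> j \<noteq> j" "j \<noteq> \<sigma> j"
    using ij by (auto simp: off_def)
  have "X3 = real_smult 8 (four_unit i j (X $$ (i, j)))"
  proof (rule square_eqI[OF sub(1)[OF X3]])
    fix p q assume pq: "p < N" "q < N"
    let ?a = "phase i p * cnj (phase i q)" and ?b = "phase j p * cnj (phase j q)"
    have dims: "(A - B) $$ (p, q) = A $$ (p, q) - B $$ (p, q)" "(A + B) $$ (p, q) = A $$ (p, q) + B $$ (p, q)"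
      if "B \<in> W" for A B using carrier_matD[OF sub(1)[OF that]] pq by simp_all
    have e1: "X1 $$ (p, q) = (1 - ?a * ?a) * X $$ (p, q)"
      unfolding X1_def dims(1)[OF Ad_W[OF ij(1) Ad_W[OF ij(1) X]]] Ad_e[OF ij(1) Ad_W[OF ij(1) X] pq] Ad_e[OF ij(1) X pq]
      by (simp add: algebra_simps)
    have e2: "X2 $$ (p, q) = (1 - ?b * ?b) * X1 $$ (p, q)"
      unfolding X2_def dims(1)[OF Ad_W[OF ij(2) Ad_W[OF ij(2) X1]]] Ad_e[OF ij(2) Ad_W[OF ij(2) X1] pq] Ad_e[OF ij(2) X1 pq]
      by (simp add: algebra_simps)
    have "X3 $$ (p, q) = (1 + ?a * ?b) * X2 $$ (p, q)"
      unfolding X3_def dims(2)[OF Ad_W[OF ij(1) Ad_W[OF ij(2) X2]]] Ad_e[OF ij(1) Ad_W[OF ij(2) X2] pq] Ad_e[OF ij(2) X2 pq]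
      by (simp add: algebra_simps)
    then have e3: "X3 $$ (p, q) = (1 + ?a * ?b) * (1 - ?b * ?b) * (1 - ?a * ?a) * X $$ (p, q)"
      unfolding e2 e1 by (simp only: mult.assoc)
    have s: "i = \<sigma> q \<longleftrightarrow> q = \<sigma> i" "i = \<sigma> p \<longleftrightarrow> p = \<sigma> i" "j = \<sigma> q \<longleftrightarrow> q = \<sigma> j" "j = \<sigma> p \<longleftrightarrow> p = \<sigma> j"
      "i = p \<longleftrightarrow> p = i" "i = q \<longleftrightarrow> q = i" "j = p \<longleftrightarrow> p = j" "j = q \<longleftrightarrow> q = j"
      using pq ij by auto
    define z where "z = X $$ (i, j)"
    have Xe: "X $$ (j, i) = - cnj z" "X $$ (\<sigma> i, \<sigma> j) = \<epsilon> i * \<epsilon> j * cnj z" "X $$ (\<sigma> j, \<sigma> i) = - (\<epsilon> i * \<epsilon> j * z)"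
      using spD(4)[OF XC ij(1,2)] spD(2)[OF XC ij(1,2)] spD(2)[OF XC ij(2,1)] by (simp_all add: z_def mult.commute)
    have "four_unit i j z $$ (p, q) = (if p = i \<and> q = j then z else 0) - (if q = i \<and> p = j then cnj z else 0)
      + (if p = \<sigma> i \<and> q = \<sigma> j then \<epsilon> i * \<epsilon> j * cnj z else 0) - (if q = \<sigma> i \<and> p = \<sigma> j then \<epsilon> i * \<epsilon> j * z else 0)"
      unfolding four_unit_entry[OF pq] unfolding s ..
    moreover have "(1 + ?a * ?b) * (1 - ?b * ?b) * (1 - ?a * ?a) * X $$ (p, q) = 8 * ((if p = i \<and> q = j then z else 0) - (if q = i \<and> p = j then cnj z else 0)
      + (if p = \<sigma> i \<and> q = \<sigma> j then \<epsilon> i * \<epsilon> j * cnj z else 0) - (if q = \<sigma> i \<and> p = \<sigma> j then \<epsilon> i * \<epsilon> j * z else 0))"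
    proof -
      define f where "f = (\<lambda>x y x' y' :: complex. (1 + x * cnj x' * (y * cnj y')) * (1 - y * cnj y' * (y * cnj y')) * (1 - x * cnj x' * (x * cnj x')))"
      have f: "f \<i> 1 \<i> 1 = 0" "f \<i> 1 (-\<i>) 1 = 0" "f \<i> 1 1 \<i> = 8" "f \<i> 1 1 (-\<i>) = 0" "f \<i> 1 1 1 = 0"
        "f (-\<i>) 1 \<i> 1 = 0" "f (-\<i>) 1 (-\<i>) 1 = 0" "f (-\<i>) 1 1 \<i> = 0" "f (-\<i>) 1 1 (-\<i>) = 8" "f (-\<i>) 1 1 1 = 0"
        "f 1 \<i> \<i> 1 = 8" "f 1 \<i> (-\<i>) 1 = 0" "f 1 \<i> 1 \<i> = 0" "f 1 \<i> 1 (-\<i>) = 0" "f 1 \<i> 1 1 = 0"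
        "f 1 (-\<i>) \<i> 1 = 0" "f 1 (-\<i>) (-\<i>) 1 = 8" "f 1 (-\<i>) 1 \<i> = 0" "f 1 (-\<i>) 1 (-\<i>) = 0" "f 1 (-\<i>) 1 1 = 0"
        "f 1 1 \<i> 1 = 0" "f 1 1 (-\<i>) 1 = 0" "f 1 1 1 \<i> = 0" "f 1 1 1 (-\<i>) = 0" "f 1 1 1 1 = 0"
        by (simp_all add: f_def)
      have ph: "phase i i = \<i>" "phase i (\<sigma> i) = -\<i>" "phase i j = 1" "phase i (\<sigma> j) = 1"
        "phase j j = \<i>" "phase j (\<sigma> j) = -\<i>" "phase j i = 1" "phase j (\<sigma> i) = 1"
        using ne by (simp_all add: phase_def)
      have pho: "x \<noteq> i \<Longrightarrow> x \<noteq> \<sigma> i \<Longrightarrow> phase i x = 1" "x \<noteq> j \<Longrightarrow> x \<noteq> \<sigma> j \<Longrightarrow> phase j x = 1" for x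
        by (simp_all add: phase_def)
      have Xij: "X $$ (i, j) = z" by (simp add: z_def)
      have five: "x = i \<or> x = j \<or> x = \<sigma> i \<or> x = \<sigma> j \<or> x \<noteq> i \<and> x \<noteq> j \<and> x \<noteq> \<sigma> i \<and> x \<noteq> \<sigma> j" for x by blast
      have "f (phase i p) (phase j p) (phase i q) (phase j q) * X $$ (p, q) = 8 * ((if p = i \<and> q = j then z else 0) - (if q = i \<and> p = j then cnj z else 0)
        + (if p = \<sigma> i \<and> q = \<sigma> j then \<epsilon> i * \<epsilon> j * cnj z else 0) - (if q = \<sigma> i \<and> p = \<sigma> j then \<epsilon> i * \<epsilon> j * z else 0))"
        using five[of p] five[of q] by (elim disjE) (simp_all add: ph pho f ne Xe Xij)
      then show ?thesis unfolding f_def .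
    qed
    ultimately show "X3 $$ (p, q) = real_smult 8 (four_unit i j (X $$ (i, j))) $$ (p, q)"
      unfolding e3 z_def[symmetric] using pq by simp
  qed simp
  then have "four_unit i j (X $$ (i, j)) = real_smult (1/8) X3"
    by (intro square_eqI[of _ N]) auto
  then show ?thesis using sub(4)[OF X3] by simp
qed

text \<open>A nonzero invariant subspace contains the orbit matrix of some nonzero entry.
  Conjugations inside \<open>Sp same\<close> give it every complex value and move either index
  through its block, so the subspace contains all entry projections, which span the module.\<close>

lemma irreducible_off: "irreducible_Ad_module N (Sp same) (sp (off c))"
  unfolding irreducible_Ad_module_def
proof (intro conjI ballI allI impI)
  show "real_subspace N (sp (off c))" by (rule real_subspace_sp)
  show "Ad N h X \<in> sp (off c)" if "h \<in> Sp same" "X \<in> sp (off c)" for h X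
    using that by (rule Ad_off)
  have block: "\<exists>i<N. blk i = d" for d
  proof -
    have "card {i. i < N \<and> blk i = d} \<noteq> 0" using card_block[of d] m_pos by simp
    then have "{i. i < N \<and> blk i = d} \<noteq> {}" by (metis card.empty)
    then show ?thesis by blast
  qed
  show "sp (off c) \<noteq> {0\<^sub>m N N}"
  proof
    assume eq: "sp (off c) = {0\<^sub>m N N}"
    obtain d where d: "d \<noteq> c" using exists_third[of c c] by blast
    obtain e where e: "e \<noteq> c" "e \<noteq> d" using exists_third[of c d] by blast
    obtain i j where ij: "i < N" "blk i = d" "j < N" "blk j = e" using block by metis
    then have o: "off c i j" using d e by (simp add: off_def)
    then have "four_unit i j 1 = 0\<^sub>m N N"
      using four_unit_in_sp[OF ij(1,3) admissible_off o, of 1] eq by blast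
    then have "four_unit i j 1 $$ (i, j) = 0" using ij by simp
    moreover have "four_unit i j 1 $$ (i, j) = 1"
    proof -
      have n: "(i = j \<and> j = i) = False" "(i = \<sigma> i \<and> j = \<sigma> j) = False" "(i = \<sigma> j \<and> j = \<sigma> i) = False"
        using ij o by (auto simp: off_def)
      show ?thesis unfolding four_unit_entry[OF ij(1,3)] n by simp
    qed
    ultimately show False by simp
  qed
  fix W assume "real_subspace N W \<and> W \<subseteq> sp (off c) \<and> (\<forall>h\<in>Sp same. \<forall>X\<in>W. Ad N h X \<in> W)"
  then have W: "real_subspace N W" "W \<subseteq> sp (off c)" and inv: "\<And>h X. h \<in> Sp same \<Longrightarrow> X \<in> W \<Longrightarrow> Ad N h X \<in> W"
    by blast+
  note sub = real_subspaceD[OF W(1)]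
  show "W = {0\<^sub>m N N} \<or> W = sp (off c)"
  proof (rule disjCI)
    assume "W \<noteq> sp (off c)"
    show "W = {0\<^sub>m N N}"
    proof (rule ccontr)
      assume "W \<noteq> {0\<^sub>m N N}"
      then obtain X where X: "X \<in> W" "X \<noteq> 0\<^sub>m N N" using sub(2) by blast
      then obtain i j where ij: "i < N" "j < N" "X $$ (i, j) \<noteq> 0"
        using square_eqI[OF sub(1)[OF X(1)], of "0\<^sub>m N N"] by fastforce
      have XC: "X \<in> sp (off c)" using X W(2) by blast
      have o: "off c i j" using spD(3)[OF XC ij(1,2)] ij(3) by blast
      let ?z = "X $$ (i, j)"
      have Fz: "four_unit i j ?z \<in> W" by (rule isolate_entry[OF W inv X(1) ij(1,2) o])
      \<comment> \<open>One quarter turn mixing rows \<open>i\<close> and \<open>i'\<close> of the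
        same block. For \<open>i' = i\<close> it is diagonal and multiplies by \<open>\<i>\<close>;
        otherwise the unimodular factor is free.\<close>
      have move: "four_unit i' j (c0 * z) \<in> W"
        if F: "four_unit i j z \<in> W" and ij: "i < N" "j < N" "i' < N" and o: "off c i j" and same: "blk i' = blk i"
          and c0: "cmod c0 = 1" "i' = i \<Longrightarrow> c0 = \<i>" for i j i' z c0
      proof -
        have sm: "skew_monomial same (four_perm i' i) (four_coeff i' i c0)"
          using ij same c0 by (intro skew_monomial_four[OF block_relation_same]) (auto simp: same_def)
        have ne: "j \<noteq> i'" "j \<noteq> i" "j \<noteq> \<sigma> i'" "j \<noteq> \<sigma> i" using o same ij by (auto simp: off_def)
        have "Ad N (rotation (four_perm i' i) (four_coeff i' i c0) (pi/2)) (four_unit i j z) =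
            four_unit i' j (four_coeff i' i c0 i' * z)"
          using c0 ne by (intro conjugate_four_unit[OF block_relation_same sm ij]) (auto simp: four_perm_def four_coeff_def)
        moreover have "four_coeff i' i c0 i' = c0" by (simp add: four_coeff_def)
        moreover have "Ad N (rotation (four_perm i' i) (four_coeff i' i c0) (pi/2)) (four_unit i j z) \<in> W"
          by (rule inv[OF rotation_in_Sp[OF block_relation_same sm] F])
        ultimately show ?thesis by simp
      qed
      \<comment> \<open>The numbers \<open>z\<close> and \<open>\<i> * z\<close> form a real basis
        of the complex plane.\<close>
      have all_z: "four_unit i j w \<in> W"
        if F: "four_unit i j z \<in> W" and ij: "i < N" "j < N" and o: "off c i j" and z: "z \<noteq> 0" for i j z w
      proof -
        have Fi: "four_unit i j (\<i> * z) \<in> W" using move[OF F ij(1,2,1) o] by simp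
        have "w = of_real (Re (w / z)) * z + of_real (Im (w / z)) * (\<i> * z)"
        proof -
          have "w = (w / z) * z" using z by simp
          also have "w / z = of_real (Re (w / z)) + \<i> * of_real (Im (w / z))" by (rule complex_eq)
          finally show ?thesis by (simp only: distrib_left distrib_right mult_ac)
        qed
        then have "four_unit i j w = real_smult (Re (w / z)) (four_unit i j z) + real_smult (Im (w / z)) (four_unit i j (\<i> * z))"
          by (metis four_unit_linear)
        then show ?thesis using sub(3,4) F Fi by simp
      qed
      have shift: "four_unit i' j w \<in> W"
        if F: "\<And>w. four_unit i j w \<in> W" and ij: "i < N" "j < N" "i' < N" and o: "off c i j" and same: "blk i' = blk i" for i j i' w
      proof (cases "i' = i")
        case False
        then show ?thesis using move[OF F[of w] ij o same, of 1] by simp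
      qed (use F in simp)
      have F0: "four_unit i j w \<in> W" for w by (rule all_z[OF Fz ij(1,2) o ij(3)])
      \<comment> \<open>Only the first index can be moved directly; \<open>four_unit_swap\<close>
        exchanges the two, so that the second can be moved in the same way.\<close>
      have target: "four_unit p q w \<in> W" if pq: "p < N" "q < N" "blk p = blk i" "blk q = blk j" for p q w
      proof -
        have F1: "four_unit p j w \<in> W" for w by (rule shift[OF F0 ij(1,2) pq(1) o pq(3)])
        have F2: "four_unit j p w \<in> W" for w
          using F1[of "- cnj w"] four_unit_swap[OF ij(2) pq(1), of w] by simp
        have "off c j p" using o pq unfolding off_def by metis
        then have "four_unit q p (- cnj w) \<in> W" by (intro shift[OF F2 ij(2) pq(1,2) _ pq(4)])
        then show ?thesis using four_unit_swap[OF pq(1,2), of w] by simp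
      qed
      have "four_unit p q w \<in> W" if pq: "p < N" "q < N" "off c p q" for p q w
      proof -
        have "blk p = blk i \<and> blk q = blk j \<or> blk q = blk i \<and> blk p = blk j"
          using pq(3) o third[of c "blk i" "blk j" "blk p"] third[of c "blk i" "blk j" "blk q"] unfolding off_def by metis
        then show ?thesis
          using target[OF pq(1,2)] target[OF pq(2,1)] four_unit_swap[OF pq(1,2), of w] by metis
      qed
      then have "entry_projection (off c) p q w \<in> W" if "p < N" "q < N" for p q w
        using that sub(2,4) by (simp add: entry_projection_def)
      then have "sp (off c) \<subseteq> W"
        using sp_decomposition[of _ "off c"] real_subspace_matrix_sum[OF W(1), of "{..<N} \<times> {..<N}"]
        by (smt (verit) SigmaE case_prod_conv finite_SigmaI finite_lessThan lessThan_iff subsetI)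
      with W(2) \<open>W \<noteq> sp (off c)\<close> show False by blast
    qed
  qed
qed

end

section \<open>Bases under scaling and linear isomorphism\<close>

lemma real_basis_real_smult:
  assumes B: "real_basis n V d b" and V: "real_subspace n V" and s: "s \<noteq> 0"
  shows "real_basis n V d (\<lambda>k. real_smult s (b k))"
proof -
  have b: "b k \<in> carrier_mat n n" if "k < d" for k using B that by (simp add: real_basis_def)
  have comb: "real_comb n d (\<lambda>k. real_smult s (b k)) c = real_comb n d b (\<lambda>k. s * c k)" for c
  proof (rule square_eqI[of _ n])
    fix i j assume ij: "i < n" "j < n"
    have "complex_of_real (c k) * real_smult s (b k) $$ (i, j) = complex_of_real (s * c k) * b k $$ (i, j)"
      if "k < d" for k using carrier_matD[OF b[OF that]] ij by simp
    then show "real_comb n d (\<lambda>k. real_smult s (b k)) c $$ (i, j) = real_comb n d b (\<lambda>k. s * c k) $$ (i, j)"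
      using ij by (simp only: real_comb_entry) (intro sum.cong, auto)
  qed simp_all
  have "bij_betw (\<lambda>c k. s * c k) (coefficients d) (coefficients d)"
    by (rule bij_betw_byWitness[of _ "\<lambda>c k. c k / s"]) (use s in \<open>auto simp: coefficients_def\<close>)
  from bij_betw_trans[OF this] B have "bij_betw (real_comb n d b \<circ> (\<lambda>c k. s * c k)) (coefficients d) V"
    unfolding real_basis_def by blast
  moreover have "real_comb n d b \<circ> (\<lambda>c k. s * c k) = real_comb n d (\<lambda>k. real_smult s (b k))"
    by (rule ext) (simp add: comb)
  ultimately show ?thesis using b by (simp add: real_basis_def)
qed

lemma matrix_sum_transport:
  assumes V: "real_subspace n V" and I: "finite I" "\<And>a. a \<in> I \<Longrightarrow> F a \<in> V"
    and add: "\<And>X Y. X \<in> V \<Longrightarrow> Y \<in> V \<Longrightarrow> \<phi> (X + Y) = \<phi> X + \<phi> Y"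
    and smult: "\<And>c X. X \<in> V \<Longrightarrow> \<phi> (real_smult c X) = real_smult c (\<phi> X)"
    and \<phi>: "\<And>X. X \<in> V \<Longrightarrow> \<phi> X \<in> carrier_mat n' n'"
  shows "\<phi> (matrix_sum n I F) = matrix_sum n' I (\<lambda>a. \<phi> (F a))"
proof -
  have z: "0\<^sub>m n n \<in> V" by (rule real_subspaceD(2)[OF V])
  have "real_smult 0 (0\<^sub>m n n) = 0\<^sub>m n n" by (rule square_eqI[of _ n]) auto
  then have "\<phi> (0\<^sub>m n n) = real_smult 0 (\<phi> (0\<^sub>m n n))" using smult[OF z, of 0] by simp
  also have "\<dots> = 0\<^sub>m n' n'" using carrier_matD[OF \<phi>[OF z]] \<phi>[OF z] by (intro square_eqI[of _ n']) auto
  finally have "\<phi> (0\<^sub>m n n) = 0\<^sub>m n' n'" .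
  with I show ?thesis
    by (induction I rule: finite_induct)
      (simp_all add: matrix_sum_empty matrix_sum_insert real_subspaceD[OF V] add real_subspace_matrix_sum[OF V] \<phi>)
qed

text \<open>Isomorphic algebras thus have bases of the same length, so the dimension can tell pairs
  apart.\<close>

lemma real_basis_transport:
  assumes B: "real_basis n V d b" and V: "real_subspace n V" and bij: "bij_betw \<phi> V V'"
    and add: "\<And>X Y. X \<in> V \<Longrightarrow> Y \<in> V \<Longrightarrow> \<phi> (X + Y) = \<phi> X + \<phi> Y"
    and smult: "\<And>c X. X \<in> V \<Longrightarrow> \<phi> (real_smult c X) = real_smult c (\<phi> X)"
    and V': "V' \<subseteq> carrier_mat n' n'"
  shows "real_basis n' V' d (\<phi> \<circ> b)"
proof -
  have \<phi>: "\<phi> X \<in> carrier_mat n' n'" if "X \<in> V" for X using bij V' that bij_betwE by blast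
  have bV: "b k \<in> V" if "k < d" for k by (rule real_basis_mem[OF B that])
  have "real_comb n' d (\<phi> \<circ> b) c = \<phi> (real_comb n d b c)" for c
  proof -
    have "real_comb n' d (\<phi> \<circ> b) c = matrix_sum n' {..<d} (\<lambda>k. real_smult (c k) ((\<phi> \<circ> b) k))"
      by (rule real_comb_eq_matrix_sum) (simp add: \<phi> bV)
    also have "\<dots> = matrix_sum n' {..<d} (\<lambda>k. \<phi> (real_smult (c k) (b k)))"
      unfolding matrix_sum_def by (simp add: smult bV)
    also have "\<dots> = \<phi> (matrix_sum n {..<d} (\<lambda>k. real_smult (c k) (b k)))"
      by (rule matrix_sum_transport[OF V _ _ add smult \<phi>, symmetric]) (auto intro: real_subspaceD(4)[OF V] bV)
    also have "\<dots> = \<phi> (real_comb n d b c)"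
      by (rule arg_cong[OF real_comb_eq_matrix_sum[symmetric]]) (rule real_subspaceD(1)[OF V bV])
    finally show ?thesis .
  qed
  then have "real_comb n' d (\<phi> \<circ> b) = \<phi> \<circ> real_comb n d b" by auto
  moreover have "bij_betw (\<phi> \<circ> real_comb n d b) (coefficients d) V'"
    using B bij bij_betw_trans unfolding real_basis_def by blast
  ultimately show ?thesis using \<phi> bV by (simp add: real_basis_def)
qed

section \<open>The parameters\<close>

context three_blocks begin

lemma orthonormal_parseval:
  assumes e: "orthonormal_basis N (sp full) (sp E) d e" and Z: "Z \<in> sp E"
  shows "k < d \<Longrightarrow> coord N d e Z k = ip N (sp full) Z (e k)"
    and "(\<Sum>k<d. (ip N (sp full) Z (e k))^2) = ip N (sp full) Z Z"
proof -
  have B: "real_basis N (sp E) d e" and on: "\<And>k l. k < d \<Longrightarrow> l < d \<Longrightarrow> ip N (sp full) (e k) (e l) = (if k = l then 1 else 0)"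
    using e unfolding orthonormal_basis_def by blast+
  have eV: "e k \<in> sp full" if "k < d" for k by (rule sp_full[OF real_basis_mem[OF B that]])
  let ?c = "coord N d e Z"
  have Zc: "real_comb N d e ?c = Z" by (rule coord_inverse(2)[OF B Z])
  have comb: "ip N (sp full) Z Y = (\<Sum>k<d. ?c k * ip N (sp full) (e k) Y)" if Y: "Y \<in> sp full" for Y
  proof -
    have "ip N (sp full) Z Y = (real N + 2) * frobenius N (real_comb N d e ?c) Y"
      unfolding Zc by (rule ip_sp[OF sp_full[OF Z] Y])
    also have "\<dots> = (\<Sum>k<d. ?c k * ((real N + 2) * frobenius N (e k) Y))"
      unfolding frobenius_real_comb by (simp add: sum_distrib_left mult.left_commute)
    finally show ?thesis using eV Y by (simp add: ip_sp)
  qed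
  have coord: "ip N (sp full) Z (e k) = ?c k" if k: "k < d" for k
  proof -
    have "ip N (sp full) Z (e k) = (\<Sum>l<d. if l = k then ?c l else 0)"
      unfolding comb[OF eV[OF k]] using k by (intro sum.cong) (auto simp: on)
    then show ?thesis using k by simp
  qed
  then show "k < d \<Longrightarrow> coord N d e Z k = ip N (sp full) Z (e k)" by simp
  have sym: "ip N (sp full) (e k) Z = ip N (sp full) Z (e k)" if "k < d" for k
    using ip_sp[OF eV[OF that] sp_full[OF Z]] ip_sp[OF sp_full[OF Z] eV[OF that]] by (simp add: frobenius_commute)
  show "(\<Sum>k<d. (ip N (sp full) Z (e k))^2) = ip N (sp full) Z Z"
    unfolding comb[OF sp_full[OF Z]] by (intro sum.cong refl) (simp add: sym coord power2_eq_square)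
qed

lemma ip_ad_skew:
  assumes "X \<in> sp full" "Y \<in> sp full" "Z \<in> sp full"
  shows "ip N (sp full) (lie_bracket X Y) Z = - ip N (sp full) Y (lie_bracket X Z)"
  using assms lie_bracket_quaternionic[of X full Y full] lie_bracket_quaternionic[of X full Z full]
  by (simp add: ip_sp frobenius_ad_skew)

lemma ip_commute: "X \<in> sp full \<Longrightarrow> Y \<in> sp full \<Longrightarrow> ip N (sp full) X Y = ip N (sp full) Y X"
  by (simp add: ip_sp frobenius_commute)

text \<open>The \<open>N + 2\<close> is the factor of the Killing form, the 2 comes from
  \<open>row_norm_off\<close>, and \<open>m\<close> from \<open>trace_off\<close>. For
  \<open>N = 6 * k\<close> and \<open>m = 2 * k\<close> it is
  \<open>k / (6 * k + 2)\<close>.\<close>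

definition wallach_constant :: real where
  "wallach_constant = real m / (2 * (real N + 2))"

text \<open>By Parseval and skewness of \<open>ad X\<close> the double sum is minus the trace of
  \<open>(ad X)^2\<close> on the module \<open>c'\<close>, which \<open>trace_off\<close> and
  \<open>row_norm_off\<close> evaluate.\<close>

lemma sum_brackets:
  assumes c: "c \<noteq> c'" "c' \<noteq> c''" "c'' \<noteq> c" and X: "X \<in> sp (off c)"
    and e': "orthonormal_basis N (sp full) (sp (off c')) d' e'"
    and e'': "orthonormal_basis N (sp full) (sp (off c'')) d'' e''"
  shows "(\<Sum>\<beta><d'. \<Sum>\<gamma><d''. (ip N (sp full) (lie_bracket X (e' \<beta>)) (e'' \<gamma>))^2) = wallach_constant * ip N (sp full) X X"
proof -
  have B: "real_basis N (sp (off c')) d' e'" using e' by (simp add: orthonormal_basis_def)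
  have inv: "lie_bracket X (lie_bracket X Z) \<in> sp (off c')" if "Z \<in> sp (off c')" for Z
  proof -
    have "lie_bracket X Z \<in> sp (off c'')" by (rule bracket_off_distinct[OF c X that])
    then show ?thesis using bracket_off_distinct[OF c(3)[symmetric] c(2)[symmetric] c(1)[symmetric] X] by blast
  qed
  have "(\<Sum>\<beta><d'. \<Sum>\<gamma><d''. (ip N (sp full) (lie_bracket X (e' \<beta>)) (e'' \<gamma>))^2) =
      (\<Sum>\<beta><d'. - coord N d' e' (lie_bracket X (lie_bracket X (e' \<beta>))) \<beta>)"
  proof (intro sum.cong refl)
    fix \<beta> assume "\<beta> \<in> {..<d'}"
    then have \<beta>: "\<beta> < d'" by simp
    have eb: "e' \<beta> \<in> sp (off c')" by (rule real_basis_mem[OF B \<beta>])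
    let ?Z = "lie_bracket X (e' \<beta>)"
    have Z: "?Z \<in> sp (off c'')" by (rule bracket_off_distinct[OF c X eb])
    have "(\<Sum>\<gamma><d''. (ip N (sp full) ?Z (e'' \<gamma>))^2) = ip N (sp full) ?Z ?Z"
      by (rule orthonormal_parseval(2)[OF e'' Z])
    also have "\<dots> = - ip N (sp full) (e' \<beta>) (lie_bracket X ?Z)"
      by (rule ip_ad_skew[OF sp_full[OF X] sp_full[OF eb] sp_full[OF Z]])
    also have "\<dots> = - ip N (sp full) (lie_bracket X ?Z) (e' \<beta>)"
      using ip_commute[OF sp_full[OF eb] sp_full[OF inv[OF eb]]] by simp
    also have "\<dots> = - coord N d' e' (lie_bracket X ?Z) \<beta>"
      using orthonormal_parseval(1)[OF e' inv[OF eb] \<beta>] by simp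
    finally show "(\<Sum>\<gamma><d''. (ip N (sp full) ?Z (e'' \<gamma>))^2) = - coord N d' e' (lie_bracket X ?Z) \<beta>" .
  qed
  also have "\<dots> = real m * (\<Sum>i<N. if blk i \<noteq> c' then row_norm X i else 0)"
  proof -
    have "X $$ (i, j) = 0" if "i < N" "j < N" "off c' i j" for i j
      using spD(3)[OF X that(1,2)] that(3) c(1) off_unique by blast
    from trace_off[OF B X this inv] show ?thesis by (simp add: sum_negf)
  qed
  also have "\<dots> = wallach_constant * ip N (sp full) X X"
    unfolding row_norm_off[OF X c(1)] ip_sp[OF sp_full[OF X] sp_full[OF X]] wallach_constant_def by (simp add: field_simps)
  finally show ?thesis .
qed

lemma exists_orthonormal_basis:
  obtains d e where "orthonormal_basis N (sp full) (sp E) d e"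
proof -
  obtain d b where B: "real_basis N (sp E) d b" and on: "frobenius_orthonormal N (sp E) d b"
    by (rule exists_frobenius_orthonormal_basis[OF real_subspace_sp])
  \<comment> \<open>The invariant inner product is \<open>N + 2\<close> times the Frobenius product,
    so this factor renormalizes a Frobenius-orthonormal basis.\<close>
  define s where "s = 1 / sqrt (real N + 2)"
  have s: "s \<noteq> 0" "(real N + 2) * (s * s) = 1" by (simp_all add: s_def)
  have "orthonormal_basis N (sp full) (sp E) d (\<lambda>k. real_smult s (b k))"
    unfolding orthonormal_basis_def
  proof (intro conjI allI impI)
    show "real_basis N (sp E) d (\<lambda>k. real_smult s (b k))"
      by (rule real_basis_real_smult[OF B real_subspace_sp s(1)])
    fix k l assume kl: "k < d" "l < d"
    have bV: "b k \<in> sp E" "b l \<in> sp E" using real_basis_mem[OF B] kl by blast+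
    have bV': "real_smult s (b k) \<in> sp full" "real_smult s (b l) \<in> sp full"
      using bV sp_full real_subspaceD(4)[OF real_subspace_sp] by blast+
    have "ip N (sp full) (real_smult s (b k)) (real_smult s (b l)) = (real N + 2) * (s * s) * frobenius N (b k) (b l)"
      unfolding ip_sp[OF bV'] frobenius_real_smult_left[OF spD(1)[OF bV(1)]] frobenius_real_smult_right[OF spD(1)[OF bV(2)]]
      by simp
    then show "ip N (sp full) (real_smult s (b k)) (real_smult s (b l)) = (if k = l then 1 else 0)"
      unfolding s(2) using on kl by (simp add: frobenius_orthonormal_def)
  qed
  then show thesis using that by blast
qed

lemma orthonormal_basis_nonempty:
  assumes "orthonormal_basis N (sp full) (sp (off c)) d e"
  shows "0 < d"
proof (rule ccontr)
  assume "\<not> 0 < d"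
  then have B: "real_basis N (sp (off c)) 0 e" using assms by (simp add: orthonormal_basis_def)
  have "X = 0\<^sub>m N N" if X: "X \<in> sp (off c)" for X
  proof -
    have "real_comb N 0 e (coord N 0 e X) $$ (i, j) = 0" if "i < N" "j < N" for i j using that by simp
    then show ?thesis
      unfolding coord_inverse(2)[OF B X] using spD(1)[OF X] by (intro square_eqI[of _ N]) auto
  qed
  then have "sp (off c) = {0\<^sub>m N N}" using real_subspaceD(2)[OF real_subspace_sp] by blast
  then show False using irreducible_off[of c] unfolding irreducible_Ad_module_def by blast
qed

lemma lie_algebra_full: "lie_algebra N (Sp full) = sp full"
  by (rule lie_algebra_Sp[OF block_relation_full])

text \<open>Invariance and skewness allow any of the three modules to be summed last. Each choice
  gives \<open>A\<close> as the constant times the dimension of that module, so all three quotients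
  agree without the dimensions being known beyond their positivity.\<close>

lemma wallach_parameters_Sp:
  "wallach_parameters N (Sp full) (\<lambda>c. sp (off c)) (\<lambda>_. wallach_constant)"
proof -
  have "\<forall>c. \<exists>d e. orthonormal_basis N (sp full) (sp (off c)) d e" using exists_orthonormal_basis by metis
  then obtain d e where e: "\<And>c. orthonormal_basis N (sp full) (sp (off c)) (d c) (e c)" by metis
  let ?ip = "ip N (sp full)"
  let ?A = "\<Sum>\<alpha><d 0. \<Sum>\<beta><d 1. \<Sum>\<gamma><d 2. (?ip (lie_bracket (e 0 \<alpha>) (e 1 \<beta>)) (e 2 \<gamma>))^2"
  have ne: "(0::3) \<noteq> 1" "(1::3) \<noteq> 2" "(2::3) \<noteq> 0" by simp_all
  have mem: "e c k \<in> sp (off c)" if "k < d c" for c k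
    using e[of c] that real_basis_mem unfolding orthonormal_basis_def by blast
  have unit: "?ip (e c k) (e c k) = 1" if "k < d c" for c k
    using e[of c] that unfolding orthonormal_basis_def by simp
  have swap: "(?ip (lie_bracket X Y) Z)^2 = (?ip (lie_bracket Y X) Z)^2"
    if "X \<in> sp full" "Y \<in> sp full" "Z \<in> sp full" for X Y Z
  proof -
    note br = lie_bracket_quaternionic[OF that(1,2)] lie_bracket_quaternionic[OF that(2,1)]
    have "?ip (lie_bracket X Y) Z = - ?ip (lie_bracket Y X) Z"
      unfolding ip_sp[OF br(1) that(3)] ip_sp[OF br(2) that(3)]
      unfolding lie_bracket_swap[OF spD(1)[OF that(1)] spD(1)[OF that(2)]]
        frobenius_real_smult_left[OF spD(1)[OF br(2)]] by simp
    then show ?thesis by simp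
  qed
  have cycle: "(?ip (lie_bracket X Y) Z)^2 = (?ip (lie_bracket Z X) Y)^2"
    if "X \<in> sp full" "Y \<in> sp full" "Z \<in> sp full" for X Y Z
  proof -
    have "?ip (lie_bracket X Y) Z = - ?ip (lie_bracket X Z) Y"
      using ip_ad_skew[OF that] ip_commute[OF that(2) lie_bracket_quaternionic[OF that(1,3)]] by simp
    then show ?thesis using swap[OF that(1,3,2)] by simp
  qed
  have A0: "?A = wallach_constant * real (d 0)"
  proof -
    have "?A = (\<Sum>\<alpha><d 0. wallach_constant * ?ip (e 0 \<alpha>) (e 0 \<alpha>))"
      by (rule sum.cong[OF refl], rule sum_brackets[OF ne _ e e]) (use mem in simp)
    then show ?thesis by (simp add: unit)
  qed
  have A1: "?A = wallach_constant * real (d 1)"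
  proof -
    have "?A = (\<Sum>\<beta><d 1. \<Sum>\<alpha><d 0. \<Sum>\<gamma><d 2. (?ip (lie_bracket (e 0 \<alpha>) (e 1 \<beta>)) (e 2 \<gamma>))^2)" by (rule sum.swap)
    also have "\<dots> = (\<Sum>\<beta><d 1. \<Sum>\<alpha><d 0. \<Sum>\<gamma><d 2. (?ip (lie_bracket (e 1 \<beta>) (e 0 \<alpha>)) (e 2 \<gamma>))^2)"
      by (intro sum.cong refl swap sp_full[OF mem]) auto
    also have "\<dots> = (\<Sum>\<beta><d 1. wallach_constant * ?ip (e 1 \<beta>) (e 1 \<beta>))"
      by (rule sum.cong[OF refl], rule sum_brackets[OF ne(1)[symmetric] ne(3)[symmetric] ne(2)[symmetric] _ e e]) (use mem in simp)
    finally show ?thesis by (simp add: unit)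
  qed
  have A2: "?A = wallach_constant * real (d 2)"
  proof -
    have "?A = (\<Sum>\<alpha><d 0. \<Sum>\<gamma><d 2. \<Sum>\<beta><d 1. (?ip (lie_bracket (e 0 \<alpha>) (e 1 \<beta>)) (e 2 \<gamma>))^2)"
      by (rule sum.cong[OF refl]) (rule sum.swap)
    also have "\<dots> = (\<Sum>\<gamma><d 2. \<Sum>\<alpha><d 0. \<Sum>\<beta><d 1. (?ip (lie_bracket (e 0 \<alpha>) (e 1 \<beta>)) (e 2 \<gamma>))^2)" by (rule sum.swap)
    also have "\<dots> = (\<Sum>\<gamma><d 2. \<Sum>\<alpha><d 0. \<Sum>\<beta><d 1. (?ip (lie_bracket (e 2 \<gamma>) (e 0 \<alpha>)) (e 1 \<beta>))^2)"
      by (intro sum.cong refl cycle sp_full[OF mem]) auto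
    also have "\<dots> = (\<Sum>\<gamma><d 2. wallach_constant * ?ip (e 2 \<gamma>) (e 2 \<gamma>))"
      by (rule sum.cong[OF refl], rule sum_brackets[OF ne(3,1,2) _ e e]) (use mem in simp)
    finally show ?thesis by (simp add: unit)
  qed
  have three: "c = 0 \<or> c = 1 \<or> c = (2::3)" for c using exhaust_3[of c] by auto
  have Ac: "?A = wallach_constant * real (d c)" for c using three[of c] A0 A1 A2 by metis
  have "wallach_constant = ?A / real (d c)" for c
    unfolding Ac[of c] using orthonormal_basis_nonempty[OF e[of c]] by simp
  moreover have "wallach_constant \<in> {0<..1/2}"
    using m_pos N_eq unfolding wallach_constant_def by (simp add: field_simps)
  ultimately show ?thesis
    unfolding wallach_parameters_def Let_def lie_algebra_full using e by blast
qed

lemma generalized_wallach_space_Sp: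
  "generalized_wallach_space N (Sp full) (Sp same) (\<lambda>c. sp (off c))"
  unfolding generalized_wallach_space_def Let_def lie_algebra_full lie_algebra_Sp[OF block_relation_same]
proof (intro conjI allI impI ballI)
  show "compact_lie_group N (Sp full)" by (rule compact_lie_group_Sp[OF block_relation_full])
  show "semisimple N (sp full)" by (rule semisimple_sp)
  show sub: "Sp same \<subseteq> Sp full" by (rule Sp_mono) simp
  show "closed_subgroup N (Sp full) (Sp same)" by (rule closed_subgroup_Sp[OF block_relation_same sub])
  show "almost_effective N (sp full) (sp same)" by (rule almost_effective_sp)
  show "orthogonal_complement N (sp full) (sp same) = {X 0 + X 1 + X 2 |X. \<forall>c. X c \<in> sp (off c)}"
    by (rule orthogonal_complement_same)
  show "irreducible_Ad_module N (Sp same) (sp (off c))" for c by (rule irreducible_off)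
qed (simp_all add: off_orthogonal bracket_off_off)

end

text \<open>
  Rows \<open>6 q + r\<close> with \<open>r < 6\<close>: the block is \<open>r mod 3\<close>, and \<open>r\<close> is paired with \<open>r \<plusminus> 3\<close>.
\<close>

definition partner :: "nat \<Rightarrow> nat" where
  "partner i = (if i mod 6 < 3 then i + 3 else i - 3)"

definition partner_sign :: "nat \<Rightarrow> complex" where
  "partner_sign i = (if i mod 6 < 3 then 1 else - 1)"

definition block :: "nat \<Rightarrow> 3" where
  "block i = (if i mod 3 = 0 then 0 else if i mod 3 = 1 then 1 else 2)"

lemma block_eq: "block i = 0 \<longleftrightarrow> i mod 3 = 0" "block i = 1 \<longleftrightarrow> i mod 3 = 1" "block i = 2 \<longleftrightarrow> i mod 3 = 2"
proof -
  have "i mod 3 = 0 \<or> i mod 3 = 1 \<or> i mod 3 = 2" by auto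
  then show "block i = 0 \<longleftrightarrow> i mod 3 = 0" "block i = 1 \<longleftrightarrow> i mod 3 = 1" "block i = 2 \<longleftrightarrow> i mod 3 = 2"
    by (auto simp: block_def)
qed

lemma partner_facts:
  shows "i < 6 * k \<Longrightarrow> partner i < 6 * k" and "partner (partner i) = i"
    and "partner i mod 6 < 3 \<longleftrightarrow> \<not> i mod 6 < 3" and "partner i mod 3 = i mod 3"
proof -
  define q r where "q = i div 6" and "r = i mod 6"
  have i: "i = 6 * q + r" "r < 6" by (simp_all add: q_def r_def)
  have p: "partner i = 6 * q + (if r < 3 then r + 3 else r - 3)"
    using i by (auto simp: partner_def)
  have r': "(if r < 3 then r + 3 else r - 3) < 6" "(if r < 3 then r + 3 else r - 3) < 3 \<longleftrightarrow> \<not> r < 3"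
    using i(2) by auto
  show "partner i mod 6 < 3 \<longleftrightarrow> \<not> i mod 6 < 3" using i r' unfolding p by simp
  show "partner (partner i) = i" unfolding partner_def[of "partner i"] using i r' unfolding p by auto
  show "partner i < 6 * k" if "i < 6 * k"
  proof -
    have "q < k" using that i by simp
    then have "6 * q + 6 \<le> 6 * k" by simp
    then show ?thesis using r'(1) unfolding p by linarith
  qed
  have "partner i = i + 3 \<or> partner i + 3 = i" using i p by auto
  then show "partner i mod 3 = i mod 3" by (metis mod_add_self2)
qed

lemma card_residue:
  assumes "s < 3"
  shows "card {i. i < 3 * n \<and> i mod 3 = s} = n"
proof (induction n)
  case (Suc n)
  have "{i. i < 3 * Suc n \<and> i mod 3 = s} = insert (3 * n + s) {i. i < 3 * n \<and> i mod 3 = s}"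
  proof (intro equalityI subsetI)
    fix i assume "i \<in> {i. i < 3 * Suc n \<and> i mod 3 = s}"
    then have i: "i < 3 * n + 3" "i mod 3 = s" by auto
    show "i \<in> insert (3 * n + s) {i. i < 3 * n \<and> i mod 3 = s}"
    proof (cases "i < 3 * n")
      case False
      then obtain t where t: "i = 3 * n + t" by (metis le_Suc_ex not_less)
      with i have "t < 3" "t = s" by auto
      then show ?thesis using t by simp
    qed (use i in simp)
  qed (use assms in auto)
  then show ?case using Suc by simp
qed simp

lemma three_blocks_instance:
  assumes k: "0 < k"
  shows "three_blocks (6 * k) partner partner_sign block (2 * k)"
proof
  show "partner i < 6 * k" if "i < 6 * k" for i using that by (rule partner_facts(1))
  show "partner (partner i) = i" for i by (rule partner_facts(2))
  show "partner_sign i * partner_sign i = 1" "partner_sign (partner i) = - partner_sign i" "cnj (partner_sign i) = partner_sign i" for i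
    using partner_facts(3)[of i] by (simp_all add: partner_sign_def)
  show "block (partner i) = block i" for i by (simp add: block_def partner_facts(4))
  show "card {i. i < 6 * k \<and> block i = c} = 2 * k" for c
  proof -
    have "3 * (2 * k) = 6 * k" by simp
    moreover have "c = 0 \<or> c = 1 \<or> c = 2" using exhaust_3[of c] by auto
    ultimately show ?thesis using card_residue[of _ "2 * k"] by (auto simp: block_eq)
  qed
qed (use k in simp)

text \<open>The data on bases are part of the statement because the dimension is the invariant that
  separates different \<open>k\<close>; at least one basis must exist for it to be usable.\<close>

lemma exists_wallach_space:
  assumes k: "0 < k"
  shows "\<exists>G H p. generalized_wallach_space (6 * k) G H p \<and>
    wallach_parameters (6 * k) G p (\<lambda>_. real k / (6 * real k + 2)) \<and>
    real_subspace (6 * k) (lie_algebra (6 * k) G) \<and>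
    (\<exists>d b. real_basis (6 * k) (lie_algebra (6 * k) G) d b) \<and>
    (\<forall>d b. real_basis (6 * k) (lie_algebra (6 * k) G) d b \<longrightarrow> 2 * d = 6 * k * (6 * k + 1))"
proof -
  interpret three_blocks "6 * k" partner partner_sign block "2 * k" by (rule three_blocks_instance[OF k])
  have "wallach_constant = real k / (6 * real k + 2)" unfolding wallach_constant_def by (simp add: field_simps)
  moreover obtain d b where "real_basis (6 * k) (sp full) d b"
    using exists_frobenius_orthonormal_basis[OF real_subspace_sp] by blast
  ultimately show ?thesis
    using generalized_wallach_space_Sp wallach_parameters_Sp real_subspace_sp[of full] dimension_sp_full
    unfolding lie_algebra_full[symmetric] by metis
qed

section \<open>Isomorphism classes of pairs\<close>

lemma pair_iso_refl: "(x, x) \<in> pair_iso"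
proof -
  obtain n G H where x: "x = (n, G, H)" by (cases x)
  show ?thesis unfolding x pair_iso_def by (auto intro!: exI[of _ id])
qed

lemma pair_iso_real_basis:
  assumes iso: "((n, G, H), (n', G', H')) \<in> pair_iso" and B: "real_basis n (lie_algebra n G) d b"
    and V: "real_subspace n (lie_algebra n G)"
  shows "\<exists>b'. real_basis n' (lie_algebra n' G') d b'"
proof -
  from iso obtain \<phi> where \<phi>: "bij_betw \<phi> (lie_algebra n G) (lie_algebra n' G') \<and>
        (\<forall>X\<in>lie_algebra n G. \<forall>Y\<in>lie_algebra n G. \<phi> (X + Y) = \<phi> X + \<phi> Y) \<and>
        (\<forall>c. \<forall>X\<in>lie_algebra n G. \<phi> (real_smult c X) = real_smult c (\<phi> X)) \<and>
        (\<forall>X\<in>lie_algebra n G. \<forall>Y\<in>lie_algebra n G. \<phi> (lie_bracket X Y) = lie_bracket (\<phi> X) (\<phi> Y)) \<and>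
        \<phi> ` lie_algebra n H = lie_algebra n' H'"
    unfolding pair_iso_def mem_Collect_eq prod.case by (rule exE)
  have "real_basis n' (lie_algebra n' G') d (\<phi> \<circ> b)"
  proof (rule real_basis_transport[OF B V \<phi>[THEN conjunct1]])
    show "\<phi> (X + Y) = \<phi> X + \<phi> Y" if "X \<in> lie_algebra n G" "Y \<in> lie_algebra n G" for X Y
      using \<phi>[THEN conjunct2, THEN conjunct1] that by blast
    show "\<phi> (real_smult c X) = real_smult c (\<phi> X)" if "X \<in> lie_algebra n G" for c X
      using \<phi>[THEN conjunct2, THEN conjunct2, THEN conjunct1] that by blast
    show "lie_algebra n' G' \<subseteq> carrier_mat n' n'" unfolding lie_algebra_def by blast
  qed
  then show ?thesis by blast
qed

text \<open>If the classes of \<open>f k\<close> and \<open>f l\<close> coincide, reflexivity puts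
  \<open>f l\<close> into the class of \<open>f k\<close>, whence \<open>k = l\<close>. So the
  quotient contains an injective image of the positive integers.\<close>

lemma infinite_quotientI:
  fixes f :: "nat \<Rightarrow> 'a"
  assumes mem: "\<And>k. 0 < k \<Longrightarrow> f k \<in> A" and refl: "\<And>x. (x, x) \<in> r"
    and inj: "\<And>k l. 0 < k \<Longrightarrow> 0 < l \<Longrightarrow> (f k, f l) \<in> r \<Longrightarrow> k = l"
  shows "infinite (A // r)"
proof
  assume fin: "finite (A // r)"
  have "inj_on (\<lambda>k. r `` {f k}) {0<..}"
    using inj refl by (intro inj_onI) (metis Image_singleton_iff greaterThan_iff)
  moreover have "(\<lambda>k. r `` {f k}) ` {0<..} \<subseteq> A // r" using mem by (auto intro: quotientI)
  ultimately have "finite {0::nat<..}" using fin by (metis finite_imageD finite_subset)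
  then show False using infinite_Ioi by blast
qed

theorem theorem1:
  shows "infinite ({(n, G, H) | n G H. \<exists>p a.
      generalized_wallach_space n G H p \<and> wallach_parameters n G p a \<and>
      (\<forall>T x. maximal_ricci_flow_solution a T x \<and> x 0 \<in> ricci_positive a \<and> inj (x 0) \<longrightarrow>
        (\<exists>t\<^sub>0 > 0. ereal t\<^sub>0 < T \<and>
          (\<forall>t. t\<^sub>0 \<le> t \<and> ereal t < T \<longrightarrow> x t \<notin> ricci_positive a)))} // pair_iso)"
    (is "infinite (?S // _)")
proof -
  let ?a = "\<lambda>k (_::3). real k / (6 * real k + 2)"
  define R where "R k t = (case t of (G, H, p) \<Rightarrow>
    generalized_wallach_space (6 * k) G H p \<and> wallach_parameters (6 * k) G p (?a k) \<and>
    real_subspace (6 * k) (lie_algebra (6 * k) G) \<and> (\<exists>d b. real_basis (6 * k) (lie_algebra (6 * k) G) d b) \<and>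
    (\<forall>d b. real_basis (6 * k) (lie_algebra (6 * k) G) d b \<longrightarrow> 2 * d = 6 * k * (6 * k + 1)))" for k t
  have "\<exists>t. 0 < k \<longrightarrow> R k t" for k
  proof (cases "0 < k")
    case True
    then obtain G H p where "R k (G, H, p)"
      using exists_wallach_space[OF True] unfolding R_def prod.case by (elim exE)
    then show ?thesis by blast
  qed simp
  then have "\<forall>k. \<exists>t. 0 < k \<longrightarrow> R k t" by blast
  from choice[OF this] obtain t where t: "\<And>k. 0 < k \<Longrightarrow> R k (t k)" by blast
  define G H p where "G k = fst (t k)" and "H k = fst (snd (t k))" and "p k = snd (snd (t k))" for k
  have R: "R k (G k, H k, p k)" if "0 < k" for k
    using t[OF that] by (simp add: G_def H_def p_def)
  note R' = R[unfolded R_def prod.case]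
  have W: "generalized_wallach_space (6 * k) (G k) (H k) (p k)" "wallach_parameters (6 * k) (G k) (p k) (?a k)"
    and V: "real_subspace (6 * k) (lie_algebra (6 * k) (G k))"
    and B: "\<exists>d b. real_basis (6 * k) (lie_algebra (6 * k) (G k)) d b" if "0 < k" for k
    using R'[OF that] by blast+
  have dim: "2 * d = 6 * k * (6 * k + 1)" if "0 < k" "real_basis (6 * k) (lie_algebra (6 * k) (G k)) d b" for k d b
    using R'[OF that(1)] that(2) by blast
  show ?thesis
  proof (rule infinite_quotientI[where f = "\<lambda>k. (6 * k, G k, H k)"])
    fix k :: nat assume k: "0 < k"
    have a: "0 < real k / (6 * real k + 2)" "real k / (6 * real k + 2) < 1 / 6"
      using k by (simp_all add: field_simps)
    show "(6 * k, G k, H k) \<in> ?S"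
    proof (intro CollectI exI conjI)
      show "(6 * k, G k, H k) = (6 * k, G k, H k)" by (rule refl)
      show "generalized_wallach_space (6 * k) (G k) (H k) (p k)" by (rule W(1)[OF k])
      show "wallach_parameters (6 * k) (G k) (p k) (?a k)" by (rule W(2)[OF k])
      show "\<forall>T x. maximal_ricci_flow_solution (?a k) T x \<and> x 0 \<in> ricci_positive (?a k) \<and> inj (x 0) \<longrightarrow>
        (\<exists>t\<^sub>0 > 0. ereal t\<^sub>0 < T \<and> (\<forall>t. t\<^sub>0 \<le> t \<and> ereal t < T \<longrightarrow> x t \<notin> ricci_positive (?a k)))"
        using positive_ricci_lost[OF a] by blast
    qed
  next
    fix k l :: nat assume kl: "0 < k" "0 < l" and iso: "((6 * k, G k, H k), (6 * l, G l, H l)) \<in> pair_iso"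
    \<comment> \<open>A basis carried over by the isomorphism has the same length, so the dimensions
      \<open>3 * k * (6 * k + 1)\<close> and \<open>3 * l * (6 * l + 1)\<close> agree; this
      expression is strictly increasing.\<close>
    obtain d b where b: "real_basis (6 * k) (lie_algebra (6 * k) (G k)) d b" using B[OF kl(1)] by blast
    obtain b' where "real_basis (6 * l) (lie_algebra (6 * l) (G l)) d b'"
      using pair_iso_real_basis[OF iso b V[OF kl(1)]] by blast
    then have eq: "6 * k * (6 * k + 1) = 6 * l * (6 * l + 1)" using dim[OF kl(1) b] dim[OF kl(2)] by simp
    have mono: "6 * x * (6 * x + 1) < 6 * y * (6 * y + 1)" if "x < y" for x y :: nat
      proof -
        have "6 * x * (6 * x + 1) \<le> 6 * x * (6 * y + 1)" using that by (intro mult_le_mono) auto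
        also have "\<dots> < 6 * y * (6 * y + 1)" using that by (intro mult_strict_right_mono) auto
        finally show ?thesis .
      qed
    show "k = l"
    proof (rule ccontr)
      assume "k \<noteq> l"
      then consider "k < l" | "l < k" by linarith
      then show False using mono[of k l] mono[of l k] eq by cases simp_all
    qed
  qed (rule pair_iso_refl)
qed

end
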